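(* In the setting described in the context (Snake model with $\beta=1$, sub-Gaussian noise, kernel $K$ satisfying the kernel assumption, nearest neighbor estimator $\hat f$), assume $$\Big(\frac{n}{\log n}\Big)^{-\frac14}\preccurlyeq T\preccurlyeq n\,(\log n)^{\frac14}.$$ (i) Let $\delta\ge0$, potentially changing with $n$, and let $\mathcal X:=\mathrm B^d(u^\star([0,T]),\delta)$. Then $$\mathbf E\Big[\sup_{x\in\mathcal X}\|\hat f(x)-f^\star(x)\|_2^2\Big]\preccurlyeq\delta^2+\Big(\frac{T\log n}{n}\Big)^{\frac25}.$$ (ii) Let $\delta:=\sup_{x\in[0,1]^d}\inf_{t\in[0,T]}\|u^\star(t)-x\|_2$. Then $$\mathbf E\Big[\sup_{x\in[0,1]^d}\|\hat f(x)-f^\star(x)\|_2^2\Big]\preccurlyeq\delta^2+\Big(\frac{T\log n}{n}\Big)^{\frac25}.$$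
   Context: Asymptotic notation (as $n\to\infty$): $a_n\preccurlyeq b_n$ means $\limsup_{n\to\infty} a_n/b_n<\infty$; $a_n\asymp b_n$ means $a_n\preccurlyeq b_n$ and $b_n\preccurlyeq a_n$. The quantities $d,L_0,L_1,\sigma,K$ are fixed; all other quantities may vary with $n$. Flow: for Lipschitz $f\colon\mathbb R^d\to\mathbb R^d$, $U(f,x,\cdot)$ is the unique solution $u$ of $\dot u(t)=f(u(t))$, $u(0)=x$. For $\mathcal Z\subseteq\mathbb R^d$ and $r\ge0$, $\mathrm B^d(\mathcal Z,r)$ is the union of the closed Euclidean balls of radius $r$ centered at the points of $\mathcal Z$. Model: $d\ge2$ integer, $L_0,L_1>0$; $\mathcal F$ is the set of continuously differentiable $f\colon\mathbb R^d\to\mathbb R^d$ with $\sup_x\|f(x)\|_2\le L_0$, $\sup_x\|Df(x)\|_{\mathsf{op}}\le L_1$; $f^\star\in\mathcal F$; $x_1\in\mathbb R^d$; $n\in\mathbb N$; $\Delta t>0$; $t_i:=i\Delta t$; $T:=n\Delta t$; $u^\star:=U(f^\star,x_1,\cdot)$. Let $\sigma\ge0$ and let $\varepsilon_1,\dots,\varepsilon_n$ be independent $\mathbb R^d$-valued with $\mathbf E[\varepsilon_i]=0$, $\mathbf E[\|\varepsilon_i\|_2^2]\le\sigma^2$. Observe $Y_i:=u^\star(t_i)+\varepsilon_i$, $i=1,\dots,n$. Sub-Gaussian assumption: each component $Z$ of each $\varepsilon_i$ satisfies $\mathbf P(|Z-\mathbf E Z|\ge t)\le2\exp(-t^2/(2\sigma^2))$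 for all $t>0$. Kernel assumption: $K\colon[0,\infty)\to\mathbb R$ is Lipschitz continuous, nonnegative, not identically zero, and there is $C_{\mathsf{ker}}>0$ with $K(z)\le C_{\mathsf{ker}}\mathbf 1_{[0,1]}(z)$ for all $z\ge0$. Estimator: for $t\in[0,T]$ and bandwidth $h>0$ let $(\hat\theta_0(t),\hat\theta_1(t))\in\arg\min_{\theta_0,\theta_1\in\mathbb R^d}\sum_{i=1}^n\|Y_i-\theta_0-\theta_1\frac{t_i-t}{h}\|_2^2\,K(|t_i-t|/h)$ (componentwise local linear regression). Set $\hat u(t):=\hat\theta_0(t)$ and $\hat{\dot u}(t):=h^{-1}\hat\theta_1(t)$, estimators of $u^\star$ and $\dot u^\star$. The bandwidth is chosen of the optimal order for the sup-norm error, $h\asymp(T\log(n)/n)^{1/5}$, with suitable implied constants. For continuous $u\colon[0,T]\to\mathbb R^d$ let $t_{\mathsf{NN}}(u,T,x)\in\arg\min_{t\in[0,T]}\|u(t)-x\|_2$ (arbitrary choice if not unique). Define $\hat f(x):=\hat{\dot u}(t_{\mathsf{NN}}(\hat u,T,x))$. *)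

theory Defs
  imports "HOL-Probability.Probability"
begin

text \<open>
  Sequences are indexed by \<open>n\<close>. They take values in \<open>ennreal\<close>, so that a risk may be infinite for
  small \<open>n\<close>; nonnegative real sequences are embedded by \<^const>\<open>ennreal\<close>.
\<close>

definition asymp_le :: "(nat \<Rightarrow> ennreal) \<Rightarrow> (nat \<Rightarrow> ennreal) \<Rightarrow> bool"  (infix "\<preceq>" 50) where
  "a \<preceq> b \<longleftrightarrow> limsup (\<lambda>n. a n / b n) < \<infinity>"

definition asymp_eq :: "(nat \<Rightarrow> ennreal) \<Rightarrow> (nat \<Rightarrow> ennreal) \<Rightarrow> bool"  (infix "\<asymp>" 50) where
  "a \<asymp> b \<longleftrightarrow> a \<preceq> b \<and> b \<preceq> a"

text \<open>
  The supremum of the squared error over an uncountable set, with arbitrary (possibly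
  non-measurable) choices of minimisers, need not be measurable. The library's
  \<^const>\<open>nn_integral\<close> is then a lower integral, so the upper integral is used to state upper bounds.
\<close>

definition outer_expectation :: "'w measure \<Rightarrow> ('w \<Rightarrow> ennreal) \<Rightarrow> ennreal" where
  "outer_expectation M X =
     (INF g \<in> {g \<in> borel_measurable M. \<forall>\<omega> \<in> space M. X \<omega> \<le> g \<omega>}. \<integral>\<^sup>+ \<omega>. g \<omega> \<partial>M)"

lemma outer_expectation_measurable:
  assumes "X \<in> borel_measurable M"
  shows "outer_expectation M X = (\<integral>\<^sup>+ \<omega>. X \<omega> \<partial>M)"
  unfolding outer_expectation_def
proof (rule antisym)
  show "(INF g \<in> {g \<in> borel_measurable M. \<forall>\<omega> \<in> space M. X \<omega> \<le> g \<omega>}. \<integral>\<^sup>+ \<omega>. g \<omega> \<partial>M)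
          \<le> (\<integral>\<^sup>+ \<omega>. X \<omega> \<partial>M)"
    using assms by (intro INF_lower) auto
  show "(\<integral>\<^sup>+ \<omega>. X \<omega> \<partial>M)
          \<le> (INF g \<in> {g \<in> borel_measurable M. \<forall>\<omega> \<in> space M. X \<omega> \<le> g \<omega>}. \<integral>\<^sup>+ \<omega>. g \<omega> \<partial>M)"
    by (intro INF_greatest nn_integral_mono) auto
qed

text \<open>The norm on \<open>\<Rightarrow>\<^sub>L\<close> is the operator norm.\<close>

definition snake_class :: "real \<Rightarrow> real \<Rightarrow> (real ^ 'd \<Rightarrow> real ^ 'd) set" where
  "snake_class L\<^sub>0 L\<^sub>1 =
     {f. \<exists>Df :: real ^ 'd \<Rightarrow> ((real ^ 'd) \<Rightarrow>\<^sub>L (real ^ 'd)).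
           continuous_on UNIV Df \<and>
           (\<forall>x. (f has_derivative blinfun_apply (Df x)) (at x)) \<and>
           (\<forall>x. norm (f x) \<le> L\<^sub>0) \<and> (\<forall>x. norm (Df x) \<le> L\<^sub>1)}"

text \<open>
  For Lipschitz \<open>f\<close> the function \<open>u\<close> exists and is uniquely determined on \<open>[0,\<infinity>)\<close>.
\<close>

definition is_flow :: "(real ^ 'd \<Rightarrow> real ^ 'd) \<Rightarrow> real ^ 'd \<Rightarrow> (real \<Rightarrow> real ^ 'd) \<Rightarrow> bool" where
  "is_flow f x u \<longleftrightarrow>
     u 0 = x \<and> (\<forall>t\<ge>0. (u has_vector_derivative f (u t)) (at t within {0..}))"

text \<open>
  For \<open>\<sigma> = 0\<close> the tail bound reads \<open>\<le> 2\<close> because of \<open>t / 0 = 0\<close>; the moment condition then still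
  forces \<open>\<epsilon> i = 0\<close> almost surely.
\<close>

definition subgaussian_noise ::
  "real \<Rightarrow> nat \<Rightarrow> 'w measure \<Rightarrow> (nat \<Rightarrow> 'w \<Rightarrow> real ^ 'd) \<Rightarrow> bool" where
  "subgaussian_noise \<sigma> n M \<epsilon> \<longleftrightarrow>
     prob_space M \<and>
     prob_space.indep_vars M (\<lambda>_. borel) \<epsilon> {1..n} \<and>
     (\<forall>i\<in>{1..n}.
        integrable M (\<epsilon> i) \<and> integral\<^sup>L M (\<epsilon> i) = 0 \<and>
        integrable M (\<lambda>\<omega>. (norm (\<epsilon> i \<omega>))\<^sup>2) \<and>
        integral\<^sup>L M (\<lambda>\<omega>. (norm (\<epsilon> i \<omega>))\<^sup>2) \<le> \<sigma>\<^sup>2 \<and>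
        (\<forall>j. \<forall>t>0.
           measure M {\<omega> \<in> space M. \<bar>\<epsilon> i \<omega> $ j - integral\<^sup>L M (\<lambda>\<omega>'. \<epsilon> i \<omega>' $ j)\<bar> \<ge> t}
             \<le> 2 * exp (- t\<^sup>2 / (2 * \<sigma>\<^sup>2))))"

definition snake_model ::
  "real \<Rightarrow> real \<Rightarrow> real \<Rightarrow> nat \<Rightarrow> (real ^ 'd \<Rightarrow> real ^ 'd) \<Rightarrow> real ^ 'd \<Rightarrow> (real \<Rightarrow> real ^ 'd) \<Rightarrow>
   'w measure \<Rightarrow> (nat \<Rightarrow> 'w \<Rightarrow> real ^ 'd) \<Rightarrow> bool" where
  "snake_model L\<^sub>0 L\<^sub>1 \<sigma> n f x\<^sub>1 u M \<epsilon> \<longleftrightarrow>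
     f \<in> snake_class L\<^sub>0 L\<^sub>1 \<and> is_flow f x\<^sub>1 u \<and> subgaussian_noise \<sigma> n M \<epsilon>"

definition observation ::
  "real \<Rightarrow> (real \<Rightarrow> real ^ 'd) \<Rightarrow> (nat \<Rightarrow> 'w \<Rightarrow> real ^ 'd) \<Rightarrow> 'w \<Rightarrow> nat \<Rightarrow> real ^ 'd" where
  "observation \<Delta>t u \<epsilon> \<omega> i = u (real i * \<Delta>t) + \<epsilon> i \<omega>"

definition admissible_kernel :: "(real \<Rightarrow> real) \<Rightarrow> bool" where
  "admissible_kernel K \<longleftrightarrow>
     (\<exists>L. L-lipschitz_on {0..} K) \<and> (\<forall>z\<ge>0. K z \<ge> 0) \<and> (\<exists>z\<ge>0. K z \<noteq> 0) \<and>
     (\<exists>C>0. \<forall>z\<ge>0. K z \<le> C * indicator {0..1} z)"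

definition local_linear_loss ::
  "(real \<Rightarrow> real) \<Rightarrow> real \<Rightarrow> nat \<Rightarrow> real \<Rightarrow> (nat \<Rightarrow> real ^ 'd) \<Rightarrow> real \<Rightarrow>
   (real ^ 'd) \<times> (real ^ 'd) \<Rightarrow> real" where
  "local_linear_loss K h n \<Delta>t Y t = (\<lambda>(\<theta>\<^sub>0, \<theta>\<^sub>1).
     \<Sum>i = 1..n. (norm (Y i - \<theta>\<^sub>0 - ((real i * \<Delta>t - t) / h) *\<^sub>R \<theta>\<^sub>1))\<^sup>2 *
        K (\<bar>real i * \<Delta>t - t\<bar> / h))"

text \<open>\<open>\<theta>\<^sub>0\<close> and \<open>\<theta>\<^sub>1\<close> are an arbitrary choice of minimisers, one for every \<open>t\<close>.\<close>

definition local_linear_fit ::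
  "(real \<Rightarrow> real) \<Rightarrow> real \<Rightarrow> nat \<Rightarrow> real \<Rightarrow> (nat \<Rightarrow> real ^ 'd) \<Rightarrow>
   (real \<Rightarrow> real ^ 'd) \<Rightarrow> (real \<Rightarrow> real ^ 'd) \<Rightarrow> bool" where
  "local_linear_fit K h n \<Delta>t Y \<theta>\<^sub>0 \<theta>\<^sub>1 \<longleftrightarrow>
     (\<forall>t\<in>{0..real n * \<Delta>t}.
        is_arg_min (local_linear_loss K h n \<Delta>t Y t) (\<lambda>_. True) (\<theta>\<^sub>0 t, \<theta>\<^sub>1 t))"

definition nearest_neighbor_choice ::
  "((real \<Rightarrow> real ^ 'd) \<Rightarrow> real \<Rightarrow> real ^ 'd \<Rightarrow> real) \<Rightarrow> bool" where
  "nearest_neighbor_choice t_NN \<longleftrightarrow>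
     (\<forall>u T x. T \<ge> 0 \<and> continuous_on {0..T} u \<longrightarrow>
        is_arg_min (\<lambda>t. norm (u t - x)) (\<lambda>t. t \<in> {0..T}) (t_NN u T x))"

text \<open>Here \<open>\<theta>\<^sub>0\<close> is the estimator of \<open>u\<close> and \<open>\<theta>\<^sub>1 / h\<close> the estimator of its derivative.\<close>

definition nn_estimator ::
  "((real \<Rightarrow> real ^ 'd) \<Rightarrow> real \<Rightarrow> real ^ 'd \<Rightarrow> real) \<Rightarrow> real \<Rightarrow> real \<Rightarrow>
   (real \<Rightarrow> real ^ 'd) \<Rightarrow> (real \<Rightarrow> real ^ 'd) \<Rightarrow> real ^ 'd \<Rightarrow> real ^ 'd" where
  "nn_estimator t_NN T h \<theta>\<^sub>0 \<theta>\<^sub>1 x = (1 / h) *\<^sub>R \<theta>\<^sub>1 (t_NN \<theta>\<^sub>0 T x)"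

definition sup_risk ::
  "'w measure \<Rightarrow> (real ^ 'd) set \<Rightarrow> ('w \<Rightarrow> real ^ 'd \<Rightarrow> real ^ 'd) \<Rightarrow>
   (real ^ 'd \<Rightarrow> real ^ 'd) \<Rightarrow> ennreal" where
  "sup_risk M X fhat f =
     outer_expectation M (\<lambda>\<omega>. SUP x\<in>X. ennreal ((norm (fhat \<omega> x - f x))\<^sup>2))"

text \<open>
  Bandwidths of the optimal order. That the implied constants are suitable is made explicit: the
  window contains sufficiently many design points (\<open>h \<ge> C \<Delta>t\<close>) and does not exceed a small
  multiple of the observation horizon (\<open>h \<le> c T\<close>); the kernel may vanish near \<open>0\<close>.
  The two restrictions on the growth of \<open>T\<close> in the theorem are what makes both compatible with
  the order of \<open>h\<close>.
\<close>

definition optimal_bandwidth ::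
  "real \<Rightarrow> real \<Rightarrow> (nat \<Rightarrow> real) \<Rightarrow> (nat \<Rightarrow> real) \<Rightarrow> (nat \<Rightarrow> real) \<Rightarrow> bool" where
  "optimal_bandwidth c C \<Delta>t T h \<longleftrightarrow>
     (\<forall>n\<ge>1. h n > 0) \<and>
     (\<lambda>n. ennreal (h n)) \<asymp> (\<lambda>n. ennreal ((T n * ln (real n) / real n) powr (1 / 5))) \<and>
     (\<forall>\<^sub>F n in sequentially. C * \<Delta>t n \<le> h n \<and> h n \<le> c * T n)"

end

(*
The estimator is linear in the data, and the lower bound on the design form turns the normal
equations into an energy estimate: the errors of the estimated curve and of h times its estimated
derivative are bounded, uniformly in time, by a bias of order h^2 plus kernel-weighted sums of the
noise divided by the number N = h / \<Delta>t of design points in a window. Sub-Gaussian concentration on a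
grid of n^2 + 1 time points and Lipschitz interpolation bound the mean square of the supremum of
these sums by a multiple of N log n. The nearest neighbour rule transfers the curve error through
the Lipschitz continuity of f, so the squared error is of order
\<delta>^2 + h^2 + \<Delta>t log n / h^3, and for h of order (\<Delta>t log n)^(1/5) the last two terms balance.
*)
theory Submission imports Defs begin

text \<open>Two obstacles shape the statements. The supremum of the error need not be measurable, so
  every stochastic bound is pathwise: an explicit measurable variable \<open>W\<close> with mean of
  order log n dominates the squared noise sums divided by N for all times and all outcomes at once,
  and \<open>W\<close> alone is integrated. And the limsup compares different models for different
  n, so each constant is obtained before n, the design, the probability space and the field are
  fixed. The kernel may vanish near 0, so the design bound cannot rely on the points next to t. It
  uses an interval [a, b] on which K is at least \<kappa>, placed on the side of t that has room;
  \<open>h \<le> T / 2\<close> guarantees such a side, and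
  \<open>h \<ge> 6 / (b - a) * \<Delta>t\<close> puts at least two sampling steps into each third of
  the interval. This is the origin of the two bandwidth constants in the theorem. Uniqueness of the
  fit matters beyond the error bound: the nearest neighbour time is specified only for continuous
  curves, and minimisers chosen separately for each t form such a curve because each of them is
  forced.\<close>

section \<open>Exponential moments of sub-Gaussian sums\<close>

text \<open>Summation over integer levels: exp Y is at most the sum of e^(k+1) over all k \<le> Y.
  The divisor 6 turns the Gaussian tail at level k into 2 e^(-3k), which leaves a geometric series
  of ratio e^(-2); any divisor above 2 would give a finite moment.\<close>

lemma nn_integral_exp_square_le_of_tail:
  fixes Z :: "'w \<Rightarrow> real"
  assumes "prob_space M" and [measurable]: "Z \<in> borel_measurable M" and "\<tau> > 0"
    and tail: "\<And>t. t > 0 \<Longrightarrow>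
      measure M {\<omega> \<in> space M. t \<le> \<bar>Z \<omega>\<bar>} \<le> 2 * exp (- t\<^sup>2 / (2 * \<tau>\<^sup>2))"
  shows "(\<integral>\<^sup>+ \<omega>. ennreal (exp ((Z \<omega>)\<^sup>2 / (6 * \<tau>\<^sup>2))) \<partial>M) \<le> ennreal (2 * exp 1 / (1 - exp (- 2)))"
proof -
  interpret prob_space M by fact
  define Y where "Y \<omega> = (Z \<omega>)\<^sup>2 / (6 * \<tau>\<^sup>2)" for \<omega>
  have [measurable]: "Y \<in> borel_measurable M"
    unfolding Y_def by measurable
  define A where "A k = {\<omega> \<in> space M. real k \<le> Y \<omega>}" for k :: nat
  have A[measurable]: "A k \<in> sets M" for k
    unfolding A_def by measurable
  have pr: "prob (A k) \<le> 2 * exp (- 3 * real k)" for k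
  \<comment> \<open>The tail hypothesis speaks of positive thresholds only, so level 0 gets the
    trivial bound.\<close>
  proof (cases "k = 0")
    case True
    have "prob (A k) \<le> 1" by (rule prob_le_1)
    also have "\<dots> \<le> 2 * exp (- 3 * real k)" using True by simp
    finally show ?thesis .
  next
    case False
    define t where "t = sqrt (6 * real k) * \<tau>"
    have t: "t > 0" using False \<open>\<tau> > 0\<close> by (simp add: t_def)
    have t2: "t\<^sup>2 = 6 * real k * \<tau>\<^sup>2"
      by (simp add: t_def power_mult_distrib)
    have "A k = {\<omega> \<in> space M. t \<le> \<bar>Z \<omega>\<bar>}"
    proof -
      have "real k \<le> Y \<omega> \<longleftrightarrow> t \<le> \<bar>Z \<omega>\<bar>" for \<omega>
      proof -
        have "real k \<le> Y \<omega> \<longleftrightarrow> t\<^sup>2 \<le> (Z \<omega>)\<^sup>2"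
          using \<open>\<tau> > 0\<close> by (simp add: Y_def t2 field_simps)
        also have "\<dots> \<longleftrightarrow> t \<le> \<bar>Z \<omega>\<bar>"
          using t abs_le_square_iff[of t "Z \<omega>"] by simp
        finally show ?thesis .
      qed
      then show ?thesis by (simp add: A_def)
    qed
    then have "prob (A k) \<le> 2 * exp (- t\<^sup>2 / (2 * \<tau>\<^sup>2))" using tail[OF t] by simp
    also have "- t\<^sup>2 / (2 * \<tau>\<^sup>2) = - 3 * real k"
      using \<open>\<tau> > 0\<close> by (simp add: t2)
    finally show ?thesis .
  qed
  have pw: "ennreal (exp (Y \<omega>)) \<le> (\<Sum>k. ennreal (exp (real k + 1)) * indicator (A k) \<omega>)"
    if "\<omega> \<in> space M" for \<omega>
  proof -
    have Y0: "Y \<omega> \<ge> 0" by (simp add: Y_def)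
    define k where "k = nat \<lfloor>Y \<omega>\<rfloor>"
    have k: "real k \<le> Y \<omega>" "Y \<omega> \<le> real k + 1"
      using Y0 by (auto simp: k_def)
    have "ennreal (exp (Y \<omega>)) \<le> ennreal (exp (real k + 1)) * indicator (A k) \<omega>"
      using k that by (auto simp: A_def intro!: ennreal_leI)
    also have "\<dots> = (\<Sum>j\<in>{k}. ennreal (exp (real j + 1)) * indicator (A j) \<omega>)"
      by (subst sum.insert) simp_all
    also have "\<dots> \<le> (\<Sum>k. ennreal (exp (real k + 1)) * indicator (A k) \<omega>)"
      by (rule sum_le_suminf) auto
    finally show ?thesis .
  qed
  have "(\<integral>\<^sup>+ \<omega>. ennreal (exp (Y \<omega>)) \<partial>M)
      \<le> (\<integral>\<^sup>+ \<omega>. (\<Sum>k. ennreal (exp (real k + 1)) * indicator (A k) \<omega>) \<partial>M)"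
    by (intro nn_integral_mono pw)
  also have "\<dots> = (\<Sum>k. \<integral>\<^sup>+ \<omega>. ennreal (exp (real k + 1)) * indicator (A k) \<omega> \<partial>M)"
    by (rule nn_integral_suminf) measurable
  also have "\<dots> = (\<Sum>k. ennreal (exp (real k + 1)) * emeasure M (A k))"
    by (simp add: nn_integral_cmult_indicator)
  also have "\<dots> \<le> (\<Sum>k. ennreal (2 * exp 1 * exp (- 2) ^ k))"
  proof (intro suminf_le summableI)
    fix k
    have "ennreal (exp (real k + 1)) * emeasure M (A k)
        = ennreal (exp (real k + 1) * prob (A k))"
      by (simp add: emeasure_eq_measure ennreal_mult')
    also have "exp (real k + 1) * prob (A k) \<le> exp (real k + 1) * (2 * exp (- 3 * real k))"
      using pr[of k] by (intro mult_left_mono) auto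
    also have "\<dots> = 2 * exp 1 * exp (- 2) ^ k"
    proof -
      have "exp (- 2) ^ k = exp (real k * (- 2))" by (rule exp_of_nat_mult[symmetric])
      moreover have "exp (real k + 1) * exp (- 3 * real k) = exp 1 * exp (real k * (- 2))"
        by (simp flip: exp_add)
      ultimately show ?thesis by simp
    qed
    finally show "ennreal (exp (real k + 1)) * emeasure M (A k) \<le> ennreal (2 * exp 1 * exp (- 2) ^ k)"
      by (simp add: ennreal_leI)
  qed
  also have "\<dots> = ennreal (2 * exp 1 / (1 - exp (- 2)))"
  proof -
    have "(\<lambda>k. 2 * exp 1 * exp (- 2 :: real) ^ k) sums (2 * exp 1 * (1 / (1 - exp (- 2))))"
      by (intro sums_mult geometric_sums) simp
    then show ?thesis by (intro suminf_ennreal_eq) auto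
  qed
  finally show ?thesis by (simp add: Y_def)
qed

text \<open>For a centred variable the linear term has mean zero, so the moment generating function
  is controlled by the exponential moment of the square, with no first-order term left.\<close>

lemma exp_le_self_plus_exp_square: "exp x \<le> x + exp (x\<^sup>2)" for x :: real
proof -
  have q: "1 + x\<^sup>2 \<le> exp (x\<^sup>2)" by (rule exp_ge_add_one_self)
  consider "x \<ge> 1" | "0 \<le> x" "x \<le> 1" | "x \<le> 0" by linarith
  then show ?thesis
  proof cases
    case 1
    then have "x \<le> x\<^sup>2" by (simp add: power2_eq_square)
    then have "exp x \<le> exp (x\<^sup>2)" by simp
    with 1 show ?thesis by linarith
  next
    case 2
    with exp_bound[of x] q show ?thesis by linarith
  next
    case 3
    define y where "y = - x"
    have y: "y \<ge> 0" using 3 by (simp add: y_def)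
    \<comment> \<open>The reciprocal of the quadratic Taylor polynomial at y is at most the one at
      -y, because their product is 1 + y^4 / 4.\<close>
    have "1 \<le> (1 + y + y\<^sup>2 / 2) * (1 - y + y\<^sup>2 / 2)"
    proof -
      have "(1 + y + y\<^sup>2 / 2) * (1 - y + y\<^sup>2 / 2) = 1 + (y\<^sup>2)\<^sup>2 / 4"
        by (simp add: algebra_simps power2_eq_square)
      then show ?thesis by simp
    qed
    also have "\<dots> \<le> exp y * (1 - y + y\<^sup>2 / 2)"
    proof (rule mult_right_mono)
      show "1 + y + y\<^sup>2 / 2 \<le> exp y" by (rule exp_lower_Taylor_quadratic[OF y])
      have *: "1 - y + y\<^sup>2 / 2 = ((1 - y)\<^sup>2 + 1) / 2" by (simp add: power2_eq_square algebra_simps)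
      show "0 \<le> 1 - y + y\<^sup>2 / 2" unfolding * by simp
    qed
    finally have "exp x \<le> 1 - y + y\<^sup>2 / 2"
      by (simp add: y_def exp_minus field_simps)
    also have "\<dots> \<le> x + (1 + x\<^sup>2)" by (simp add: y_def)
    finally show ?thesis using q by linarith
  qed
qed

text \<open>With a = l^2 s there are two regimes. For a \<le> 1, centring and convexity of exp give
  1 + a G, which is quadratic in l. For a > 1, Young's inequality gives e^a G, and the prefactor
  moves into the exponent by G \<le> e^(G-1) and (a-1)(G-1) \<ge> 0.\<close>

lemma nn_integral_exp_le_of_exp_square:
  fixes Z :: "'w \<Rightarrow> real"
  assumes "prob_space M" and Z: "integrable M Z" "integral\<^sup>L M Z = 0" and "s > 0" and "G \<ge> 1"
    and le: "(\<integral>\<^sup>+ \<omega>. ennreal (exp ((Z \<omega>)\<^sup>2 / s)) \<partial>M) \<le> ennreal G"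
  shows "(\<integral>\<^sup>+ \<omega>. ennreal (exp (l * Z \<omega>)) \<partial>M) \<le> ennreal (exp (G * s * l\<^sup>2))"
proof -
  interpret prob_space M by fact
  have [measurable]: "Z \<in> borel_measurable M" using Z by auto
  define Q where "Q \<omega> = exp ((Z \<omega>)\<^sup>2 / s)" for \<omega>
  have [measurable]: "Q \<in> borel_measurable M" unfolding Q_def by measurable
  define a where "a = l\<^sup>2 * s"
  have a0: "a \<ge> 0" using \<open>s > 0\<close> by (simp add: a_def)
  show ?thesis
  proof (cases "a \<le> 1")
    case True
    have iQ: "integrable M Q"
      using le by (intro integrableI_nonneg) (auto simp: Q_def intro: le_less_trans)
    have EQ: "expectation Q \<le> G"
    proof -
      have "ennreal (expectation Q) = (\<integral>\<^sup>+ \<omega>. ennreal (Q \<omega>) \<partial>M)"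
        using iQ by (intro nn_integral_eq_integral[symmetric]) (auto simp: Q_def)
      also have "\<dots> \<le> ennreal G" using le by (simp add: Q_def)
      finally show ?thesis using \<open>G \<ge> 1\<close> by (simp add: ennreal_le_iff)
    qed
    have pw: "exp (l * Z \<omega>) \<le> l * Z \<omega> + ((1 - a) + a * Q \<omega>)" for \<omega>
    proof -
      define y where "y = (Z \<omega>)\<^sup>2 / s"
      have "exp (l * Z \<omega>) \<le> l * Z \<omega> + exp ((l * Z \<omega>)\<^sup>2)" by (rule exp_le_self_plus_exp_square)
      also have "(l * Z \<omega>)\<^sup>2 = a * y"
        using \<open>s > 0\<close> by (simp add: a_def y_def power_mult_distrib)
      also have "exp (a * y) \<le> (1 - a) * exp 0 + a * exp y"
        using convex_onD[OF exp_convex, of a 0 y] True a0 by simp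
      finally show ?thesis by (simp add: Q_def y_def)
    qed
    have iR: "integrable M (\<lambda>\<omega>. l * Z \<omega> + ((1 - a) + a * Q \<omega>))"
      using Z iQ by auto
    have "(\<integral>\<^sup>+ \<omega>. ennreal (exp (l * Z \<omega>)) \<partial>M) \<le> (\<integral>\<^sup>+ \<omega>. ennreal (l * Z \<omega> + ((1 - a) + a * Q \<omega>)) \<partial>M)"
      by (intro nn_integral_mono ennreal_leI pw)
    also have "\<dots> = ennreal (\<integral> \<omega>. l * Z \<omega> + ((1 - a) + a * Q \<omega>) \<partial>M)"
    proof (rule nn_integral_eq_integral[OF iR])
      have "0 \<le> l * Z \<omega> + ((1 - a) + a * Q \<omega>)" for \<omega>
        using pw[of \<omega>] exp_ge_zero[of "l * Z \<omega>"] by linarith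
      then show "AE \<omega> in M. 0 \<le> l * Z \<omega> + ((1 - a) + a * Q \<omega>)" by simp
    qed
    also have "(\<integral> \<omega>. l * Z \<omega> + ((1 - a) + a * Q \<omega>) \<partial>M) = (1 - a) + a * expectation Q"
      using Z iQ by (simp add: prob_space)
    also have "\<dots> \<le> exp (a * G)"
    proof -
      have "(1 - a) + a * expectation Q \<le> 1 + a * G"
        using mult_left_mono[OF EQ a0] a0 by linarith
      also have "\<dots> \<le> exp (a * G)" by (rule exp_ge_add_one_self)
      finally show ?thesis .
    qed
    finally show ?thesis by (simp add: a_def ac_simps ennreal_leI)
  next
    case False
    have pw: "exp (l * Z \<omega>) \<le> exp a * Q \<omega>" for \<omega>
    proof -
      have "0 \<le> (l * s - Z \<omega>)\<^sup>2 + (l * s)\<^sup>2 + (Z \<omega>)\<^sup>2" by simp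
      then have "l * Z \<omega> * s \<le> (a + (Z \<omega>)\<^sup>2 / s) * s"
        using \<open>s > 0\<close> by (simp add: a_def power2_eq_square algebra_simps)
      then have "l * Z \<omega> \<le> a + (Z \<omega>)\<^sup>2 / s"
        using \<open>s > 0\<close> by simp
      then show ?thesis by (simp add: Q_def exp_add[symmetric])
    qed
    have "(\<integral>\<^sup>+ \<omega>. ennreal (exp (l * Z \<omega>)) \<partial>M) \<le> (\<integral>\<^sup>+ \<omega>. ennreal (exp a) * ennreal (Q \<omega>) \<partial>M)"
      using pw by (intro nn_integral_mono) (simp add: ennreal_mult'[symmetric] ennreal_leI)
    also have "\<dots> = ennreal (exp a) * (\<integral>\<^sup>+ \<omega>. ennreal (Q \<omega>) \<partial>M)"
      by (rule nn_integral_cmult) measurable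
    also have "\<dots> \<le> ennreal (exp a) * ennreal G"
      using le by (intro mult_left_mono) (simp_all add: Q_def)
    also have "\<dots> = ennreal (exp a * G)" by (simp add: ennreal_mult')
    also have "exp a * G \<le> exp a * exp (G - 1)"
      using exp_ge_add_one_self[of "G - 1"] by (intro mult_left_mono) auto
    also have "\<dots> = exp (a + (G - 1))" by (simp add: exp_add)
    also have "\<dots> \<le> exp (a * G)"
    proof -
      have "0 \<le> (a - 1) * (G - 1)" using False \<open>G \<ge> 1\<close> by (intro mult_nonneg_nonneg) auto
      then show ?thesis by (simp add: algebra_simps)
    qed
    finally show ?thesis by (simp add: a_def ac_simps ennreal_leI)
  qed
qed

lemma tail_le_of_nn_integral_exp:
  fixes X :: "'w \<Rightarrow> real"
  assumes "prob_space M" and [measurable]: "X \<in> borel_measurable M" and "v > 0"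
    and mgf: "\<And>l. (\<integral>\<^sup>+ \<omega>. ennreal (exp (l * X \<omega>)) \<partial>M) \<le> ennreal (exp (v * l\<^sup>2))"
    and "t > 0"
  shows "measure M {\<omega> \<in> space M. t \<le> \<bar>X \<omega>\<bar>} \<le> 2 * exp (- t\<^sup>2 / (4 * v))"
proof -
  interpret prob_space M by fact
  \<comment> \<open>The minimiser of \<open>v * l\<^sup>2 - l * t\<close>.\<close>
  define l where "l = t / (2 * v)"
  have l: "l > 0" using assms by (simp add: l_def)
  have e: "- l * t + v * l\<^sup>2 = - t\<^sup>2 / (4 * v)"
    using \<open>v > 0\<close> by (simp add: l_def power2_eq_square field_simps)
  have one: "prob {\<omega> \<in> space M. t \<le> Y \<omega>} \<le> exp (- t\<^sup>2 / (4 * v))"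
    if [measurable]: "Y \<in> borel_measurable M"
      and m: "(\<integral>\<^sup>+ \<omega>. ennreal (exp (l * Y \<omega>)) \<partial>M) \<le> ennreal (exp (v * l\<^sup>2))" for Y
  proof -
    have "emeasure M {\<omega> \<in> space M. t \<le> Y \<omega>}
        \<le> ennreal (exp (- l * t)) * (\<integral>\<^sup>+ \<omega> \<in> space M. ennreal (exp (l * Y \<omega>)) \<partial>M)"
      by (intro Chernoff_ineq_nn_integral_ge l) auto
    also have "(\<integral>\<^sup>+ \<omega> \<in> space M. ennreal (exp (l * Y \<omega>)) \<partial>M) = (\<integral>\<^sup>+ \<omega>. ennreal (exp (l * Y \<omega>)) \<partial>M)"
      by (intro nn_integral_cong) auto
    also have "ennreal (exp (- l * t)) * \<dots> \<le> ennreal (exp (- l * t)) * ennreal (exp (v * l\<^sup>2))"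
      by (intro mult_left_mono m) auto
    also have "\<dots> = ennreal (exp (- l * t + v * l\<^sup>2))"
      by (simp add: ennreal_mult'[symmetric] exp_add[symmetric])
    finally show ?thesis unfolding e by (simp add: emeasure_eq_measure)
  qed
  have "prob {\<omega> \<in> space M. t \<le> \<bar>X \<omega>\<bar>}
      \<le> prob ({\<omega> \<in> space M. t \<le> X \<omega>} \<union> {\<omega> \<in> space M. t \<le> - X \<omega>})"
    by (intro finite_measure_mono) auto
  also have "\<dots> \<le> prob {\<omega> \<in> space M. t \<le> X \<omega>} + prob {\<omega> \<in> space M. t \<le> - X \<omega>}"
    by (intro measure_Un_le) auto
  also have "\<dots> \<le> exp (- t\<^sup>2 / (4 * v)) + exp (- t\<^sup>2 / (4 * v))"
    using mgf[of l] mgf[of "- l"] by (intro add_mono one) (auto simp: mult_ac)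
  finally show ?thesis by simp
qed

abbreviation exp_sq_const :: real where
  "exp_sq_const \<equiv> 2 * exp 1 / (1 - exp (- 2))"

lemma exp_sq_const_ge_1: "exp_sq_const \<ge> 1"
proof -
  have "exp (- 2 :: real) < 1" and "exp (- 2 :: real) > 0" and "exp (1::real) \<ge> 1" by simp_all
  moreover from this have "1 - exp (- 2 :: real) \<le> 2 * exp 1" by linarith
  ultimately show ?thesis by (simp add: le_divide_eq)
qed

text \<open>Independence enters through the moment generating function, which factorises, so that
  the variance proxies \<open>6 * G * \<tau>\<^sup>2 * (a i)\<^sup>2\<close> add up. The Chernoff
  tail of the sum then has scale sqrt (2 v), and the tail-to-moment step is applied once more. The
  constant is 72 = 6 * 2 * 6: a 6 for each tail-to-moment step and a 2 for the scale.\<close>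

lemma nn_integral_exp_square_weighted_sum_le:
  fixes Z :: "nat \<Rightarrow> 'w \<Rightarrow> real"
  assumes "prob_space M" and "finite I" and "\<tau> > 0" and "V > 0"
    and indep: "prob_space.indep_vars M (\<lambda>_. borel) Z I"
    and Z: "\<And>i. i \<in> I \<Longrightarrow> integrable M (Z i)" "\<And>i. i \<in> I \<Longrightarrow> integral\<^sup>L M (Z i) = 0"
    and tail: "\<And>i t. i \<in> I \<Longrightarrow> t > 0 \<Longrightarrow>
      measure M {\<omega> \<in> space M. t \<le> \<bar>Z i \<omega>\<bar>} \<le> 2 * exp (- t\<^sup>2 / (2 * \<tau>\<^sup>2))"
    and V: "(\<Sum>i\<in>I. (a i)\<^sup>2) \<le> V"
  shows "(\<integral>\<^sup>+ \<omega>. ennreal (exp ((\<Sum>i\<in>I. a i * Z i \<omega>)\<^sup>2 / (72 * exp_sq_const * \<tau>\<^sup>2 * V))) \<partial>M)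
    \<le> ennreal exp_sq_const"
proof -
  interpret prob_space M by fact
  define G where "G = exp_sq_const"
  have G: "G \<ge> 1" using exp_sq_const_ge_1 by (simp add: G_def)
  have [measurable]: "Z i \<in> borel_measurable M" if "i \<in> I" for i using Z(1)[OF that] by auto
  define v where "v = G * (6 * \<tau>\<^sup>2) * V"
  have v: "v > 0" using G assms by (simp add: v_def)
  define X where "X \<omega> = (\<Sum>i\<in>I. a i * Z i \<omega>)" for \<omega>
  have [measurable]: "X \<in> borel_measurable M" unfolding X_def by measurable
  have mgf: "(\<integral>\<^sup>+ \<omega>. ennreal (exp (l * X \<omega>)) \<partial>M) \<le> ennreal (exp (v * l\<^sup>2))" for l
  proof -
    have "(\<integral>\<^sup>+ \<omega>. ennreal (exp (l * X \<omega>)) \<partial>M)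
        = (\<integral>\<^sup>+ \<omega>. (\<Prod>i\<in>I. ennreal (exp ((l * a i) * Z i \<omega>))) \<partial>M)"
      by (intro nn_integral_cong)
        (simp add: X_def sum_distrib_left exp_sum \<open>finite I\<close> prod_ennreal mult.assoc)
    also have "\<dots> = (\<Prod>i\<in>I. \<integral>\<^sup>+ \<omega>. ennreal (exp ((l * a i) * Z i \<omega>)) \<partial>M)"
      by (intro indep_vars_nn_integral \<open>finite I\<close> indep_vars_compose2[OF indep]) auto
    also have "\<dots> \<le> (\<Prod>i\<in>I. ennreal (exp (G * (6 * \<tau>\<^sup>2) * (l * a i)\<^sup>2)))"
    proof (intro prod_mono_ennreal)
      fix i assume i: "i \<in> I"
      show "(\<integral>\<^sup>+ \<omega>. ennreal (exp ((l * a i) * Z i \<omega>)) \<partial>M) \<le> ennreal (exp (G * (6 * \<tau>\<^sup>2) * (l * a i)\<^sup>2))"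
        using i G \<open>\<tau> > 0\<close>
          nn_integral_exp_square_le_of_tail[OF \<open>prob_space M\<close> _ \<open>\<tau> > 0\<close> tail[OF i]]
        by (intro nn_integral_exp_le_of_exp_square assms(1) Z) (auto simp: G_def)
    qed
    also have "\<dots> = ennreal (exp (G * (6 * \<tau>\<^sup>2) * l\<^sup>2 * (\<Sum>i\<in>I. (a i)\<^sup>2)))"
      by (simp add: prod_ennreal exp_sum[symmetric] \<open>finite I\<close> sum_distrib_left power_mult_distrib mult_ac)
    also have "\<dots> \<le> ennreal (exp (G * (6 * \<tau>\<^sup>2) * l\<^sup>2 * V))"
      using V G by (intro ennreal_leI) (auto intro!: mult_left_mono)
    finally show ?thesis by (simp add: v_def mult_ac)
  qed
  have "measure M {\<omega> \<in> space M. t \<le> \<bar>X \<omega>\<bar>} \<le> 2 * exp (- t\<^sup>2 / (2 * (sqrt (2 * v))\<^sup>2))" if "t > 0" for t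
    using tail_le_of_nn_integral_exp[OF assms(1) _ v mgf that] v by simp
  from nn_integral_exp_square_le_of_tail[OF assms(1) _ _ this] v
  have "(\<integral>\<^sup>+ \<omega>. ennreal (exp ((X \<omega>)\<^sup>2 / (6 * (2 * v)))) \<partial>M) \<le> ennreal G"
    by (simp add: G_def)
  moreover have "6 * (2 * v) = 72 * exp_sq_const * \<tau>\<^sup>2 * V"
    by (simp add: v_def G_def field_simps)
  ultimately show ?thesis by (simp only: X_def G_def)
qed

section \<open>Uniform bound for kernel-weighted noise\<close>

lemma card_nat_between_le:
  assumes "x \<le> y"
  shows "real (card {i::nat. x \<le> real i \<and> real i \<le> y}) \<le> y - x + 1"
proof -
  let ?S = "{i::nat. x \<le> real i \<and> real i \<le> y}"
  have "int ` ?S \<subseteq> {\<lceil>x\<rceil>..\<lfloor>y\<rfloor>}"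
    by (auto simp: ceiling_le_iff le_floor_iff)
  then have "card (int ` ?S) \<le> card {\<lceil>x\<rceil>..\<lfloor>y\<rfloor>}"
    by (intro card_mono) auto
  moreover have "card (int ` ?S) = card ?S"
    by (intro card_image) (auto simp: inj_on_def)
  ultimately have "real (card ?S) \<le> real (nat (\<lfloor>y\<rfloor> - \<lceil>x\<rceil> + 1))"
    by simp
  also have "\<dots> \<le> y - x + 1"
  proof -
    have "real_of_int \<lfloor>y\<rfloor> - real_of_int \<lceil>x\<rceil> \<le> y - x" by linarith
    then show ?thesis using assms by (cases "\<lfloor>y\<rfloor> - \<lceil>x\<rceil> + 1 \<ge> 0") auto
  qed
  finally show ?thesis .
qed

text \<open>A window of length 2h meets at most 2N + 1 design points, where N = h / \<Delta>t, and N
  \<ge> 1 absorbs the extra point.\<close>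

lemma card_window_le:
  fixes \<Delta>t h t :: real
  assumes "0 < \<Delta>t" "\<Delta>t \<le> h"
  shows "real (card {i \<in> {1..n}. \<bar>(real i * \<Delta>t - t) / h\<bar> \<le> 1}) \<le> 3 * (h / \<Delta>t)"
proof -
  have h: "h > 0" using assms by linarith
  let ?S = "{i::nat. (t - h) / \<Delta>t \<le> real i \<and> real i \<le> (t + h) / \<Delta>t}"
  have "finite ?S"
  proof (rule finite_subset)
    show "?S \<subseteq> {..nat \<lceil>(t + h) / \<Delta>t\<rceil>}" by (auto intro!: le_nat_iff[THEN iffD2]) linarith
  qed simp
  moreover have "{i \<in> {1..n}. \<bar>(real i * \<Delta>t - t) / h\<bar> \<le> 1} \<subseteq> ?S"
    using h assms by (auto simp: abs_le_iff field_simps)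
  ultimately have "card {i \<in> {1..n}. \<bar>(real i * \<Delta>t - t) / h\<bar> \<le> 1} \<le> card ?S"
    by (rule card_mono)
  also have "real (card ?S) \<le> (t + h) / \<Delta>t - (t - h) / \<Delta>t + 1"
    using assms h by (intro card_nat_between_le divide_right_mono) auto
  also have "\<dots> = 2 * (h / \<Delta>t) + 1" by (simp add: add_divide_distrib diff_divide_distrib)
  also have "\<dots> \<le> 3 * (h / \<Delta>t)" using assms by (simp add: field_simps)
  finally show ?thesis by simp
qed

text \<open>Serves twice: with the squared weights it bounds the variance of the noise sums, with
  the weights themselves the accumulated bias.\<close>

lemma sum_window_le:
  fixes \<Delta>t h t B :: real
  assumes "0 < \<Delta>t" "\<Delta>t \<le> h" "\<And>z. \<bar>g z\<bar> \<le> B" "\<And>z. \<bar>z\<bar> > 1 \<Longrightarrow> g z = 0"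
  shows "(\<Sum>i = 1..n. \<bar>g ((real i * \<Delta>t - t) / h)\<bar>) \<le> 3 * (h / \<Delta>t) * B"
proof -
  have "B \<ge> 0" using assms(3)[of 0] by linarith
  let ?S = "{i \<in> {1..n}. \<bar>(real i * \<Delta>t - t) / h\<bar> \<le> 1}"
  have "(\<Sum>i = 1..n. \<bar>g ((real i * \<Delta>t - t) / h)\<bar>) = (\<Sum>i \<in> ?S. \<bar>g ((real i * \<Delta>t - t) / h)\<bar>)"
  proof (rule sum.mono_neutral_right)
    show "\<forall>i\<in>{1..n} - ?S. \<bar>g ((real i * \<Delta>t - t) / h)\<bar> = 0"
      using assms(4) by (force simp del: abs_divide simp: not_le)
  qed auto
  also have "\<dots> \<le> (\<Sum>i \<in> ?S. B)" by (intro sum_mono assms(3))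
  also have "\<dots> = real (card ?S) * B" by simp
  also have "\<dots> \<le> 3 * (h / \<Delta>t) * B"
    using card_window_le[OF assms(1,2)] \<open>B \<ge> 0\<close> by (intro mult_right_mono) auto
  finally show ?thesis .
qed

lemma sum_abs_square_le: "(\<Sum>i = 1..n. \<bar>x i\<bar>)\<^sup>2 \<le> real n * (\<Sum>i = 1..n. (x i)\<^sup>2)" for x :: "nat \<Rightarrow> real"
  using Cauchy_Schwarz_ineq_sum[of "\<lambda>i. 1" "\<lambda>i. \<bar>x i\<bar>" "{1..n}"] by simp

text \<open>3 exceeds e; the restriction n \<ge> 3 in the finite-sample bounds lets ln n absorb
  additive constants.\<close>

lemma one_le_ln:
  assumes "n \<ge> 3"
  shows "1 \<le> ln (real n)"
proof -
  have "exp 1 \<le> (3::real)" using exp_le by simp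
  also have "\<dots> \<le> real n" using assms by simp
  finally show ?thesis using assms by (simp add: ln_ge_iff)
qed

text \<open>
  The weighted sums are controlled on a grid of \<open>n\<^sup>2 + 1\<close> points and interpolated by the Lipschitz
  property. On the grid, \<open>w \<le> ln J + exp w / J\<close> replaces a maximum of \<open>J\<close> exponentially
  integrable variables by \<open>ln J\<close> plus an average of exponentials.
\<close>

lemma sup_weighted_sum_dominated:
  fixes Z :: "nat \<Rightarrow> 'w \<Rightarrow> real" and \<phi> :: "real \<Rightarrow> real" and \<Delta>t h :: real
  assumes M: "prob_space M" and "\<tau> > 0" and "S \<ge> 0" and "B > 0" and "L \<ge> 0"
    and n: "n \<ge> 3" and dt: "0 < \<Delta>t" "\<Delta>t \<le> h"
    and indep: "prob_space.indep_vars M (\<lambda>_. borel) Z {1..n}"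
    and Z: "\<And>i. i \<in> {1..n} \<Longrightarrow> integrable M (Z i)" "\<And>i. i \<in> {1..n} \<Longrightarrow> integral\<^sup>L M (Z i) = 0"
    and tail: "\<And>i t. i \<in> {1..n} \<Longrightarrow> t > 0 \<Longrightarrow>
      measure M {\<omega> \<in> space M. t \<le> \<bar>Z i \<omega>\<bar>} \<le> 2 * exp (- t\<^sup>2 / (2 * \<tau>\<^sup>2))"
    and second: "\<And>i. i \<in> {1..n} \<Longrightarrow> (\<integral>\<^sup>+ \<omega>. ennreal ((Z i \<omega>)\<^sup>2) \<partial>M) \<le> ennreal S"
    and B: "\<And>z. \<bar>\<phi> z\<bar> \<le> B" and supp: "\<And>z. \<bar>z\<bar> > 1 \<Longrightarrow> \<phi> z = 0"
    and lip: "\<And>z z'. \<bar>\<phi> z - \<phi> z'\<bar> \<le> L * \<bar>z - z'\<bar>"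
  shows "\<exists>W. W \<in> borel_measurable M \<and> (\<forall>\<omega>. 0 \<le> W \<omega>) \<and>
    (\<integral>\<^sup>+ \<omega>. ennreal (W \<omega>) \<partial>M)
      \<le> ennreal ((432 * exp_sq_const * \<tau>\<^sup>2 * B\<^sup>2 * (2 + 2 * exp_sq_const) + 2 * L\<^sup>2 * S) * ln (real n)) \<and>
    (\<forall>\<omega>. \<forall>t\<in>{0..real n * \<Delta>t}.
       (\<Sum>i = 1..n. \<phi> ((real i * \<Delta>t - t) / h) * Z i \<omega>)\<^sup>2 \<le> h / \<Delta>t * W \<omega>)"
proof -
  interpret prob_space M by fact
  have [measurable]: "Z i \<in> borel_measurable M" if "i \<in> {1..n}" for i using Z(1)[OF that] by auto
  define G where "G = exp_sq_const"
  have G: "G \<ge> 1" using exp_sq_const_ge_1 by (simp add: G_def)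
  define N where "N = h / \<Delta>t"
  have N: "N \<ge> 1" using dt by (simp add: N_def field_simps)
  have h: "h > 0" using dt by linarith
  have n0: "real n > 0" using n by simp
  \<comment> \<open>216 = 72 * 3: the squared weights sum to at most 3 N B^2, so \<open>w\<close>
    below is the square normalised to have exponential moment at most G.\<close>
  define \<kappa> where "\<kappa> = 216 * G * \<tau>\<^sup>2 * B\<^sup>2"
  have \<kappa>: "\<kappa> > 0" using G \<open>\<tau> > 0\<close> \<open>B > 0\<close> by (simp add: \<kappa>_def)
  define X where "X t \<omega> = (\<Sum>i = 1..n. \<phi> ((real i * \<Delta>t - t) / h) * Z i \<omega>)" for t \<omega>
  have [measurable]: "X t \<in> borel_measurable M" for t unfolding X_def by measurable
  \<comment> \<open>Spacing \<Delta>t / n, so that index n^2 reaches the end of the time range. The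
    fine spacing pays for the crude interpolation estimate, which sums over all n observations
    instead of a window.\<close>
  define gr where "gr j = real j * (\<Delta>t / real n)" for j :: nat
  define w where "w j \<omega> = (X (gr j) \<omega>)\<^sup>2 / (\<kappa> * N)" for j \<omega>
  have [measurable]: "w j \<in> borel_measurable M" for j unfolding w_def by measurable
  define J where "J = (real n)\<^sup>2"
  have J: "J > 0" using n0 by (simp add: J_def)
  \<comment> \<open>Three contributions: the logarithm of the number of grid points, the average of
    the exponentials, and the interpolation error. The first two are twice the grid bound and the
    last is twice the increment bound, from (x + y)^2 \<le> 2 x^2 + 2 y^2.\<close>
  define W where "W \<omega> = 4 * \<kappa> * ln (real n) + (\<Sum>j = 0..n\<^sup>2. 2 * \<kappa> / J * exp (w j \<omega>))
      + (\<Sum>i = 1..n. 2 * L\<^sup>2 / real n * (Z i \<omega>)\<^sup>2)" for \<omega>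
  have [measurable]: "W \<in> borel_measurable M" unfolding W_def by measurable
  note ln1 = one_le_ln[OF n]
  have parts: "0 \<le> (\<Sum>j = 0..n\<^sup>2. 2 * \<kappa> / J * exp (w j \<omega>))"
    "0 \<le> (\<Sum>i = 1..n. 2 * L\<^sup>2 / real n * (Z i \<omega>)\<^sup>2)" for \<omega>
    using \<kappa> J n0 by (auto intro!: sum_nonneg)
  have W0: "0 \<le> W \<omega>" for \<omega>
    using parts[of \<omega>] \<kappa> ln1 by (simp add: W_def)
  have Ew: "(\<integral>\<^sup>+ \<omega>. ennreal (exp (w j \<omega>)) \<partial>M) \<le> ennreal G" for j
  proof -
    have "(\<Sum>i\<in>{1..n}. (\<phi> ((real i * \<Delta>t - gr j) / h))\<^sup>2) \<le> 3 * N * B\<^sup>2"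
      using sum_window_le[OF dt, of "\<lambda>z. (\<phi> z)\<^sup>2" "B\<^sup>2" "gr j" n] B supp \<open>B > 0\<close>
      by (auto simp: N_def abs_le_square_iff[symmetric])
    from nn_integral_exp_square_weighted_sum_le[OF M _ \<open>\<tau> > 0\<close> _ indep Z tail this]
    have "(\<integral>\<^sup>+ \<omega>. ennreal (exp ((X (gr j) \<omega>)\<^sup>2 / (72 * exp_sq_const * \<tau>\<^sup>2 * (3 * N * B\<^sup>2)))) \<partial>M) \<le> ennreal G"
      using N \<open>B > 0\<close> by (simp add: X_def G_def)
    moreover have "72 * exp_sq_const * \<tau>\<^sup>2 * (3 * N * B\<^sup>2) = \<kappa> * N"
      by (simp add: \<kappa>_def G_def)
    ultimately show ?thesis by (simp only: w_def)
  qed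
  have "(\<integral>\<^sup>+ \<omega>. ennreal (W \<omega>) \<partial>M)
      = (\<integral>\<^sup>+ \<omega>. ennreal (4 * \<kappa> * ln (real n)) + (\<Sum>j = 0..n\<^sup>2. ennreal (2 * \<kappa> / J) * ennreal (exp (w j \<omega>)))
          + (\<Sum>i = 1..n. ennreal (2 * L\<^sup>2 / real n) * ennreal ((Z i \<omega>)\<^sup>2)) \<partial>M)"
  proof (rule nn_integral_cong)
    fix \<omega>
    have "ennreal (W \<omega>) = ennreal (4 * \<kappa> * ln (real n)) + ennreal (\<Sum>j = 0..n\<^sup>2. 2 * \<kappa> / J * exp (w j \<omega>))
          + ennreal (\<Sum>i = 1..n. 2 * L\<^sup>2 / real n * (Z i \<omega>)\<^sup>2)"
      unfolding W_def using parts[of \<omega>] \<kappa> ln1 by (simp add: ennreal_plus)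
    also have "ennreal (\<Sum>j = 0..n\<^sup>2. 2 * \<kappa> / J * exp (w j \<omega>))
        = (\<Sum>j = 0..n\<^sup>2. ennreal (2 * \<kappa> / J) * ennreal (exp (w j \<omega>)))"
    proof -
      have "ennreal (2 * \<kappa> / J) * ennreal (exp (w j \<omega>)) = ennreal (2 * \<kappa> / J * exp (w j \<omega>))" for j
        using \<kappa> J by (intro ennreal_mult[symmetric]) auto
      then show ?thesis using \<kappa> J by (simp only:) (intro sum_ennreal[symmetric], auto)
    qed
    also have "ennreal (\<Sum>i = 1..n. 2 * L\<^sup>2 / real n * (Z i \<omega>)\<^sup>2)
        = (\<Sum>i = 1..n. ennreal (2 * L\<^sup>2 / real n) * ennreal ((Z i \<omega>)\<^sup>2))"
      by (subst sum_ennreal[symmetric]) (auto simp flip: ennreal_mult)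
    finally show "ennreal (W \<omega>) = ennreal (4 * \<kappa> * ln (real n))
          + (\<Sum>j = 0..n\<^sup>2. ennreal (2 * \<kappa> / J) * ennreal (exp (w j \<omega>)))
          + (\<Sum>i = 1..n. ennreal (2 * L\<^sup>2 / real n) * ennreal ((Z i \<omega>)\<^sup>2))" .
  qed
  also have "\<dots> = ennreal (4 * \<kappa> * ln (real n))
      + (\<Sum>j = 0..n\<^sup>2. ennreal (2 * \<kappa> / J) * (\<integral>\<^sup>+ \<omega>. ennreal (exp (w j \<omega>)) \<partial>M))
      + (\<Sum>i = 1..n. ennreal (2 * L\<^sup>2 / real n) * (\<integral>\<^sup>+ \<omega>. ennreal ((Z i \<omega>)\<^sup>2) \<partial>M))"
  proof -
    have "(\<integral>\<^sup>+ \<omega>. (\<Sum>i = 1..n. ennreal (2 * L\<^sup>2 / real n) * ennreal ((Z i \<omega>)\<^sup>2)) \<partial>M)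
        = (\<Sum>i = 1..n. \<integral>\<^sup>+ \<omega>. ennreal (2 * L\<^sup>2 / real n) * ennreal ((Z i \<omega>)\<^sup>2) \<partial>M)"
      by (rule nn_integral_sum) measurable
    also have "\<dots> = (\<Sum>i = 1..n. ennreal (2 * L\<^sup>2 / real n) * (\<integral>\<^sup>+ \<omega>. ennreal ((Z i \<omega>)\<^sup>2) \<partial>M))"
      by (intro sum.cong refl nn_integral_cmult) measurable
    finally show ?thesis
      by (simp add: nn_integral_add nn_integral_sum nn_integral_cmult emeasure_space_1 del: One_nat_def)
  qed
  also have "\<dots> \<le> ennreal (4 * \<kappa> * ln (real n))
      + (\<Sum>j = 0..n\<^sup>2. ennreal (2 * \<kappa> / J) * ennreal G)
      + (\<Sum>i = 1..n. ennreal (2 * L\<^sup>2 / real n) * ennreal S)"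
    by (intro add_mono sum_mono mult_left_mono Ew second order_refl) auto
  also have "\<dots> = ennreal (4 * \<kappa> * ln (real n) + (\<Sum>j = 0..n\<^sup>2. 2 * \<kappa> / J * G)
      + (\<Sum>i = 1..n. 2 * L\<^sup>2 / real n * S))"
  proof -
    have "(\<Sum>j = 0..n\<^sup>2. ennreal (2 * \<kappa> / J) * ennreal G) = ennreal (\<Sum>j = 0..n\<^sup>2. 2 * \<kappa> / J * G)"
      using \<kappa> J G by (subst sum_ennreal[symmetric]) (auto simp flip: ennreal_mult)
    moreover have "(\<Sum>i = 1..n. ennreal (2 * L\<^sup>2 / real n) * ennreal S) = ennreal (\<Sum>i = 1..n. 2 * L\<^sup>2 / real n * S)"
      using \<open>S \<ge> 0\<close> by (subst sum_ennreal[symmetric]) (auto simp flip: ennreal_mult)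
    moreover have "0 \<le> 4 * \<kappa> * ln (real n)" "0 \<le> (\<Sum>j = 0..n\<^sup>2. 2 * \<kappa> / J * G)"
      "0 \<le> (\<Sum>i = 1..n. 2 * L\<^sup>2 / real n * S)"
      using \<kappa> J G ln1 n0 \<open>S \<ge> 0\<close> by (auto intro!: sum_nonneg mult_nonneg_nonneg)
    ultimately show ?thesis by (simp only: ennreal_plus add_nonneg_nonneg)
  qed
  also have "\<dots> \<le> ennreal ((2 * \<kappa> * (2 + 2 * G) + 2 * L\<^sup>2 * S) * ln (real n))"
  proof (rule ennreal_leI)
    have "(\<Sum>j = 0..n\<^sup>2. 2 * \<kappa> / J * G) = (J + 1) * (2 * \<kappa> / J * G)"
      by (simp add: J_def)
    also have "\<dots> \<le> (2 * J) * (2 * \<kappa> / J * G)"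
      using \<kappa> J G n by (intro mult_right_mono) (auto simp: J_def)
    also have "\<dots> = 2 * \<kappa> * (2 * G)" using J by simp
    finally have 1: "(\<Sum>j = 0..n\<^sup>2. 2 * \<kappa> / J * G) \<le> 2 * \<kappa> * (2 * G)" .
    have 2: "(\<Sum>i = 1..n. 2 * L\<^sup>2 / real n * S) = 2 * L\<^sup>2 * S" using n0 by simp
    have "1 * (2 * \<kappa> * (2 * G) + 2 * L\<^sup>2 * S) \<le> ln (real n) * (2 * \<kappa> * (2 * G) + 2 * L\<^sup>2 * S)"
      using ln1 \<kappa> G \<open>S \<ge> 0\<close> by (intro mult_right_mono) auto
    then show "4 * \<kappa> * ln (real n) + (\<Sum>j = 0..n\<^sup>2. 2 * \<kappa> / J * G) + (\<Sum>i = 1..n. 2 * L\<^sup>2 / real n * S)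
        \<le> (2 * \<kappa> * (2 + 2 * G) + 2 * L\<^sup>2 * S) * ln (real n)"
      using 1 unfolding 2 by (simp add: algebra_simps)
  qed
  also have "2 * \<kappa> * (2 + 2 * G) + 2 * L\<^sup>2 * S
      = 432 * exp_sq_const * \<tau>\<^sup>2 * B\<^sup>2 * (2 + 2 * exp_sq_const) + 2 * L\<^sup>2 * S"
    by (simp add: \<kappa>_def G_def)
  finally have EW: "(\<integral>\<^sup>+ \<omega>. ennreal (W \<omega>) \<partial>M)
      \<le> ennreal ((432 * exp_sq_const * \<tau>\<^sup>2 * B\<^sup>2 * (2 + 2 * exp_sq_const) + 2 * L\<^sup>2 * S) * ln (real n))" .
  have pw: "(X t \<omega>)\<^sup>2 \<le> N * W \<omega>" if t: "t \<in> {0..real n * \<Delta>t}" for t \<omega>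
  proof -
    \<comment> \<open>The grid point just below t.\<close>
    define j where "j = nat \<lfloor>t / (\<Delta>t / real n)\<rfloor>"
    have q0: "t / (\<Delta>t / real n) \<ge> 0" using t dt n0 by simp
    then have j1: "real j \<le> t / (\<Delta>t / real n)" "t / (\<Delta>t / real n) \<le> real j + 1"
      by (auto simp: j_def)
    have j2: "gr j \<le> t" "t \<le> gr j + \<Delta>t / real n"
      using j1 dt n0 by (auto simp: gr_def field_simps)
    have jn: "j \<le> n\<^sup>2"
    proof -
      have "t / (\<Delta>t / real n) \<le> (real n)\<^sup>2"
        using t dt n0 by (auto simp: field_simps power2_eq_square)
      then have "real j \<le> real (n\<^sup>2)" by (intro order_trans[OF j1(1)]) simp
      then show ?thesis by (simp only: of_nat_le_iff)
    qed
    have grid: "(X (gr j) \<omega>)\<^sup>2 \<le> N * (2 * \<kappa> * ln (real n) + \<kappa> / J * (\<Sum>j = 0..n\<^sup>2. exp (w j \<omega>)))"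
    proof -
      have "1 + (w j \<omega> - ln J) \<le> exp (w j \<omega> - ln J)" by (rule exp_ge_add_one_self)
      also have "\<dots> = exp (w j \<omega>) / J" using J by (simp add: exp_diff)
      finally have "w j \<omega> \<le> ln J + exp (w j \<omega>) / J" by linarith
      also have "exp (w j \<omega>) \<le> (\<Sum>j = 0..n\<^sup>2. exp (w j \<omega>))"
        using jn by (intro member_le_sum) auto
      finally have *: "w j \<omega> \<le> ln J + (\<Sum>j = 0..n\<^sup>2. exp (w j \<omega>)) / J"
        using J by (simp add: divide_right_mono)
      have "(X (gr j) \<omega>)\<^sup>2 = \<kappa> * N * w j \<omega>" using \<kappa> N by (simp add: w_def)
      also have "\<dots> \<le> \<kappa> * N * (ln J + (\<Sum>j = 0..n\<^sup>2. exp (w j \<omega>)) / J)"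
        using * \<kappa> N by (intro mult_left_mono) auto
      also have "ln J = 2 * ln (real n)" using n0 by (simp add: J_def ln_realpow)
      finally show ?thesis by (simp add: algebra_simps)
    qed
    have diff: "(X t \<omega> - X (gr j) \<omega>)\<^sup>2 \<le> N * (L\<^sup>2 / real n * (\<Sum>i = 1..n. (Z i \<omega>)\<^sup>2))"
    proof -
      have "\<bar>X t \<omega> - X (gr j) \<omega>\<bar>
          = \<bar>\<Sum>i = 1..n. (\<phi> ((real i * \<Delta>t - t) / h) - \<phi> ((real i * \<Delta>t - gr j) / h)) * Z i \<omega>\<bar>"
        by (simp add: X_def sum_subtractf left_diff_distrib)
      also have "\<dots> \<le> (\<Sum>i = 1..n. L / (real n * N) * \<bar>Z i \<omega>\<bar>)"
      proof (rule order_trans[OF sum_abs], intro sum_mono)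
        fix i
        have "\<bar>\<phi> ((real i * \<Delta>t - t) / h) - \<phi> ((real i * \<Delta>t - gr j) / h)\<bar>
            \<le> L * \<bar>(real i * \<Delta>t - t) / h - (real i * \<Delta>t - gr j) / h\<bar>" by (rule lip)
        also have "\<bar>(real i * \<Delta>t - t) / h - (real i * \<Delta>t - gr j) / h\<bar> = (t - gr j) / h"
          using j2 h by (simp add: diff_divide_distrib[symmetric])
        also have "\<dots> \<le> (\<Delta>t / real n) / h" using j2 h by (intro divide_right_mono) auto
        also have "\<dots> = 1 / (real n * N)" using dt by (simp add: N_def)
        finally have "\<bar>\<phi> ((real i * \<Delta>t - t) / h) - \<phi> ((real i * \<Delta>t - gr j) / h)\<bar> \<le> L / (real n * N)"
          using \<open>L \<ge> 0\<close> by (simp add: mult_left_mono)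
        then show "\<bar>(\<phi> ((real i * \<Delta>t - t) / h) - \<phi> ((real i * \<Delta>t - gr j) / h)) * Z i \<omega>\<bar>
            \<le> L / (real n * N) * \<bar>Z i \<omega>\<bar>"
          unfolding abs_mult by (rule mult_right_mono) simp
      qed
      also have "\<dots> = L / (real n * N) * (\<Sum>i = 1..n. \<bar>Z i \<omega>\<bar>)" by (simp add: sum_distrib_left)
      finally have "\<bar>X t \<omega> - X (gr j) \<omega>\<bar>\<^sup>2 \<le> (L / (real n * N) * (\<Sum>i = 1..n. \<bar>Z i \<omega>\<bar>))\<^sup>2"
        by (intro power_mono) auto
      also have "\<dots> = (L / (real n * N))\<^sup>2 * (\<Sum>i = 1..n. \<bar>Z i \<omega>\<bar>)\<^sup>2" by (rule power_mult_distrib)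
      \<comment> \<open>Cauchy-Schwarz costs a factor n, the squared spacing gains 1 / n^2; what
        remains is the mean of the squared noise, whose expectation is bounded.\<close>
      also have "\<dots> \<le> (L / (real n * N))\<^sup>2 * (real n * (\<Sum>i = 1..n. (Z i \<omega>)\<^sup>2))"
        by (intro mult_left_mono sum_abs_square_le) auto
      also have "\<dots> = (1 / N\<^sup>2) * (L\<^sup>2 / real n * (\<Sum>i = 1..n. (Z i \<omega>)\<^sup>2))"
        using n0 N by (simp add: power2_eq_square mult_ac)
      \<comment> \<open>Deliberately lossy: it gives this term the same factor N as the grid
        bound.\<close>
      also have "\<dots> \<le> N * (L\<^sup>2 / real n * (\<Sum>i = 1..n. (Z i \<omega>)\<^sup>2))"
      proof (rule mult_right_mono)
        have "1 \<le> N\<^sup>2" using N by simp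
        then have "1 / N\<^sup>2 \<le> 1" by (simp add: divide_le_eq)
        then show "1 / N\<^sup>2 \<le> N" using N by linarith
      qed (simp add: sum_nonneg)
      finally show ?thesis by simp
    qed
    have "(X t \<omega>)\<^sup>2 \<le> 2 * (X (gr j) \<omega>)\<^sup>2 + 2 * (X t \<omega> - X (gr j) \<omega>)\<^sup>2"
    proof -
      have "0 \<le> (X t \<omega> - 2 * X (gr j) \<omega>)\<^sup>2" by simp
      then show ?thesis by (simp add: power2_eq_square algebra_simps)
    qed
    also have "\<dots> \<le> 2 * (N * (2 * \<kappa> * ln (real n) + \<kappa> / J * (\<Sum>j = 0..n\<^sup>2. exp (w j \<omega>))))
        + 2 * (N * (L\<^sup>2 / real n * (\<Sum>i = 1..n. (Z i \<omega>)\<^sup>2)))"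
      using grid diff by linarith
    also have "\<dots> = N * W \<omega>"
      unfolding W_def sum_distrib_left[symmetric] by (simp add: algebra_simps)
    finally show ?thesis .
  qed
  show ?thesis
    using EW pw W0 by (intro exI[of _ W]) (auto simp: X_def N_def)
qed

section \<open>From scalar noise to vector-valued noise\<close>

lemma subgaussian_noise_component:
  fixes \<epsilon> :: "nat \<Rightarrow> 'w \<Rightarrow> real ^ 'd::finite"
  assumes noise: "subgaussian_noise \<sigma> n M \<epsilon>" and "\<sigma> \<ge> 0" and i: "i \<in> {1..n}"
  shows "integrable M (\<lambda>\<omega>. \<epsilon> i \<omega> $ l)"
    and "integral\<^sup>L M (\<lambda>\<omega>. \<epsilon> i \<omega> $ l) = 0"
    and "(\<integral>\<^sup>+ \<omega>. ennreal ((\<epsilon> i \<omega> $ l)\<^sup>2) \<partial>M) \<le> ennreal (\<sigma>\<^sup>2)"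
    and "t > 0 \<Longrightarrow> measure M {\<omega> \<in> space M. t \<le> \<bar>\<epsilon> i \<omega> $ l\<bar>} \<le> 2 * exp (- t\<^sup>2 / (2 * (\<sigma> + 1)\<^sup>2))"
proof -
  interpret prob_space M using noise by (simp add: subgaussian_noise_def)
  have int: "integrable M (\<epsilon> i)" and mean: "integral\<^sup>L M (\<epsilon> i) = 0"
    and int2: "integrable M (\<lambda>\<omega>. (norm (\<epsilon> i \<omega>))\<^sup>2)"
    and mom: "integral\<^sup>L M (\<lambda>\<omega>. (norm (\<epsilon> i \<omega>))\<^sup>2) \<le> \<sigma>\<^sup>2"
    and tail: "\<And>t. t > 0 \<Longrightarrow>
      measure M {\<omega> \<in> space M. \<bar>\<epsilon> i \<omega> $ l - integral\<^sup>L M (\<lambda>\<omega>'. \<epsilon> i \<omega>' $ l)\<bar> \<ge> t} \<le> 2 * exp (- t\<^sup>2 / (2 * \<sigma>\<^sup>2))"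
    using noise i by (auto simp: subgaussian_noise_def)
  have [measurable]: "\<epsilon> i \<in> borel_measurable M" using int by auto
  show intl: "integrable M (\<lambda>\<omega>. \<epsilon> i \<omega> $ l)"
    by (rule integrable_bounded_linear[OF bounded_linear_vec_nth int])
  then have [measurable]: "(\<lambda>\<omega>. \<epsilon> i \<omega> $ l) \<in> borel_measurable M" by auto
  show mean0: "integral\<^sup>L M (\<lambda>\<omega>. \<epsilon> i \<omega> $ l) = 0"
    using integral_bounded_linear[OF bounded_linear_vec_nth int, of l] mean by simp
  have "(\<integral>\<^sup>+ \<omega>. ennreal ((\<epsilon> i \<omega> $ l)\<^sup>2) \<partial>M) \<le> (\<integral>\<^sup>+ \<omega>. ennreal ((norm (\<epsilon> i \<omega>))\<^sup>2) \<partial>M)"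
    using component_le_norm_cart by (intro nn_integral_mono ennreal_leI) (simp add: abs_le_square_iff[symmetric])
  also have "\<dots> = ennreal (integral\<^sup>L M (\<lambda>\<omega>. (norm (\<epsilon> i \<omega>))\<^sup>2))"
    by (intro nn_integral_eq_integral int2) auto
  also have "\<dots> \<le> ennreal (\<sigma>\<^sup>2)" using mom by (rule ennreal_leI)
  finally show "(\<integral>\<^sup>+ \<omega>. ennreal ((\<epsilon> i \<omega> $ l)\<^sup>2) \<partial>M) \<le> ennreal (\<sigma>\<^sup>2)" .
  \<comment> \<open>The scale \<sigma> + 1 is positive also for \<sigma> = 0, as the exponential
    moment bounds require. In that case the vanishing second moment makes the component zero almost
    surely.\<close>
  show "measure M {\<omega> \<in> space M. t \<le> \<bar>\<epsilon> i \<omega> $ l\<bar>} \<le> 2 * exp (- t\<^sup>2 / (2 * (\<sigma> + 1)\<^sup>2))" if "t > 0"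
  proof (cases "\<sigma> = 0")
    case True
    have "integral\<^sup>L M (\<lambda>\<omega>. (norm (\<epsilon> i \<omega>))\<^sup>2) = 0"
      using mom True by (intro antisym) auto
    then have "AE \<omega> in M. (norm (\<epsilon> i \<omega>))\<^sup>2 = 0"
      using integral_nonneg_eq_0_iff_AE[OF int2] by simp
    then have "AE \<omega> in M. \<omega> \<notin> {\<omega> \<in> space M. t \<le> \<bar>\<epsilon> i \<omega> $ l\<bar>}"
      by (rule eventually_mono) (use \<open>t > 0\<close> in auto)
    then have "prob {\<omega> \<in> space M. t \<le> \<bar>\<epsilon> i \<omega> $ l\<bar>} = 0"
      by (subst prob_eq_0) auto
    then show ?thesis by simp
  next
    case False
    then have "\<sigma> > 0" using \<open>\<sigma> \<ge> 0\<close> by simp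
    have "prob {\<omega> \<in> space M. t \<le> \<bar>\<epsilon> i \<omega> $ l\<bar>} \<le> 2 * exp (- t\<^sup>2 / (2 * \<sigma>\<^sup>2))"
      using tail[OF \<open>t > 0\<close>] by (simp add: mean0)
    also have "\<dots> \<le> 2 * exp (- t\<^sup>2 / (2 * (\<sigma> + 1)\<^sup>2))"
      using \<open>\<sigma> > 0\<close> by (auto intro!: divide_left_mono mult_pos_pos power_mono)
    finally show ?thesis .
  qed
qed

lemma power2_norm_vec: "(norm x)\<^sup>2 = (\<Sum>l\<in>UNIV. (x $ l)\<^sup>2)" for x :: "real ^ 'd::finite"
  by (simp add: norm_vec_def L2_set_def sum_nonneg)

text \<open>The coordinates are treated one at a time and their dominating variables added, hence
  the factor \<open>CARD('d)\<close>. \<open>A\<close> is fixed before the sample size, the design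
  and the probability space, all of which change along the sequence.\<close>

lemma noise_sup_dominated:
  fixes \<phi> :: "real \<Rightarrow> real"
  assumes "\<sigma> \<ge> 0" and "B > 0" and "L \<ge> 0"
    and \<phi>: "\<And>z. \<bar>\<phi> z\<bar> \<le> B" "\<And>z. \<bar>z\<bar> > 1 \<Longrightarrow> \<phi> z = 0"
      "\<And>z z'. \<bar>\<phi> z - \<phi> z'\<bar> \<le> L * \<bar>z - z'\<bar>"
  obtains A where "A > 0"
    "\<And>n \<Delta>t h (M :: 'w measure) (\<epsilon> :: nat \<Rightarrow> 'w \<Rightarrow> real ^ 'd::finite).
      n \<ge> 3 \<Longrightarrow> 0 < \<Delta>t \<Longrightarrow> \<Delta>t \<le> h \<Longrightarrow> subgaussian_noise \<sigma> n M \<epsilon> \<Longrightarrow>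
      \<exists>W. W \<in> borel_measurable M \<and> (\<forall>\<omega>. 0 \<le> W \<omega>) \<and>
        (\<integral>\<^sup>+ \<omega>. ennreal (W \<omega>) \<partial>M) \<le> ennreal (A * ln (real n)) \<and>
        (\<forall>\<omega>. \<forall>t\<in>{0..real n * \<Delta>t}.
          (norm (\<Sum>i = 1..n. \<phi> ((real i * \<Delta>t - t) / h) *\<^sub>R \<epsilon> i \<omega>))\<^sup>2 \<le> h / \<Delta>t * W \<omega>)"
proof -
  define A0 where "A0 = 432 * exp_sq_const * (\<sigma> + 1)\<^sup>2 * B\<^sup>2 * (2 + 2 * exp_sq_const) + 2 * L\<^sup>2 * \<sigma>\<^sup>2"
  have A0: "A0 > 0"
    unfolding A0_def using assms(1-3) exp_sq_const_ge_1
    by (intro add_pos_nonneg mult_pos_pos) auto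
  show thesis
  proof (rule that)
    show "real CARD('d) * A0 > 0" using A0 by simp
    fix n :: nat and \<Delta>t h :: real and M :: "'w measure" and \<epsilon> :: "nat \<Rightarrow> 'w \<Rightarrow> real ^ 'd"
    assume n: "n \<ge> 3" and dt: "0 < \<Delta>t" "\<Delta>t \<le> h" and noise: "subgaussian_noise \<sigma> n M \<epsilon>"
    interpret prob_space M using noise by (simp add: subgaussian_noise_def)
    have indep: "indep_vars (\<lambda>_. borel) \<epsilon> {1..n}"
      using noise by (simp add: subgaussian_noise_def)
    have indep': "indep_vars (\<lambda>_. borel) (\<lambda>i \<omega>. \<epsilon> i \<omega> $ l) {1..n}" for l
      by (rule indep_vars_compose2[OF indep]) auto
    note comp = subgaussian_noise_component[OF noise \<open>\<sigma> \<ge> 0\<close>]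
    have pos: "\<sigma> + 1 > 0" "\<sigma>\<^sup>2 \<ge> 0" using \<open>\<sigma> \<ge> 0\<close> by auto
    have "\<forall>l. \<exists>W. W \<in> borel_measurable M \<and> (\<forall>\<omega>. 0 \<le> W \<omega>) \<and>
        (\<integral>\<^sup>+ \<omega>. ennreal (W \<omega>) \<partial>M) \<le> ennreal (A0 * ln (real n)) \<and>
        (\<forall>\<omega>. \<forall>t\<in>{0..real n * \<Delta>t}.
          (\<Sum>i = 1..n. \<phi> ((real i * \<Delta>t - t) / h) * (\<epsilon> i \<omega> $ l))\<^sup>2 \<le> h / \<Delta>t * W \<omega>)"
      unfolding A0_def
      by (rule allI)
        (rule sup_weighted_sum_dominated[OF prob_space_axioms pos \<open>B > 0\<close> \<open>L \<ge> 0\<close> n dt indep'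
          comp(1) comp(2) comp(4) comp(3) \<phi>])
    from choice[OF this] obtain W where W: "\<And>l. W l \<in> borel_measurable M" "\<And>l \<omega>. 0 \<le> W l \<omega>"
      "\<And>l. (\<integral>\<^sup>+ \<omega>. ennreal (W l \<omega>) \<partial>M) \<le> ennreal (A0 * ln (real n))"
      "\<And>l \<omega> t. t \<in> {0..real n * \<Delta>t} \<Longrightarrow>
          (\<Sum>i = 1..n. \<phi> ((real i * \<Delta>t - t) / h) * (\<epsilon> i \<omega> $ l))\<^sup>2 \<le> h / \<Delta>t * W l \<omega>"
      by blast
    note [measurable] = W(1)
    show "\<exists>W. W \<in> borel_measurable M \<and> (\<forall>\<omega>. 0 \<le> W \<omega>) \<and>
        (\<integral>\<^sup>+ \<omega>. ennreal (W \<omega>) \<partial>M) \<le> ennreal (real CARD('d) * A0 * ln (real n)) \<and>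
        (\<forall>\<omega>. \<forall>t\<in>{0..real n * \<Delta>t}.
          (norm (\<Sum>i = 1..n. \<phi> ((real i * \<Delta>t - t) / h) *\<^sub>R \<epsilon> i \<omega>))\<^sup>2 \<le> h / \<Delta>t * W \<omega>)"
    proof (intro exI conjI allI ballI)
      show "(\<lambda>\<omega>. \<Sum>l\<in>UNIV. W l \<omega>) \<in> borel_measurable M" by measurable
      show "0 \<le> (\<Sum>l\<in>UNIV. W l \<omega>)" for \<omega> by (intro sum_nonneg W(2))
      have "(\<integral>\<^sup>+ \<omega>. ennreal (\<Sum>l\<in>UNIV. W l \<omega>) \<partial>M) = (\<integral>\<^sup>+ \<omega>. (\<Sum>l\<in>UNIV. ennreal (W l \<omega>)) \<partial>M)"
        by (intro nn_integral_cong sum_ennreal[symmetric] W(2))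
      also have "\<dots> = (\<Sum>l\<in>UNIV. \<integral>\<^sup>+ \<omega>. ennreal (W l \<omega>) \<partial>M)"
        by (rule nn_integral_sum) measurable
      also have "\<dots> \<le> (\<Sum>l\<in>(UNIV :: 'd set). ennreal (A0 * ln (real n)))"
        by (intro sum_mono W(3))
      also have "\<dots> = ennreal (\<Sum>l\<in>(UNIV :: 'd set). A0 * ln (real n))"
        using A0 n by (intro sum_ennreal) auto
      finally show "(\<integral>\<^sup>+ \<omega>. ennreal (\<Sum>l\<in>UNIV. W l \<omega>) \<partial>M) \<le> ennreal (real CARD('d) * A0 * ln (real n))"
        by (simp add: mult.assoc)
      fix \<omega> t assume t: "t \<in> {0..real n * \<Delta>t}"
      have "(norm (\<Sum>i = 1..n. \<phi> ((real i * \<Delta>t - t) / h) *\<^sub>R \<epsilon> i \<omega>))\<^sup>2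
          = (\<Sum>l\<in>UNIV. (\<Sum>i = 1..n. \<phi> ((real i * \<Delta>t - t) / h) * (\<epsilon> i \<omega> $ l))\<^sup>2)"
        by (simp add: power2_norm_vec)
      also have "\<dots> \<le> (\<Sum>l\<in>UNIV. h / \<Delta>t * W l \<omega>)"
        by (intro sum_mono W(4) t)
      finally show "(norm (\<Sum>i = 1..n. \<phi> ((real i * \<Delta>t - t) / h) *\<^sub>R \<epsilon> i \<omega>))\<^sup>2
          \<le> h / \<Delta>t * (\<Sum>l\<in>UNIV. W l \<omega>)"
        by (simp add: sum_distrib_left)
    qed
  qed
qed

section \<open>The flow, the kernel and the design\<close>

lemma snake_class_lipschitz:
  assumes "f \<in> snake_class L\<^sub>0 L\<^sub>1"
  shows "norm (f x - f y) \<le> L\<^sub>1 * norm (x - y)"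
proof -
  obtain Df where Df: "\<And>x. (f has_derivative blinfun_apply (Df x)) (at x)" "\<And>x. norm (Df x) \<le> L\<^sub>1"
    using assms by (auto simp: snake_class_def)
  show ?thesis
    by (rule differentiable_bound[of UNIV f "\<lambda>x. blinfun_apply (Df x)"])
      (use Df in \<open>auto simp flip: norm_blinfun.rep_eq\<close>)
qed

text \<open>The derivative of u is f along u, which is Lipschitz in time with constant
  \<open>L\<^sub>0 * L\<^sub>1\<close>; this stands in for a bound on the second derivative. The
  mean value inequality on the segment between t and s handles both orders of the two times and
  gives up the Taylor factor 1/2.\<close>

lemma is_flow_linearization:
  assumes f: "f \<in> snake_class L\<^sub>0 L\<^sub>1" and u: "is_flow f x u" and "L\<^sub>1 \<ge> 0"
    and st: "s \<ge> 0" "t \<ge> 0"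
  shows "norm (u s - u t - (s - t) *\<^sub>R f (u t)) \<le> L\<^sub>0 * L\<^sub>1 * (s - t)\<^sup>2"
proof -
  have der: "(u has_vector_derivative f (u r)) (at r within {0..})" if "r \<ge> 0" for r
    using u that by (simp add: is_flow_def)
  have f0: "norm (f y) \<le> L\<^sub>0" for y using f by (auto simp: snake_class_def)
  have lip: "norm (u r - u t) \<le> L\<^sub>0 * \<bar>r - t\<bar>" if "r \<ge> 0" for r
    using differentiable_bound[of "{0..}" u "\<lambda>x h. h *\<^sub>R f (u x)" L\<^sub>0 r t] der f0 that st
    by (auto simp: has_vector_derivative_def onorm_scaleR_left bounded_linear_ident onorm_id)
  let ?S = "closed_segment t s"
  have S: "?S \<subseteq> {0..}" using st by (auto simp: closed_segment_eq_real_ivl)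
  have "norm (u s - u t - (s - t) *\<^sub>R f (u t)) \<le> norm (s - t) * (L\<^sub>1 * (L\<^sub>0 * \<bar>s - t\<bar>))"
  proof (rule vector_differentiable_bound_linearization[where S = ?S and f' = "\<lambda>r. f (u r)"])
    fix r assume r: "r \<in> ?S"
    then have "r \<ge> 0" using S by auto
    then show "(u has_vector_derivative f (u r)) (at r within ?S)"
      using der has_vector_derivative_within_subset S by blast
    have "norm (f (u r) - f (u t)) \<le> L\<^sub>1 * norm (u r - u t)" by (rule snake_class_lipschitz[OF f])
    also have "\<dots> \<le> L\<^sub>1 * (L\<^sub>0 * \<bar>r - t\<bar>)" using lip[OF \<open>r \<ge> 0\<close>] \<open>L\<^sub>1 \<ge> 0\<close> by (rule mult_left_mono)
    also have "\<dots> \<le> L\<^sub>1 * (L\<^sub>0 * \<bar>s - t\<bar>)"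
      using r \<open>L\<^sub>1 \<ge> 0\<close> order_trans[OF norm_ge_zero f0]
      by (intro mult_left_mono) (auto simp: closed_segment_eq_real_ivl split: if_splits)
    finally show "norm (f (u r) - f (u t)) \<le> L\<^sub>1 * (L\<^sub>0 * \<bar>s - t\<bar>)" .
  qed auto
  also have "\<dots> = L\<^sub>0 * L\<^sub>1 * (s - t)\<^sup>2"
    by (simp add: power2_eq_square abs_mult_self_eq)
  finally show ?thesis .
qed

text \<open>Comparison of the minimiser with one explicit competitor replaces differentiation: a
  step along the candidate gradient E changes the loss by \<open>s * (s * q - 2)\<close> times the
  squared norm of E, which is negative for small s unless E = 0.\<close>

lemma weighted_least_squares_normal_equation:
  fixes e :: "nat \<Rightarrow> 'a::real_inner"
  assumes "finite I" and k: "\<And>i. i \<in> I \<Longrightarrow> 0 \<le> k i"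
    and min: "\<And>v. (\<Sum>i\<in>I. (norm (e i))\<^sup>2 * k i) \<le> (\<Sum>i\<in>I. (norm (e i - g i *\<^sub>R v))\<^sup>2 * k i)"
  shows "(\<Sum>i\<in>I. (k i * g i) *\<^sub>R e i) = 0"
proof -
  define E where "E = (\<Sum>i\<in>I. (k i * g i) *\<^sub>R e i)"
  define q where "q = (\<Sum>i\<in>I. k i * (g i)\<^sup>2)"
  have q: "q \<ge> 0" unfolding q_def by (intro sum_nonneg mult_nonneg_nonneg k) auto
  \<comment> \<open>Small enough for s q < 1; the 1 in the denominator covers q = 0.\<close>
  define s where "s = 1 / (q + 1)"
  have "(\<Sum>i\<in>I. (norm (e i - g i *\<^sub>R (s *\<^sub>R E)))\<^sup>2 * k i)
      = (\<Sum>i\<in>I. (norm (e i))\<^sup>2 * k i - 2 * s * (((k i * g i) *\<^sub>R e i) \<bullet> E) + s\<^sup>2 * (E \<bullet> E) * (k i * (g i)\<^sup>2))"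
    unfolding power2_norm_eq_inner by (intro sum.cong refl)
      (simp add: inner_diff_left inner_diff_right inner_commute power2_eq_square algebra_simps)
  also have "\<dots> = (\<Sum>i\<in>I. (norm (e i))\<^sup>2 * k i) - 2 * s * (E \<bullet> E) + s\<^sup>2 * (E \<bullet> E) * q"
    unfolding sum.distrib sum_subtractf sum_distrib_left[symmetric] inner_sum_left[symmetric]
      E_def[symmetric] q_def[symmetric] ..
  finally have "2 * s * (E \<bullet> E) \<le> s\<^sup>2 * (E \<bullet> E) * q" using min[of "s *\<^sub>R E"] by linarith
  then have "s * ((E \<bullet> E) * (2 - s * q)) \<le> 0" by (simp add: power2_eq_square algebra_simps)
  moreover have "s > 0" using q by (simp add: s_def)
  moreover have "s * q < 1" using q by (simp add: s_def divide_simps)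
  ultimately have "E \<bullet> E \<le> 0" by (simp add: mult_le_0_iff)
  then have "E \<bullet> E = 0" using inner_ge_zero[of E] by (rule antisym)
  then show ?thesis by (simp add: E_def[symmetric])
qed

text \<open>An affine function is determined by its values at two separated points. The difference
  of the values controls the slope (constant 18 = 9 * 2), and the value at z, with |z| \<le> 1, then
  controls the intercept; altogether 56 = 2 + 3 * 18.\<close>

lemma two_point_bound:
  fixes D\<^sub>0 D\<^sub>1 :: "'a::real_normed_vector"
  assumes "0 < \<eta>" "\<eta> \<le> 1" "z' - z \<ge> \<eta> / 3" "\<bar>z\<bar> \<le> 1"
  shows "\<eta>\<^sup>2 / 56 * ((norm D\<^sub>0)\<^sup>2 + (norm D\<^sub>1)\<^sup>2)
    \<le> (norm (D\<^sub>0 + z *\<^sub>R D\<^sub>1))\<^sup>2 + (norm (D\<^sub>0 + z' *\<^sub>R D\<^sub>1))\<^sup>2"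
proof -
  define p q where "p = norm (D\<^sub>0 + z *\<^sub>R D\<^sub>1)" and "q = norm (D\<^sub>0 + z' *\<^sub>R D\<^sub>1)"
  have pq: "0 \<le> p" "0 \<le> q" by (auto simp: p_def q_def)
  have two: "(x + y)\<^sup>2 \<le> 2 * x\<^sup>2 + 2 * y\<^sup>2" for x y :: real
  proof -
    have "0 \<le> (x - y)\<^sup>2" by simp
    then show ?thesis by (simp add: power2_eq_square algebra_simps)
  qed
  have "\<eta> / 3 * norm D\<^sub>1 \<le> (z' - z) * norm D\<^sub>1"
    using assms by (intro mult_right_mono) auto
  also have "\<dots> = norm ((z' - z) *\<^sub>R D\<^sub>1)" using assms by simp
  also have "(z' - z) *\<^sub>R D\<^sub>1 = (D\<^sub>0 + z' *\<^sub>R D\<^sub>1) - (D\<^sub>0 + z *\<^sub>R D\<^sub>1)" by (simp add: algebra_simps)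
  also have "norm \<dots> \<le> p + q" unfolding p_def q_def by (metis add.commute norm_triangle_ineq4)
  finally have "(\<eta> / 3 * norm D\<^sub>1)\<^sup>2 \<le> (p + q)\<^sup>2" using assms by (intro power_mono) auto
  then have 1: "\<eta>\<^sup>2 * (norm D\<^sub>1)\<^sup>2 \<le> 18 * (p\<^sup>2 + q\<^sup>2)"
    using two[of p q] by (simp add: power_mult_distrib power_divide)
  have "norm D\<^sub>0 = norm ((D\<^sub>0 + z *\<^sub>R D\<^sub>1) - z *\<^sub>R D\<^sub>1)" by simp
  also have "\<dots> \<le> p + norm (z *\<^sub>R D\<^sub>1)" unfolding p_def by (rule norm_triangle_ineq4)
  also have "norm (z *\<^sub>R D\<^sub>1) \<le> norm D\<^sub>1" using assms by (simp add: mult_left_le_one_le)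
  finally have "(norm D\<^sub>0)\<^sup>2 \<le> (p + norm D\<^sub>1)\<^sup>2" by (intro power_mono) auto
  also have "\<dots> \<le> 2 * p\<^sup>2 + 2 * (norm D\<^sub>1)\<^sup>2" by (rule two)
  finally have "\<eta>\<^sup>2 * (norm D\<^sub>0)\<^sup>2 \<le> \<eta>\<^sup>2 * (2 * p\<^sup>2 + 2 * (norm D\<^sub>1)\<^sup>2)" by (intro mult_left_mono) auto
  moreover have "\<eta>\<^sup>2 * p\<^sup>2 \<le> 1 * p\<^sup>2" using assms by (intro mult_right_mono) (auto simp: power_le_one)
  ultimately have "\<eta>\<^sup>2 * ((norm D\<^sub>0)\<^sup>2 + (norm D\<^sub>1)\<^sup>2) \<le> 2 * p\<^sup>2 + 54 * (p\<^sup>2 + q\<^sup>2)"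
    using 1 by (simp add: algebra_simps)
  also have "\<dots> \<le> 56 * (p\<^sup>2 + q\<^sup>2)" by simp
  finally show ?thesis by (simp add: p_def q_def)
qed

text \<open>The kernel assumption in quantitative form. Nondegeneracy becomes an interval [a, b] on
  which K is at least \<kappa>; it may lie away from 0.\<close>

locale kernel_bounds =
  fixes K :: "real \<Rightarrow> real" and B L a b \<kappa> :: real
  assumes B: "B > 0" and L: "L \<ge> 0" and \<kappa>: "\<kappa> > 0" and ab: "0 \<le> a" "a < b" "b \<le> 1"
    and K_nonneg: "z \<ge> 0 \<Longrightarrow> K z \<ge> 0" and K_le: "z \<ge> 0 \<Longrightarrow> K z \<le> B"
    and K_zero: "z > 1 \<Longrightarrow> K z = 0"
    and K_lip: "x \<ge> 0 \<Longrightarrow> y \<ge> 0 \<Longrightarrow> \<bar>K x - K y\<bar> \<le> L * \<bar>x - y\<bar>"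
    and K_ge: "a \<le> z \<Longrightarrow> z \<le> b \<Longrightarrow> K z \<ge> \<kappa>"

lemma admissible_kernel_bounds:
  assumes "admissible_kernel K"
  obtains B L a b \<kappa> where "kernel_bounds K B L a b \<kappa>"
proof -
  from assms obtain L B z\<^sub>0 where lip: "L-lipschitz_on {0..} K" and nn: "\<And>z. z \<ge> 0 \<Longrightarrow> K z \<ge> 0"
    and z0: "z\<^sub>0 \<ge> 0" "K z\<^sub>0 \<noteq> 0" and B: "B > 0" "\<And>z. z \<ge> 0 \<Longrightarrow> K z \<le> B * indicator {0..1} z"
    by (auto simp: admissible_kernel_def)
  have L: "L \<ge> 0" using lip by (rule lipschitz_on_nonneg)
  have lip': "\<bar>K x - K y\<bar> \<le> L * \<bar>x - y\<bar>" if "x \<ge> 0" "y \<ge> 0" for x y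
    using lipschitz_onD[OF lip, of x y] that by (simp add: dist_real_def)
  have zero: "K z = 0" if "z > 1" for z
    using nn[of z] B(2)[of z] that by (simp add: indicator_def)
  have kz: "K z\<^sub>0 > 0" using nn[OF z0(1)] z0(2) by simp
  \<comment> \<open>The distance over which the Lipschitz bound lets K lose at most half of its
    value at \<open>z\<^sub>0\<close>; \<open>L + 1\<close> avoids division by zero for constant
    K.\<close>
  define \<eta> where "\<eta> = K z\<^sub>0 / 2 / (L + 1)"
  have \<eta>: "\<eta> > 0" using kz L by (simp add: \<eta>_def)
  have ge: "K z \<ge> K z\<^sub>0 / 2" if "z\<^sub>0 \<le> z" "z \<le> z\<^sub>0 + \<eta>" for z
  proof -
    have "\<bar>K z - K z\<^sub>0\<bar> \<le> L * \<bar>z - z\<^sub>0\<bar>" using that z0 by (intro lip') auto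
    also have "\<dots> \<le> (L + 1) * \<eta>" using that L by (intro mult_mono) auto
    also have "\<dots> = K z\<^sub>0 / 2" using L by (simp add: \<eta>_def field_simps)
    finally show ?thesis by linarith
  qed
  \<comment> \<open>K is still positive at the right end of the interval, while it vanishes beyond
    1.\<close>
  have le1: "z\<^sub>0 + \<eta> \<le> 1"
  proof (rule ccontr)
    assume "\<not> z\<^sub>0 + \<eta> \<le> 1"
    then show False using zero[of "z\<^sub>0 + \<eta>"] ge[of "z\<^sub>0 + \<eta>"] kz \<eta> by simp
  qed
  have "kernel_bounds K B L z\<^sub>0 (z\<^sub>0 + \<eta>) (K z\<^sub>0 / 2)"
  proof
    show "K z \<le> B" if "z \<ge> 0" for z
      using B(2)[OF that] B(1) by (cases "z \<le> 1") (simp_all add: indicator_def that)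
  qed (use B L kz z0 \<eta> le1 nn zero lip' ge in auto)
  then show thesis by (rule that)
qed

context kernel_bounds
begin

lemma K_abs_le: "\<bar>K \<bar>z\<bar>\<bar> \<le> B"
  using K_le[of "\<bar>z\<bar>"] K_nonneg[of "\<bar>z\<bar>"] by simp

lemma K_abs_mult_le: "\<bar>K \<bar>z\<bar> * z\<bar> \<le> B"
proof (cases "\<bar>z\<bar> \<le> 1")
  case True
  have "\<bar>K \<bar>z\<bar>\<bar> * \<bar>z\<bar> \<le> B * 1" using True K_abs_le B by (intro mult_mono) auto
  then show ?thesis by (simp add: abs_mult)
qed (use B K_zero in simp)

lemma K_abs_lip: "\<bar>K \<bar>z\<bar> - K \<bar>z'\<bar>\<bar> \<le> L * \<bar>z - z'\<bar>"
proof -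
  have "\<bar>K \<bar>z\<bar> - K \<bar>z'\<bar>\<bar> \<le> L * \<bar>\<bar>z\<bar> - \<bar>z'\<bar>\<bar>" by (intro K_lip) auto
  also have "\<dots> \<le> L * \<bar>z - z'\<bar>" using L by (intro mult_left_mono) auto
  finally show ?thesis .
qed

text \<open>The factor z is unbounded, so the product is split with z on the argument inside
  [-1, 1]. By symmetry it suffices that one argument lies there; otherwise both products
  vanish.\<close>

lemma K_abs_mult_lip: "\<bar>K \<bar>z\<bar> * z - K \<bar>z'\<bar> * z'\<bar> \<le> (L + B) * \<bar>z - z'\<bar>"
proof -
  have *: "\<bar>K \<bar>z\<bar> * z - K \<bar>z'\<bar> * z'\<bar> \<le> (L + B) * \<bar>z - z'\<bar>" if "\<bar>z\<bar> \<le> 1" for z z'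
  proof -
    have "K \<bar>z\<bar> * z - K \<bar>z'\<bar> * z' = (K \<bar>z\<bar> - K \<bar>z'\<bar>) * z + K \<bar>z'\<bar> * (z - z')"
      by (simp add: algebra_simps)
    also have "\<bar>\<dots>\<bar> \<le> \<bar>K \<bar>z\<bar> - K \<bar>z'\<bar>\<bar> * \<bar>z\<bar> + \<bar>K \<bar>z'\<bar>\<bar> * \<bar>z - z'\<bar>"
      by (metis abs_mult abs_triangle_ineq)
    also have "\<dots> \<le> (L * \<bar>z - z'\<bar>) * 1 + B * \<bar>z - z'\<bar>"
      using that K_abs_lip K_abs_le L B by (intro add_mono mult_mono) auto
    finally show ?thesis by (simp add: algebra_simps)
  qed
  show ?thesis
  proof (cases "\<bar>z\<bar> \<le> 1 \<or> \<bar>z'\<bar> \<le> 1")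
    case True
    then show ?thesis using *[of z z'] *[of z' z] by (auto simp: abs_minus_commute)
  next
    case False
    then show ?thesis using K_zero L B by simp
  qed
qed

lemma continuous_on_K_abs: "continuous_on UNIV (\<lambda>z. K \<bar>z\<bar>)"
proof (rule lipschitz_on_continuous_on)
  show "L-lipschitz_on UNIV (\<lambda>z. K \<bar>z\<bar>)"
    using K_abs_lip L by (intro lipschitz_onI) (auto simp: dist_real_def)
qed

text \<open>672 = 56 * 6 * 2: the two-point bound, at least N (b - a) / 6 pairs of points, and the
  two groups each being compared with the full sum.\<close>

definition design_const :: real where
  "design_const = \<kappa> * (b - a) ^ 3 / 672"

lemma design_const_pos: "design_const > 0"
  using \<kappa> ab by (simp add: design_const_def)

text \<open>
  The window contains, on one side of \<open>t\<close>, two groups of \<open>m\<close> design points each whose rescaled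
  positions lie in the region where \<open>K \<ge> \<kappa>\<close> and are separated by \<open>\<eta> / 3\<close>.
\<close>

lemma design_lower_bound:
  fixes D\<^sub>0 D\<^sub>1 :: "'a::real_normed_vector" and \<Delta>t h t :: real
  assumes dt: "0 < \<Delta>t" and h: "6 / (b - a) * \<Delta>t \<le> h" "h \<le> real n * \<Delta>t / 2"
    and t: "t \<in> {0..real n * \<Delta>t}"
  shows "design_const * (h / \<Delta>t) * ((norm D\<^sub>0)\<^sup>2 + (norm D\<^sub>1)\<^sup>2)
    \<le> (\<Sum>i = 1..n. K \<bar>(real i * \<Delta>t - t) / h\<bar> * (norm (D\<^sub>0 + ((real i * \<Delta>t - t) / h) *\<^sub>R D\<^sub>1))\<^sup>2)"
proof -
  define \<eta> where "\<eta> = b - a"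
  have \<eta>: "0 < \<eta>" "\<eta> \<le> 1" using ab by (auto simp: \<eta>_def)
  define N where "N = h / \<Delta>t"
  have "N * \<Delta>t = h" using dt by (simp add: N_def)
  have N6: "6 \<le> N * \<eta>" using h(1) dt \<eta> by (simp add: N_def \<eta>_def[symmetric] field_simps)
  then have "N > 0" using \<eta> by (metis less_le_trans zero_less_mult_pos2 zero_less_numeral)
  then have h0: "h > 0" using \<open>N * \<Delta>t = h\<close> dt by (metis mult_pos_pos)
  define z where "z i = (real i * \<Delta>t - t) / h" for i :: nat
  define F where "F i = K \<bar>z i\<bar> * (norm (D\<^sub>0 + z i *\<^sub>R D\<^sub>1))\<^sup>2" for i
  have F0: "F i \<ge> 0" for i unfolding F_def by (intro mult_nonneg_nonneg K_nonneg) auto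
  \<comment> \<open>In the first half of the time range the interval [a, b] is placed to the right
    of t, in the second half its mirror image to the left. Since h b \<le> h \<le> T / 2, it stays
    inside the range.\<close>
  obtain p where p: "t + h * p \<ge> 0" "t + h * (p + \<eta>) \<le> real n * \<Delta>t"
    "\<And>y. p < y \<Longrightarrow> y \<le> p + \<eta> \<Longrightarrow> a \<le> \<bar>y\<bar> \<and> \<bar>y\<bar> \<le> b"
  proof (cases "t \<le> real n * \<Delta>t / 2")
    case True
    have "h * b \<le> h" "0 \<le> h * a" using h0 ab by auto
    then show thesis using True h t ab by (intro that[of a]) (auto simp: \<eta>_def)
  next
    case False
    have "h * b \<le> h" "0 \<le> h * a" using h0 ab by auto
    then show thesis using False h t ab by (intro that[of "- b"]) (auto simp: \<eta>_def)
  qed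
  define x where "x = (t + h * p) / \<Delta>t"
  have x0: "x \<ge> 0" using p dt by (simp add: x_def)
  have xn: "x + N * \<eta> \<le> real n"
    using p(2) dt by (simp add: x_def N_def field_simps)
  have z_iff: "z i = p + (real i - x) / N" for i
    using dt h0 by (simp add: z_def x_def N_def field_simps)
  \<comment> \<open>The number of sampling steps that fit into a third of the interval. Because N
    \<eta> \<ge> 6, rounding down loses at most half: m \<ge> N \<eta> / 6.\<close>
  define m where "m = nat \<lfloor>N * \<eta> / 3\<rfloor>"
  have m: "real m \<le> N * \<eta> / 3" "N * \<eta> / 3 \<le> real m + 1"
  proof -
    have "real m = real_of_int \<lfloor>N * \<eta> / 3\<rfloor>" using N6 by (simp add: m_def)
    then show "real m \<le> N * \<eta> / 3" "N * \<eta> / 3 \<le> real m + 1" by linarith+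
  qed
  \<comment> \<open>In units of \<Delta>t, the last integers up to the start of the first and of the
    last third; the middle third separates the groups. Counting from k = 1 keeps the indices at
    least 1, as nothing is observed at time 0.\<close>
  define i\<^sub>0 j\<^sub>0 where "i\<^sub>0 = nat \<lfloor>x\<rfloor>" and "j\<^sub>0 = nat \<lfloor>x + 2 * N * \<eta> / 3\<rfloor>"
  have i0: "real i\<^sub>0 \<le> x" "x < real i\<^sub>0 + 1" using x0 by (auto simp: i\<^sub>0_def)
  have j0: "real j\<^sub>0 \<le> x + 2 * N * \<eta> / 3" "x + 2 * N * \<eta> / 3 < real j\<^sub>0 + 1"
    using x0 N6 by (auto simp: j\<^sub>0_def)
  have z1: "p < z (i\<^sub>0 + k) \<and> z (i\<^sub>0 + k) \<le> p + \<eta> / 3 \<and> i\<^sub>0 + k \<in> {1..n}" if "k \<in> {1..m}" for k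
  proof -
    have "real k \<ge> 1" "real k \<le> real m" using that by auto
    then have *: "x < real (i\<^sub>0 + k)" "real (i\<^sub>0 + k) \<le> x + N * \<eta> / 3" using i0 m by auto
    moreover from * have "real (i\<^sub>0 + k) \<le> real n" using xn N6 by linarith
    ultimately show ?thesis using that \<open>N > 0\<close> by (auto simp: z_iff field_simps)
  qed
  have z2: "p + 2 * \<eta> / 3 < z (j\<^sub>0 + k) \<and> z (j\<^sub>0 + k) \<le> p + \<eta> \<and> j\<^sub>0 + k \<in> {1..n}" if "k \<in> {1..m}" for k
  proof -
    have "real k \<ge> 1" "real k \<le> real m" using that by auto
    then have *: "x + 2 * N * \<eta> / 3 < real (j\<^sub>0 + k)" "real (j\<^sub>0 + k) \<le> x + N * \<eta>" using j0 m by auto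
    moreover from * have "real (j\<^sub>0 + k) \<le> real n" using xn by linarith
    ultimately show ?thesis using that \<open>N > 0\<close> by (auto simp: z_iff field_simps)
  qed
  \<comment> \<open>Each group is compared with the full sum on its own, at the price of a factor 2,
    instead of proving the two groups disjoint.\<close>
  have shift: "(\<Sum>k = 1..m. F (c + k)) \<le> (\<Sum>i = 1..n. F i)" if "\<And>k. k \<in> {1..m} \<Longrightarrow> c + k \<in> {1..n}" for c
  proof -
    have "(\<Sum>k = 1..m. F (c + k)) = sum F ((+) c ` {1..m})"
      by (subst sum.reindex) auto
    also have "\<dots> \<le> (\<Sum>i = 1..n. F i)"
    proof (rule sum_mono2)
      show "(+) c ` {1..m} \<subseteq> {1..n}" using that by blast
    qed (use F0 in auto)
    finally show ?thesis .
  qed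
  have pair: "\<kappa> * (\<eta>\<^sup>2 / 56 * ((norm D\<^sub>0)\<^sup>2 + (norm D\<^sub>1)\<^sup>2)) \<le> F (i\<^sub>0 + k) + F (j\<^sub>0 + k)" if k: "k \<in> {1..m}" for k
  proof -
    have in1: "a \<le> \<bar>z (i\<^sub>0 + k)\<bar> \<and> \<bar>z (i\<^sub>0 + k)\<bar> \<le> b" using z1[OF k] \<eta> by (intro p(3)) auto
    have in2: "a \<le> \<bar>z (j\<^sub>0 + k)\<bar> \<and> \<bar>z (j\<^sub>0 + k)\<bar> \<le> b" using z2[OF k] \<eta> by (intro p(3)) auto
    have "\<kappa> * (\<eta>\<^sup>2 / 56 * ((norm D\<^sub>0)\<^sup>2 + (norm D\<^sub>1)\<^sup>2))
        \<le> \<kappa> * ((norm (D\<^sub>0 + z (i\<^sub>0 + k) *\<^sub>R D\<^sub>1))\<^sup>2 + (norm (D\<^sub>0 + z (j\<^sub>0 + k) *\<^sub>R D\<^sub>1))\<^sup>2)"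
      using z1[OF k] z2[OF k] \<eta> in1 ab \<kappa> by (intro mult_left_mono two_point_bound) auto
    also have "\<dots> \<le> F (i\<^sub>0 + k) + F (j\<^sub>0 + k)"
      unfolding F_def distrib_left using in1 in2 by (intro add_mono mult_right_mono K_ge) auto
    finally show ?thesis .
  qed
  define Q where "Q = (norm D\<^sub>0)\<^sup>2 + (norm D\<^sub>1)\<^sup>2"
  have Q: "Q \<ge> 0" by (simp add: Q_def)
  have "N * \<eta> / 6 \<le> real m" using m N6 by linarith
  then have "N * \<eta> / 6 * (\<kappa> * (\<eta>\<^sup>2 / 56 * Q)) \<le> real m * (\<kappa> * (\<eta>\<^sup>2 / 56 * Q))"
    using \<kappa> Q by (intro mult_right_mono) auto
  also have "\<dots> = (\<Sum>k = 1..m. \<kappa> * (\<eta>\<^sup>2 / 56 * Q))" by simp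
  also have "\<dots> \<le> (\<Sum>k = 1..m. F (i\<^sub>0 + k) + F (j\<^sub>0 + k))" unfolding Q_def by (intro sum_mono pair)
  also have "\<dots> \<le> 2 * (\<Sum>i = 1..n. F i)"
    using shift[of i\<^sub>0] shift[of j\<^sub>0] z1 z2 by (simp add: sum.distrib)
  finally have "\<kappa> * \<eta> ^ 3 / 672 * N * Q \<le> (\<Sum>i = 1..n. F i)"
    by (simp add: power3_eq_cube power2_eq_square field_simps)
  then show ?thesis by (simp add: design_const_def \<eta>_def Q_def N_def F_def z_def)
qed

end

section \<open>Local linear regression\<close>

lemma local_linear_loss_eq:
  assumes "h > 0"
  shows "local_linear_loss K h n \<Delta>t Y t (\<theta>\<^sub>0, \<theta>\<^sub>1)
    = (\<Sum>i = 1..n. (norm (Y i - \<theta>\<^sub>0 - ((real i * \<Delta>t - t) / h) *\<^sub>R \<theta>\<^sub>1))\<^sup>2 * K \<bar>(real i * \<Delta>t - t) / h\<bar>)"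
  using assms by (simp add: local_linear_loss_def)

context kernel_bounds
begin

lemma step_le_bandwidth:
  assumes "0 < \<Delta>t" and "6 / (b - a) * \<Delta>t \<le> h"
  shows "\<Delta>t \<le> h"
proof -
  have "1 \<le> 6 / (b - a)" using ab by (simp add: le_divide_eq)
  then have "1 * \<Delta>t \<le> 6 / (b - a) * \<Delta>t" using assms by (intro mult_right_mono) auto
  then show ?thesis using assms by simp
qed

text \<open>The first equation comes from varying the intercept alone, the second from varying the
  slope alone.\<close>

lemma local_linear_fit_normal_equations:
  assumes fit: "local_linear_fit K h n \<Delta>t Y \<theta>\<^sub>0 \<theta>\<^sub>1" and "h > 0" and t: "t \<in> {0..real n * \<Delta>t}"
  defines "z \<equiv> \<lambda>i. (real i * \<Delta>t - t) / h"
  shows "(\<Sum>i = 1..n. K \<bar>z i\<bar> *\<^sub>R (Y i - \<theta>\<^sub>0 t - z i *\<^sub>R \<theta>\<^sub>1 t)) = 0"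
    and "(\<Sum>i = 1..n. (K \<bar>z i\<bar> * z i) *\<^sub>R (Y i - \<theta>\<^sub>0 t - z i *\<^sub>R \<theta>\<^sub>1 t)) = 0"
proof -
  have min: "local_linear_loss K h n \<Delta>t Y t (\<theta>\<^sub>0 t, \<theta>\<^sub>1 t) \<le> local_linear_loss K h n \<Delta>t Y t (v, w)" for v w
    using fit t by (auto simp: local_linear_fit_def is_arg_min_def not_less)
  have "(\<Sum>i\<in>{1..n}. (K \<bar>z i\<bar> * 1) *\<^sub>R (Y i - \<theta>\<^sub>0 t - z i *\<^sub>R \<theta>\<^sub>1 t)) = 0"
  proof (rule weighted_least_squares_normal_equation)
    fix v
    show "(\<Sum>i = 1..n. (norm (Y i - \<theta>\<^sub>0 t - z i *\<^sub>R \<theta>\<^sub>1 t))\<^sup>2 * K \<bar>z i\<bar>)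
        \<le> (\<Sum>i = 1..n. (norm (Y i - \<theta>\<^sub>0 t - z i *\<^sub>R \<theta>\<^sub>1 t - 1 *\<^sub>R v))\<^sup>2 * K \<bar>z i\<bar>)"
      using min[of "\<theta>\<^sub>0 t + v" "\<theta>\<^sub>1 t"] unfolding local_linear_loss_eq[OF \<open>h > 0\<close>] z_def
      by (simp add: algebra_simps)
  qed (auto intro: K_nonneg)
  then show "(\<Sum>i = 1..n. K \<bar>z i\<bar> *\<^sub>R (Y i - \<theta>\<^sub>0 t - z i *\<^sub>R \<theta>\<^sub>1 t)) = 0" by simp
  show "(\<Sum>i = 1..n. (K \<bar>z i\<bar> * z i) *\<^sub>R (Y i - \<theta>\<^sub>0 t - z i *\<^sub>R \<theta>\<^sub>1 t)) = 0"
  proof (rule weighted_least_squares_normal_equation)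
    fix v
    show "(\<Sum>i = 1..n. (norm (Y i - \<theta>\<^sub>0 t - z i *\<^sub>R \<theta>\<^sub>1 t))\<^sup>2 * K \<bar>z i\<bar>)
        \<le> (\<Sum>i = 1..n. (norm (Y i - \<theta>\<^sub>0 t - z i *\<^sub>R \<theta>\<^sub>1 t - z i *\<^sub>R v))\<^sup>2 * K \<bar>z i\<bar>)"
      using min[of "\<theta>\<^sub>0 t" "\<theta>\<^sub>1 t + v"] unfolding local_linear_loss_eq[OF \<open>h > 0\<close>] z_def
      by (simp add: scaleR_add_right diff_diff_eq add.assoc)
  qed (auto intro: K_nonneg)
qed

text \<open>The minimiser is an arbitrary choice for every t, so continuity has to come from
  uniqueness: the determinant of the normal equations is positive, and Cramer's rule expresses the
  intercept through sums that are continuous in t. This makes the nearest neighbour rule applicable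
  to the fitted curve.\<close>

lemma local_linear_fit_continuous:
  fixes \<theta>\<^sub>0 \<theta>\<^sub>1 :: "real \<Rightarrow> real ^ 'd::finite"
  assumes fit: "local_linear_fit K h n \<Delta>t Y \<theta>\<^sub>0 \<theta>\<^sub>1"
    and dt: "0 < \<Delta>t" and h: "6 / (b - a) * \<Delta>t \<le> h" "h \<le> real n * \<Delta>t / 2"
  shows "continuous_on {0..real n * \<Delta>t} \<theta>\<^sub>0"
proof -
  have "0 < 6 / (b - a) * \<Delta>t" using dt ab by simp
  then have h0: "h > 0" using h by linarith
  define z where "z t i = (real i * \<Delta>t - t) / h" for t and i :: nat
  define s\<^sub>0 where "s\<^sub>0 t = (\<Sum>i = 1..n. K \<bar>z t i\<bar>)" for t
  define s\<^sub>1 where "s\<^sub>1 t = (\<Sum>i = 1..n. K \<bar>z t i\<bar> * z t i)" for t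
  define s\<^sub>2 where "s\<^sub>2 t = (\<Sum>i = 1..n. K \<bar>z t i\<bar> * (z t i)\<^sup>2)" for t
  define A\<^sub>0 where "A\<^sub>0 t = (\<Sum>i = 1..n. K \<bar>z t i\<bar> *\<^sub>R Y i)" for t
  define A\<^sub>1 where "A\<^sub>1 t = (\<Sum>i = 1..n. (K \<bar>z t i\<bar> * z t i) *\<^sub>R Y i)" for t
  have cz: "continuous_on S (\<lambda>t. z t i)" for S i
    unfolding z_def using h0 by (intro continuous_intros) auto
  have cK: "continuous_on S (\<lambda>t. K \<bar>z t i\<bar>)" for S i
    using continuous_on_compose2[OF continuous_on_K_abs cz] by auto
  note [continuous_intros] = cz cK
  have det: "s\<^sub>0 t * s\<^sub>2 t - (s\<^sub>1 t)\<^sup>2 > 0" if t: "t \<in> {0..real n * \<Delta>t}" for t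
  proof -
    have "h / \<Delta>t > 0" using h0 dt by simp
    have form: "design_const * (h / \<Delta>t) * (\<alpha>\<^sup>2 + \<beta>\<^sup>2) \<le> s\<^sub>0 t * \<alpha>\<^sup>2 + 2 * s\<^sub>1 t * \<alpha> * \<beta> + s\<^sub>2 t * \<beta>\<^sup>2" for \<alpha> \<beta> :: real
    proof -
      have "(\<Sum>i = 1..n. K \<bar>z t i\<bar> * (\<alpha> + z t i * \<beta>)\<^sup>2)
          = (\<Sum>i = 1..n. K \<bar>z t i\<bar> * \<alpha>\<^sup>2 + (K \<bar>z t i\<bar> * z t i) * (2 * \<alpha> * \<beta>) + (K \<bar>z t i\<bar> * (z t i)\<^sup>2) * \<beta>\<^sup>2)"
        by (intro sum.cong) (auto simp: power2_eq_square algebra_simps)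
      also have "\<dots> = s\<^sub>0 t * \<alpha>\<^sup>2 + s\<^sub>1 t * (2 * \<alpha> * \<beta>) + s\<^sub>2 t * \<beta>\<^sup>2"
        unfolding s\<^sub>0_def s\<^sub>1_def s\<^sub>2_def sum_distrib_right sum.distrib ..
      finally show ?thesis
        using design_lower_bound[OF dt h t, of \<alpha> \<beta>] by (simp add: z_def mult_ac)
    qed
    have pos: "0 < design_const * (h / \<Delta>t) * c" if "c > 0" for c
      using design_const_pos \<open>h / \<Delta>t > 0\<close> that by (intro mult_pos_pos)
    have s0: "s\<^sub>0 t > 0" using form[of 1 0] pos[of 1] by simp
    \<comment> \<open>At the vector \<open>(- s\<^sub>1 t, s\<^sub>0 t)\<close> the quadratic form
      equals \<open>s\<^sub>0 t\<close> times the determinant.\<close>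
    then have "0 < design_const * (h / \<Delta>t) * ((- s\<^sub>1 t)\<^sup>2 + (s\<^sub>0 t)\<^sup>2)"
      by (intro pos add_nonneg_pos) auto
    also have "\<dots> \<le> s\<^sub>0 t * (s\<^sub>0 t * s\<^sub>2 t - (s\<^sub>1 t)\<^sup>2)"
      using form[of "- s\<^sub>1 t" "s\<^sub>0 t"] by (simp add: power2_eq_square algebra_simps)
    finally show ?thesis using s0 by (simp add: zero_less_mult_iff)
  qed
  have eq: "\<theta>\<^sub>0 t = (1 / (s\<^sub>0 t * s\<^sub>2 t - (s\<^sub>1 t)\<^sup>2)) *\<^sub>R (s\<^sub>2 t *\<^sub>R A\<^sub>0 t - s\<^sub>1 t *\<^sub>R A\<^sub>1 t)"
    if t: "t \<in> {0..real n * \<Delta>t}" for t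
  proof -
    note ne = local_linear_fit_normal_equations[OF fit h0 t, folded z_def[of t]]
    have "A\<^sub>0 t - s\<^sub>0 t *\<^sub>R \<theta>\<^sub>0 t - s\<^sub>1 t *\<^sub>R \<theta>\<^sub>1 t
        = (\<Sum>i = 1..n. K \<bar>z t i\<bar> *\<^sub>R (Y i - \<theta>\<^sub>0 t - z t i *\<^sub>R \<theta>\<^sub>1 t))"
      unfolding A\<^sub>0_def s\<^sub>0_def s\<^sub>1_def scaleR_sum_left sum_subtractf[symmetric]
      by (intro sum.cong) (simp_all add: scaleR_diff_right)
    also have "\<dots> = 0" using ne(1) by (simp add: z_def)
    finally have 0: "A\<^sub>0 t = s\<^sub>0 t *\<^sub>R \<theta>\<^sub>0 t + s\<^sub>1 t *\<^sub>R \<theta>\<^sub>1 t" by (simp add: algebra_simps)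
    have "A\<^sub>1 t - s\<^sub>1 t *\<^sub>R \<theta>\<^sub>0 t - s\<^sub>2 t *\<^sub>R \<theta>\<^sub>1 t
        = (\<Sum>i = 1..n. (K \<bar>z t i\<bar> * z t i) *\<^sub>R (Y i - \<theta>\<^sub>0 t - z t i *\<^sub>R \<theta>\<^sub>1 t))"
      unfolding A\<^sub>1_def s\<^sub>1_def s\<^sub>2_def scaleR_sum_left sum_subtractf[symmetric]
      by (intro sum.cong) (simp_all add: scaleR_diff_right power2_eq_square mult.assoc)
    also have "\<dots> = 0" using ne(2) by (simp add: z_def)
    finally have 1: "A\<^sub>1 t = s\<^sub>1 t *\<^sub>R \<theta>\<^sub>0 t + s\<^sub>2 t *\<^sub>R \<theta>\<^sub>1 t" by (simp add: algebra_simps)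
    have "s\<^sub>2 t *\<^sub>R A\<^sub>0 t - s\<^sub>1 t *\<^sub>R A\<^sub>1 t = (s\<^sub>0 t * s\<^sub>2 t - (s\<^sub>1 t)\<^sup>2) *\<^sub>R \<theta>\<^sub>0 t"
      unfolding 0 1 by (simp add: algebra_simps power2_eq_square)
    then show ?thesis using det[OF t] by simp
  qed
  have "continuous_on {0..real n * \<Delta>t}
      (\<lambda>t. (1 / (s\<^sub>0 t * s\<^sub>2 t - (s\<^sub>1 t)\<^sup>2)) *\<^sub>R (s\<^sub>2 t *\<^sub>R A\<^sub>0 t - s\<^sub>1 t *\<^sub>R A\<^sub>1 t))"
  proof -
    have c: "continuous_on S s\<^sub>0" "continuous_on S s\<^sub>1" "continuous_on S s\<^sub>2"
      "continuous_on S A\<^sub>0" "continuous_on S A\<^sub>1" for S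
      unfolding s\<^sub>0_def s\<^sub>1_def s\<^sub>2_def A\<^sub>0_def A\<^sub>1_def by (intro continuous_intros)+
    have "s\<^sub>0 t * s\<^sub>2 t - (s\<^sub>1 t)\<^sup>2 \<noteq> 0" if "t \<in> {0..real n * \<Delta>t}" for t
      using det[OF that] by simp
    then show ?thesis by (intro continuous_intros c) auto
  qed
  then show ?thesis by (rule continuous_on_eq) (rule eq[symmetric])
qed

text \<open>The data minus the tangent line of u at t split into Taylor remainder and noise. The
  weight restricts the remainder to |t_i - t| \<le> h, where it is of order h^2, and at most 3N
  terms are nonzero.\<close>

lemma weighted_residual_bound:
  fixes u :: "real \<Rightarrow> real ^ 'd::finite" and \<psi> :: "real \<Rightarrow> real" and \<Delta>t h t :: real
  assumes f: "f \<in> snake_class L\<^sub>0 L\<^sub>1" and u: "is_flow f x\<^sub>1 u" and "L\<^sub>0 \<ge> 0" "L\<^sub>1 \<ge> 0"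
    and dt: "0 < \<Delta>t" "\<Delta>t \<le> h" and "t \<ge> 0"
    and \<psi>: "\<And>z. \<bar>\<psi> z\<bar> \<le> B" "\<And>z. \<bar>z\<bar> > 1 \<Longrightarrow> \<psi> z = 0"
    and noise: "(norm (\<Sum>i = 1..n. \<psi> ((real i * \<Delta>t - t) / h) *\<^sub>R e i))\<^sup>2 \<le> h / \<Delta>t * W" and "W \<ge> 0"
  shows "norm (\<Sum>i = 1..n. \<psi> ((real i * \<Delta>t - t) / h) *\<^sub>R (u (real i * \<Delta>t) + e i - u t - (real i * \<Delta>t - t) *\<^sub>R f (u t)))
    \<le> h / \<Delta>t * (3 * B * L\<^sub>0 * L\<^sub>1 * h\<^sup>2 + sqrt (W / (h / \<Delta>t)))"
proof -
  define N where "N = h / \<Delta>t"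
  have N: "N > 0" using dt by (simp add: N_def)
  have h0: "h > 0" using dt by simp
  define w where "w i = \<psi> ((real i * \<Delta>t - t) / h)" for i :: nat
  define r where "r i = u (real i * \<Delta>t) - u t - (real i * \<Delta>t - t) *\<^sub>R f (u t)" for i :: nat
  have "(\<Sum>i = 1..n. w i *\<^sub>R (u (real i * \<Delta>t) + e i - u t - (real i * \<Delta>t - t) *\<^sub>R f (u t)))
      = (\<Sum>i = 1..n. w i *\<^sub>R r i) + (\<Sum>i = 1..n. w i *\<^sub>R e i)"
    by (simp add: sum.distrib[symmetric] r_def algebra_simps)
  also have "norm \<dots> \<le> norm (\<Sum>i = 1..n. w i *\<^sub>R r i) + norm (\<Sum>i = 1..n. w i *\<^sub>R e i)"
    by (rule norm_triangle_ineq)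
  also have "norm (\<Sum>i = 1..n. w i *\<^sub>R r i) \<le> (\<Sum>i = 1..n. \<bar>w i\<bar> * (L\<^sub>0 * L\<^sub>1 * h\<^sup>2))"
  proof (rule sum_norm_le)
    fix i
    show "norm (w i *\<^sub>R r i) \<le> \<bar>w i\<bar> * (L\<^sub>0 * L\<^sub>1 * h\<^sup>2)"
    proof (cases "\<bar>(real i * \<Delta>t - t) / h\<bar> \<le> 1")
      case True
      then have "\<bar>real i * \<Delta>t - t\<bar> \<le> h" using h0 by simp
      then have "(real i * \<Delta>t - t)\<^sup>2 \<le> h\<^sup>2" using h0 by (simp add: abs_le_square_iff[symmetric])
      then have "L\<^sub>0 * L\<^sub>1 * (real i * \<Delta>t - t)\<^sup>2 \<le> L\<^sub>0 * L\<^sub>1 * h\<^sup>2"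
        using \<open>L\<^sub>0 \<ge> 0\<close> \<open>L\<^sub>1 \<ge> 0\<close> by (intro mult_left_mono) auto
      moreover have "norm (r i) \<le> L\<^sub>0 * L\<^sub>1 * (real i * \<Delta>t - t)\<^sup>2"
        unfolding r_def using dt \<open>t \<ge> 0\<close> by (intro is_flow_linearization[OF f u \<open>L\<^sub>1 \<ge> 0\<close>]) auto
      ultimately show ?thesis by (simp add: mult_left_mono)
    next
      case False
      then show ?thesis using \<psi>(2) by (simp add: w_def)
    qed
  qed
  also have "\<dots> = (\<Sum>i = 1..n. \<bar>w i\<bar>) * (L\<^sub>0 * L\<^sub>1 * h\<^sup>2)" by (simp add: sum_distrib_right)
  also have "\<dots> \<le> (3 * N * B) * (L\<^sub>0 * L\<^sub>1 * h\<^sup>2)"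
    using sum_window_le[OF dt \<psi>, where t = t and n = n] \<open>L\<^sub>0 \<ge> 0\<close> \<open>L\<^sub>1 \<ge> 0\<close>
    by (intro mult_right_mono) (auto simp: w_def N_def)
  also have "norm (\<Sum>i = 1..n. w i *\<^sub>R e i) \<le> N * sqrt (W / N)"
  proof (rule power2_le_imp_le)
    have "(N * sqrt (W / N))\<^sup>2 = N\<^sup>2 * (W / N)" using N \<open>W \<ge> 0\<close> by (simp add: power_mult_distrib)
    also have "\<dots> = N * W" using N by (simp add: power2_eq_square)
    finally have "(N * sqrt (W / N))\<^sup>2 = N * W" .
    then show "(norm (\<Sum>i = 1..n. w i *\<^sub>R e i))\<^sup>2 \<le> (N * sqrt (W / N))\<^sup>2"
      using noise by (simp add: w_def N_def)
  qed (use N \<open>W \<ge> 0\<close> in auto)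
  finally show ?thesis by (simp add: w_def N_def algebra_simps)
qed

text \<open>\<open>D\<^sub>0\<close> and \<open>D\<^sub>1\<close> are the errors of the intercept
  and of the slope in the rescaled time variable. Pairing the normal equations with them turns the
  design form at \<open>(D\<^sub>0, D\<^sub>1)\<close> into \<open>R\<^sub>0 \<bullet> D\<^sub>0 +
  R\<^sub>1 \<bullet> D\<^sub>1\<close>, so a quadratic quantity is bounded by a linear one.\<close>

lemma local_linear_fit_error:
  fixes u :: "real \<Rightarrow> real ^ 'd::finite" and \<Delta>t h t :: real
  assumes f: "f \<in> snake_class L\<^sub>0 L\<^sub>1" and u: "is_flow f x\<^sub>1 u" and "L\<^sub>0 \<ge> 0" "L\<^sub>1 \<ge> 0"
    and dt: "0 < \<Delta>t" and h: "6 / (b - a) * \<Delta>t \<le> h" "h \<le> real n * \<Delta>t / 2"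
    and t: "t \<in> {0..real n * \<Delta>t}"
    and fit: "local_linear_fit K h n \<Delta>t (\<lambda>i. u (real i * \<Delta>t) + e i) \<theta>\<^sub>0 \<theta>\<^sub>1"
    and noise: "(norm (\<Sum>i = 1..n. K \<bar>(real i * \<Delta>t - t) / h\<bar> *\<^sub>R e i))\<^sup>2 \<le> h / \<Delta>t * W"
      "(norm (\<Sum>i = 1..n. (K \<bar>(real i * \<Delta>t - t) / h\<bar> * ((real i * \<Delta>t - t) / h)) *\<^sub>R e i))\<^sup>2 \<le> h / \<Delta>t * W"
    and "W \<ge> 0"
  defines "err \<equiv> (6 * B * L\<^sub>0 * L\<^sub>1 * h\<^sup>2 + 2 * sqrt (W / (h / \<Delta>t))) / design_const"
  shows "norm (\<theta>\<^sub>0 t - u t) \<le> err" and "norm (\<theta>\<^sub>1 t - h *\<^sub>R f (u t)) \<le> err"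
proof -
  note dth = step_le_bandwidth[OF dt h(1)]
  have h0: "h > 0" using dth dt by linarith
  define N where "N = h / \<Delta>t"
  have N: "N > 0" using dt h0 by (simp add: N_def)
  define z where "z i = (real i * \<Delta>t - t) / h" for i :: nat
  have hz: "real i * \<Delta>t - t = z i * h" for i using h0 by (simp add: z_def)
  define k where "k i = K \<bar>z i\<bar>" for i
  define D\<^sub>0 where "D\<^sub>0 = \<theta>\<^sub>0 t - u t"
  define D\<^sub>1 where "D\<^sub>1 = \<theta>\<^sub>1 t - h *\<^sub>R f (u t)"
  define E where "E i = u (real i * \<Delta>t) + e i - u t - (real i * \<Delta>t - t) *\<^sub>R f (u t)" for i
  define R\<^sub>0 where "R\<^sub>0 = (\<Sum>i = 1..n. k i *\<^sub>R E i)"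
  define R\<^sub>1 where "R\<^sub>1 = (\<Sum>i = 1..n. (k i * z i) *\<^sub>R E i)"
  have res: "u (real i * \<Delta>t) + e i - \<theta>\<^sub>0 t - z i *\<^sub>R \<theta>\<^sub>1 t = E i - (D\<^sub>0 + z i *\<^sub>R D\<^sub>1)" for i
    unfolding E_def hz by (simp add: D\<^sub>0_def D\<^sub>1_def algebra_simps)
  note ne = local_linear_fit_normal_equations[OF fit h0 t, folded z_def, unfolded res, folded k_def]
  have ne0: "(\<Sum>i = 1..n. k i *\<^sub>R (D\<^sub>0 + z i *\<^sub>R D\<^sub>1)) = R\<^sub>0"
    using ne(1) by (simp add: R\<^sub>0_def scaleR_diff_right sum_subtractf)
  have ne1: "(\<Sum>i = 1..n. (k i * z i) *\<^sub>R (D\<^sub>0 + z i *\<^sub>R D\<^sub>1)) = R\<^sub>1"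
    using ne(2) by (simp add: R\<^sub>1_def scaleR_diff_right sum_subtractf)
  have "design_const * N * ((norm D\<^sub>0)\<^sup>2 + (norm D\<^sub>1)\<^sup>2) \<le> (\<Sum>i = 1..n. k i * (norm (D\<^sub>0 + z i *\<^sub>R D\<^sub>1))\<^sup>2)"
    using design_lower_bound[OF dt h t, of D\<^sub>0 D\<^sub>1] by (simp add: k_def z_def N_def)
  also have "\<dots> = (\<Sum>i = 1..n. (k i *\<^sub>R (D\<^sub>0 + z i *\<^sub>R D\<^sub>1)) \<bullet> D\<^sub>0 + ((k i * z i) *\<^sub>R (D\<^sub>0 + z i *\<^sub>R D\<^sub>1)) \<bullet> D\<^sub>1)"
    unfolding power2_norm_eq_inner
    by (intro sum.cong refl) (simp add: inner_add_left inner_add_right algebra_simps)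
  also have "\<dots> = R\<^sub>0 \<bullet> D\<^sub>0 + R\<^sub>1 \<bullet> D\<^sub>1"
    unfolding sum.distrib inner_sum_left[symmetric] ne0 ne1 ..
  also have "\<dots> \<le> norm R\<^sub>0 * norm D\<^sub>0 + norm R\<^sub>1 * norm D\<^sub>1"
    by (intro add_mono norm_cauchy_schwarz)
  finally have energy: "design_const * N * ((norm D\<^sub>0)\<^sup>2 + (norm D\<^sub>1)\<^sup>2) \<le> norm R\<^sub>0 * norm D\<^sub>0 + norm R\<^sub>1 * norm D\<^sub>1" .
  have R0: "norm R\<^sub>0 \<le> N * (3 * B * L\<^sub>0 * L\<^sub>1 * h\<^sup>2 + sqrt (W / N))"
    unfolding R\<^sub>0_def E_def k_def z_def N_def
    using t by (intro weighted_residual_bound[OF f u \<open>L\<^sub>0 \<ge> 0\<close> \<open>L\<^sub>1 \<ge> 0\<close> dt dth] K_abs_le K_zero noise \<open>W \<ge> 0\<close>) auto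
  have R1: "norm R\<^sub>1 \<le> N * (3 * B * L\<^sub>0 * L\<^sub>1 * h\<^sup>2 + sqrt (W / N))"
    unfolding R\<^sub>1_def E_def k_def z_def N_def
    using t K_zero
    by (intro weighted_residual_bound[OF f u \<open>L\<^sub>0 \<ge> 0\<close> \<open>L\<^sub>1 \<ge> 0\<close> dt dth, of t "\<lambda>z. K \<bar>z\<bar> * z"]
        K_abs_mult_le noise \<open>W \<ge> 0\<close>) auto
  \<comment> \<open>The larger error is what one factor is cancelled against; the constants 6 and 2
    in \<open>err\<close> add the equal bounds for \<open>R\<^sub>0\<close> and
    \<open>R\<^sub>1\<close>.\<close>
  define m where "m = max (norm D\<^sub>0) (norm D\<^sub>1)"
  have m: "0 \<le> m" "norm D\<^sub>0 \<le> m" "norm D\<^sub>1 \<le> m" "m\<^sup>2 \<le> (norm D\<^sub>0)\<^sup>2 + (norm D\<^sub>1)\<^sup>2"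
    by (auto simp: m_def max_def)
  have "design_const * N * m\<^sup>2 \<le> design_const * N * ((norm D\<^sub>0)\<^sup>2 + (norm D\<^sub>1)\<^sup>2)"
    using m N design_const_pos by (intro mult_left_mono) auto
  also have "\<dots> \<le> norm R\<^sub>0 * m + norm R\<^sub>1 * m"
    using energy m by (intro order_trans[OF energy] add_mono mult_left_mono) auto
  also have "\<dots> \<le> (N * (6 * B * L\<^sub>0 * L\<^sub>1 * h\<^sup>2 + 2 * sqrt (W / N))) * m"
    using mult_right_mono[OF add_mono[OF R0 R1] m(1)] by (simp add: algebra_simps)
  also have "\<dots> = design_const * N * (err * m)"
    using design_const_pos by (simp add: err_def N_def)
  finally have "m\<^sup>2 \<le> err * m" using N design_const_pos by simp
  moreover have "err \<ge> 0"
    unfolding err_def using B \<open>L\<^sub>0 \<ge> 0\<close> \<open>L\<^sub>1 \<ge> 0\<close> \<open>W \<ge> 0\<close> h0 dt design_const_pos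
    by (intro divide_nonneg_pos add_nonneg_nonneg mult_nonneg_nonneg) auto
  ultimately have "m \<le> err"
    using m(1) by (cases "m = 0") (auto simp: power2_eq_square)
  then show "norm (\<theta>\<^sub>0 t - u t) \<le> err" "norm (\<theta>\<^sub>1 t - h *\<^sub>R f (u t)) \<le> err"
    using m by (auto simp: D\<^sub>0_def D\<^sub>1_def)
qed

end

section \<open>Risk of the nearest neighbor estimator\<close>

context kernel_bounds
begin

definition risk_const :: "real \<Rightarrow> real \<Rightarrow> real" where
  "risk_const L\<^sub>0 L\<^sub>1 = (1 + 2 * L\<^sub>1) * ((6 * B * L\<^sub>0 * L\<^sub>1 + 2) / design_const) + 2 * L\<^sub>0 + L\<^sub>1"

text \<open>
  The estimated curve is only \<open>h\<^sup>2\<close>-close to \<open>u\<close>, which for \<open>h \<ge> 1\<close> exceeds the target \<open>h\<close>; there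
  the trivial bound \<open>2 L\<^sub>0\<close> on the increments of \<open>f\<close> replaces its Lipschitz continuity.
\<close>

lemma nn_estimator_error:
  fixes u :: "real \<Rightarrow> real ^ 'd::finite" and \<Delta>t h :: real
  assumes f: "f \<in> snake_class L\<^sub>0 L\<^sub>1" and u: "is_flow f x\<^sub>1 u" and L0: "L\<^sub>0 \<ge> 0" and L1: "L\<^sub>1 \<ge> 0"
    and dt: "0 < \<Delta>t" and h: "6 / (b - a) * \<Delta>t \<le> h" "h \<le> real n * \<Delta>t / 2"
    and fit: "local_linear_fit K h n \<Delta>t (\<lambda>i. u (real i * \<Delta>t) + e i) \<theta>\<^sub>0 \<theta>\<^sub>1"
    and noise: "\<And>t. t \<in> {0..real n * \<Delta>t} \<Longrightarrow>
        (norm (\<Sum>i = 1..n. K \<bar>(real i * \<Delta>t - t) / h\<bar> *\<^sub>R e i))\<^sup>2 \<le> h / \<Delta>t * W"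
      "\<And>t. t \<in> {0..real n * \<Delta>t} \<Longrightarrow>
        (norm (\<Sum>i = 1..n. (K \<bar>(real i * \<Delta>t - t) / h\<bar> * ((real i * \<Delta>t - t) / h)) *\<^sub>R e i))\<^sup>2 \<le> h / \<Delta>t * W"
    and W: "W \<ge> 0"
    and NN: "nearest_neighbor_choice t_NN"
    and x: "x \<in> (\<Union>t\<in>{0..real n * \<Delta>t}. cball (u t) \<delta>)"
  shows "(norm (nn_estimator t_NN (real n * \<Delta>t) h \<theta>\<^sub>0 \<theta>\<^sub>1 x - f x))\<^sup>2
    \<le> 3 * (risk_const L\<^sub>0 L\<^sub>1)\<^sup>2 * (\<delta>\<^sup>2 + h\<^sup>2 + \<Delta>t / h ^ 3 * W)"
proof -
  have h0: "h > 0" using step_le_bandwidth[OF dt h(1)] dt by linarith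
  define T where "T = real n * \<Delta>t"
  \<comment> \<open>The stochastic part of the derivative error: the noise level sqrt (W / N)
    divided by the h of the rescaled slope.\<close>
  define q where "q = sqrt (W / (h / \<Delta>t)) / h"
  have q: "q \<ge> 0" using W h0 dt by (simp add: q_def)
  have q2: "q\<^sup>2 = \<Delta>t / h ^ 3 * W"
    using W h0 dt by (simp add: q_def power_divide power2_eq_square power3_eq_cube field_simps)
  define err where "err = (6 * B * L\<^sub>0 * L\<^sub>1 * h\<^sup>2 + 2 * sqrt (W / (h / \<Delta>t))) / design_const"
  have err: "norm (\<theta>\<^sub>0 t - u t) \<le> err" "norm (\<theta>\<^sub>1 t - h *\<^sub>R f (u t)) \<le> err" if "t \<in> {0..T}" for t
    using local_linear_fit_error[OF f u L0 L1 dt h _ fit noise W, of t] that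
    by (auto simp: T_def err_def)
  have f0: "norm (f y) \<le> L\<^sub>0" for y using f by (auto simp: snake_class_def)
  obtain t\<^sub>0 where t0: "t\<^sub>0 \<in> {0..T}" "norm (u t\<^sub>0 - x) \<le> \<delta>"
    using x by (auto simp: T_def dist_norm)
  have T0: "T \<ge> 0" using t0 by auto
  have cont: "continuous_on {0..T} \<theta>\<^sub>0"
    unfolding T_def by (rule local_linear_fit_continuous[OF fit dt h])
  define s where "s = t_NN \<theta>\<^sub>0 T x"
  have "is_arg_min (\<lambda>t. norm (\<theta>\<^sub>0 t - x)) (\<lambda>t. t \<in> {0..T}) s"
    using NN T0 cont by (simp add: nearest_neighbor_choice_def s_def)
  then have s: "s \<in> {0..T}" and min: "norm (\<theta>\<^sub>0 s - x) \<le> norm (\<theta>\<^sub>0 t\<^sub>0 - x)"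
    using t0(1) by (auto simp: is_arg_min_def not_less)
  \<comment> \<open>The true nearest time competes in the minimisation, so the curve error enters
    twice: at the chosen time s and at \<open>t\<^sub>0\<close>.\<close>
  have "norm (u s - x) \<le> norm (\<theta>\<^sub>0 s - u s) + norm (\<theta>\<^sub>0 s - x)"
    using norm_triangle_ineq4[of "\<theta>\<^sub>0 s - x" "\<theta>\<^sub>0 s - u s"] by simp
  also have "norm (\<theta>\<^sub>0 s - x) \<le> norm (\<theta>\<^sub>0 t\<^sub>0 - u t\<^sub>0) + norm (u t\<^sub>0 - x)"
    using min norm_triangle_ineq[of "\<theta>\<^sub>0 t\<^sub>0 - u t\<^sub>0" "u t\<^sub>0 - x"] by simp
  finally have us: "norm (u s - x) \<le> 2 * err + \<delta>"
    using err(1)[OF s] err(1)[OF t0(1)] t0(2) by linarith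
  have err0: "err \<ge> 0" using err(1)[OF s] norm_ge_zero order_trans by blast
  have errh: "err / h \<le> (6 * B * L\<^sub>0 * L\<^sub>1 + 2) / design_const * (h + q)"
  proof -
    have "err / h = (6 * B * L\<^sub>0 * L\<^sub>1 * h + 2 * q) / design_const"
      using h0 by (simp add: err_def q_def power2_eq_square field_simps)
    also have "\<dots> \<le> ((6 * B * L\<^sub>0 * L\<^sub>1 + 2) * (h + q)) / design_const"
      using design_const_pos q h0 B L0 L1
      by (intro divide_right_mono) (auto simp: algebra_simps)
    finally show ?thesis by simp
  qed
  have der: "norm ((1 / h) *\<^sub>R \<theta>\<^sub>1 s - f (u s)) \<le> err / h"
  proof -
    have "(1 / h) *\<^sub>R \<theta>\<^sub>1 s - f (u s) = (1 / h) *\<^sub>R (\<theta>\<^sub>1 s - h *\<^sub>R f (u s))"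
      using h0 by (simp add: scaleR_diff_right)
    also have "norm \<dots> = norm (\<theta>\<^sub>1 s - h *\<^sub>R f (u s)) / h" using h0 by simp
    also have "\<dots> \<le> err / h" using err(2)[OF s] h0 by (intro divide_right_mono) auto
    finally show ?thesis .
  qed
  have d0: "\<delta> \<ge> 0" using t0(2) norm_ge_zero order_trans by blast
  have inc: "norm (f (u s) - f x) \<le> 2 * L\<^sub>1 * (err / h) + 2 * L\<^sub>0 * h + L\<^sub>1 * \<delta>"
  proof (cases "h \<le> 1")
    case True
    have "norm (f (u s) - f x) \<le> L\<^sub>1 * norm (u s - x)" by (rule snake_class_lipschitz[OF f])
    also have "\<dots> \<le> L\<^sub>1 * (2 * err + \<delta>)" using us L1 by (rule mult_left_mono)
    \<comment> \<open>For h \<le> 1 the curve error is no larger than the derivative error.\<close>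
    also have "err \<le> err / h"
      using True h0 err0 by (simp add: le_divide_eq mult_left_le)
    finally have "norm (f (u s) - f x) \<le> L\<^sub>1 * (2 * (err / h) + \<delta>)"
      using L1 by (simp add: mult_left_mono)
    moreover have "0 \<le> 2 * L\<^sub>0 * h" using L0 h0 by simp
    ultimately show ?thesis by (simp add: algebra_simps)
  next
    case False
    have "norm (f (u s) - f x) \<le> L\<^sub>0 + L\<^sub>0"
      using norm_triangle_ineq4[of "f (u s)" "f x"] f0[of "u s"] f0[of x] by linarith
    also have "\<dots> \<le> 2 * L\<^sub>0 * h" using False L0 mult_left_mono[of 1 h "2 * L\<^sub>0"] by simp
    moreover have "0 \<le> 2 * L\<^sub>1 * (err / h)" "0 \<le> L\<^sub>1 * \<delta>" using L1 err0 h0 d0 by auto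
    ultimately show ?thesis by linarith
  qed
  define P where "P = risk_const L\<^sub>0 L\<^sub>1"
  have c: "(6 * B * L\<^sub>0 * L\<^sub>1 + 2) / design_const \<ge> 0" (is "?c \<ge> 0")
    using B L0 L1 design_const_pos by simp
  have "nn_estimator t_NN (real n * \<Delta>t) h \<theta>\<^sub>0 \<theta>\<^sub>1 x - f x = ((1 / h) *\<^sub>R \<theta>\<^sub>1 s - f (u s)) + (f (u s) - f x)"
    by (simp add: nn_estimator_def s_def T_def)
  also have "norm \<dots> \<le> err / h + (2 * L\<^sub>1 * (err / h) + 2 * L\<^sub>0 * h + L\<^sub>1 * \<delta>)"
    by (rule norm_triangle_le) (use der inc in linarith)
  also have "\<dots> = (1 + 2 * L\<^sub>1) * (err / h) + 2 * L\<^sub>0 * h + L\<^sub>1 * \<delta>" by (simp add: algebra_simps)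
  also have "\<dots> \<le> (1 + 2 * L\<^sub>1) * (?c * (h + q)) + 2 * L\<^sub>0 * h + L\<^sub>1 * \<delta>"
    using errh L0 L1 by (intro add_mono mult_left_mono order_refl) auto
  also have "\<dots> \<le> (1 + 2 * L\<^sub>1) * (?c * (h + q + \<delta>)) + 2 * L\<^sub>0 * (h + q + \<delta>) + L\<^sub>1 * (h + q + \<delta>)"
  proof -
    have "h + q \<le> h + q + \<delta>" "h \<le> h + q + \<delta>" "\<delta> \<le> h + q + \<delta>" using q h0 d0 by auto
    then show ?thesis
      using L0 L1 mult_left_mono[of "?c * (h + q)" "?c * (h + q + \<delta>)" "1 + 2 * L\<^sub>1"]
        mult_left_mono[of "h + q" "h + q + \<delta>" ?c] mult_left_mono[of h "h + q + \<delta>" "2 * L\<^sub>0"]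
        mult_left_mono[of \<delta> "h + q + \<delta>" L\<^sub>1] c by linarith
  qed
  also have "\<dots> = P * (h + q + \<delta>)" by (simp add: P_def risk_const_def algebra_simps)
  finally have "(norm (nn_estimator t_NN (real n * \<Delta>t) h \<theta>\<^sub>0 \<theta>\<^sub>1 x - f x))\<^sup>2 \<le> (P * (h + q + \<delta>))\<^sup>2"
    by (intro power_mono) auto
  also have "\<dots> = P\<^sup>2 * (h + q + \<delta>)\<^sup>2" by (rule power_mult_distrib)
  also have "\<dots> \<le> P\<^sup>2 * (3 * (\<delta>\<^sup>2 + h\<^sup>2 + q\<^sup>2))"
  proof (rule mult_left_mono)
    have "0 \<le> (h - q)\<^sup>2 + (h - \<delta>)\<^sup>2 + (q - \<delta>)\<^sup>2" by simp
    then show "(h + q + \<delta>)\<^sup>2 \<le> 3 * (\<delta>\<^sup>2 + h\<^sup>2 + q\<^sup>2)" by (simp add: power2_eq_square algebra_simps)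
  qed simp
  also have "\<dots> = 3 * P\<^sup>2 * (\<delta>\<^sup>2 + h\<^sup>2 + q\<^sup>2)" by simp
  finally show ?thesis unfolding q2 P_def .
qed

text \<open>\<open>X\<close> is any subset of the tube of radius \<delta>, so that the same bound
  serves the tube itself and the unit cube. All quantities that may vary with n come after
  \<open>A\<close>.\<close>

lemma sup_risk_le:
  assumes L0: "L\<^sub>0 > 0" and L1: "L\<^sub>1 > 0" and \<sigma>: "\<sigma> \<ge> 0"
  obtains A where "A > 0"
    "\<And>n \<Delta>t h f x\<^sub>1 u (M :: 'w measure) (\<epsilon> :: nat \<Rightarrow> 'w \<Rightarrow> real ^ 'd::finite) \<theta>\<^sub>0 \<theta>\<^sub>1 t_NN \<delta> X.
      n \<ge> 3 \<Longrightarrow> 0 < \<Delta>t \<Longrightarrow> 6 / (b - a) * \<Delta>t \<le> h \<Longrightarrow> h \<le> real n * \<Delta>t / 2 \<Longrightarrow>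
      snake_model L\<^sub>0 L\<^sub>1 \<sigma> n f x\<^sub>1 u M \<epsilon> \<Longrightarrow>
      (\<And>\<omega>. \<omega> \<in> space M \<Longrightarrow>
        local_linear_fit K h n \<Delta>t (observation \<Delta>t u \<epsilon> \<omega>) (\<theta>\<^sub>0 \<omega>) (\<theta>\<^sub>1 \<omega>)) \<Longrightarrow>
      nearest_neighbor_choice t_NN \<Longrightarrow>
      X \<subseteq> (\<Union>t\<in>{0..real n * \<Delta>t}. cball (u t) \<delta>) \<Longrightarrow>
      sup_risk M X (\<lambda>\<omega>. nn_estimator t_NN (real n * \<Delta>t) h (\<theta>\<^sub>0 \<omega>) (\<theta>\<^sub>1 \<omega>)) f
        \<le> ennreal (A * (\<delta>\<^sup>2 + h\<^sup>2 + \<Delta>t * ln (real n) / h ^ 3))"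
proof -
  obtain A\<^sub>0 where A0: "A\<^sub>0 > 0" and dom0:
    "\<And>n \<Delta>t h (M :: 'w measure) (\<epsilon> :: nat \<Rightarrow> 'w \<Rightarrow> real ^ 'd).
      n \<ge> 3 \<Longrightarrow> 0 < \<Delta>t \<Longrightarrow> \<Delta>t \<le> h \<Longrightarrow> subgaussian_noise \<sigma> n M \<epsilon> \<Longrightarrow>
      \<exists>W. W \<in> borel_measurable M \<and> (\<forall>\<omega>. 0 \<le> W \<omega>) \<and>
        (\<integral>\<^sup>+ \<omega>. ennreal (W \<omega>) \<partial>M) \<le> ennreal (A\<^sub>0 * ln (real n)) \<and>
        (\<forall>\<omega>. \<forall>t\<in>{0..real n * \<Delta>t}.
          (norm (\<Sum>i = 1..n. K \<bar>(real i * \<Delta>t - t) / h\<bar> *\<^sub>R \<epsilon> i \<omega>))\<^sup>2 \<le> h / \<Delta>t * W \<omega>)"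
    by (rule noise_sup_dominated[OF \<sigma> B L, of "\<lambda>z. K \<bar>z\<bar>"]) (use K_abs_le K_zero K_abs_lip in auto)
  have LB: "L + B \<ge> 0" using L B by simp
  obtain A\<^sub>1 where A1: "A\<^sub>1 > 0" and dom1:
    "\<And>n \<Delta>t h (M :: 'w measure) (\<epsilon> :: nat \<Rightarrow> 'w \<Rightarrow> real ^ 'd).
      n \<ge> 3 \<Longrightarrow> 0 < \<Delta>t \<Longrightarrow> \<Delta>t \<le> h \<Longrightarrow> subgaussian_noise \<sigma> n M \<epsilon> \<Longrightarrow>
      \<exists>W. W \<in> borel_measurable M \<and> (\<forall>\<omega>. 0 \<le> W \<omega>) \<and>
        (\<integral>\<^sup>+ \<omega>. ennreal (W \<omega>) \<partial>M) \<le> ennreal (A\<^sub>1 * ln (real n)) \<and>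
        (\<forall>\<omega>. \<forall>t\<in>{0..real n * \<Delta>t}.
          (norm (\<Sum>i = 1..n. (K \<bar>(real i * \<Delta>t - t) / h\<bar> * ((real i * \<Delta>t - t) / h)) *\<^sub>R \<epsilon> i \<omega>))\<^sup>2 \<le> h / \<Delta>t * W \<omega>)"
    by (rule noise_sup_dominated[OF \<sigma> B LB, of "\<lambda>z. K \<bar>z\<bar> * z"])
      (use K_abs_mult_le K_zero K_abs_mult_lip in auto)
  define P where "P = 3 * (risk_const L\<^sub>0 L\<^sub>1)\<^sup>2"
  have P: "P \<ge> 0" by (simp add: P_def)
  show thesis
  proof (rule that)
    \<comment> \<open>\<open>A\<^sub>0 + A\<^sub>1 + 1\<close> covers both the coefficient 1 of the
      deterministic terms and that of the noise term; \<open>P + 1\<close> makes positivity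
      immediate.\<close>
    show "(P + 1) * (A\<^sub>0 + A\<^sub>1 + 1) > 0" using P A0 A1 by (intro mult_pos_pos) auto
    fix n :: nat and \<Delta>t h \<delta> :: real and f :: "real ^ 'd \<Rightarrow> real ^ 'd" and x\<^sub>1 :: "real ^ 'd"
      and u :: "real \<Rightarrow> real ^ 'd" and M :: "'w measure" and \<epsilon> :: "nat \<Rightarrow> 'w \<Rightarrow> real ^ 'd"
      and \<theta>\<^sub>0 \<theta>\<^sub>1 :: "'w \<Rightarrow> real \<Rightarrow> real ^ 'd" 
      and t_NN :: "(real \<Rightarrow> real ^ 'd) \<Rightarrow> real \<Rightarrow> real ^ 'd \<Rightarrow> real" and X :: "(real ^ 'd) set"
    assume n: "n \<ge> 3" and dt: "0 < \<Delta>t" and h: "6 / (b - a) * \<Delta>t \<le> h" "h \<le> real n * \<Delta>t / 2"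
      and model: "snake_model L\<^sub>0 L\<^sub>1 \<sigma> n f x\<^sub>1 u M \<epsilon>"
      and fit: "\<And>\<omega>. \<omega> \<in> space M \<Longrightarrow>
        local_linear_fit K h n \<Delta>t (observation \<Delta>t u \<epsilon> \<omega>) (\<theta>\<^sub>0 \<omega>) (\<theta>\<^sub>1 \<omega>)"
      and NN: "nearest_neighbor_choice t_NN"
      and X: "X \<subseteq> (\<Union>t\<in>{0..real n * \<Delta>t}. cball (u t) \<delta>)"
    have f: "f \<in> snake_class L\<^sub>0 L\<^sub>1" and u: "is_flow f x\<^sub>1 u" and noise: "subgaussian_noise \<sigma> n M \<epsilon>"
      using model by (auto simp: snake_model_def)
    interpret prob_space M using noise by (simp add: subgaussian_noise_def)
    note dth = step_le_bandwidth[OF dt h(1)]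
    have h0: "h > 0" using dth dt by linarith
    obtain W\<^sub>0 where W0[measurable]: "W\<^sub>0 \<in> borel_measurable M" and W0_nonneg: "\<And>\<omega>. 0 \<le> W\<^sub>0 \<omega>"
      and EW0: "(\<integral>\<^sup>+ \<omega>. ennreal (W\<^sub>0 \<omega>) \<partial>M) \<le> ennreal (A\<^sub>0 * ln (real n))"
      and le0: "\<And>\<omega> t. t \<in> {0..real n * \<Delta>t} \<Longrightarrow>
          (norm (\<Sum>i = 1..n. K \<bar>(real i * \<Delta>t - t) / h\<bar> *\<^sub>R \<epsilon> i \<omega>))\<^sup>2 \<le> h / \<Delta>t * W\<^sub>0 \<omega>"
      using dom0[OF n dt dth noise] by blast
    obtain W\<^sub>1 where W1[measurable]: "W\<^sub>1 \<in> borel_measurable M" and W1_nonneg: "\<And>\<omega>. 0 \<le> W\<^sub>1 \<omega>"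
      and EW1: "(\<integral>\<^sup>+ \<omega>. ennreal (W\<^sub>1 \<omega>) \<partial>M) \<le> ennreal (A\<^sub>1 * ln (real n))"
      and le1: "\<And>\<omega> t. t \<in> {0..real n * \<Delta>t} \<Longrightarrow>
          (norm (\<Sum>i = 1..n. (K \<bar>(real i * \<Delta>t - t) / h\<bar> * ((real i * \<Delta>t - t) / h)) *\<^sub>R \<epsilon> i \<omega>))\<^sup>2 \<le> h / \<Delta>t * W\<^sub>1 \<omega>"
      using dom1[OF n dt dth noise] by blast
    \<comment> \<open>One variable that dominates the sums for both weights, K and K times
      z.\<close>
    define W where "W \<omega> = W\<^sub>0 \<omega> + W\<^sub>1 \<omega>" for \<omega>
    have W_nonneg: "0 \<le> W \<omega>" for \<omega> using W0_nonneg[of \<omega>] W1_nonneg[of \<omega>] by (simp add: W_def)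
    have [measurable]: "W \<in> borel_measurable M" unfolding W_def by measurable
    have Nn: "h / \<Delta>t \<ge> 0" using h0 dt by simp
    have le0': "(norm (\<Sum>i = 1..n. K \<bar>(real i * \<Delta>t - t) / h\<bar> *\<^sub>R \<epsilon> i \<omega>))\<^sup>2 \<le> h / \<Delta>t * W \<omega>"
      if "t \<in> {0..real n * \<Delta>t}" for t \<omega>
      using le0[OF that, of \<omega>] mult_left_mono[OF _ Nn, of "W\<^sub>0 \<omega>" "W \<omega>"] W1_nonneg[of \<omega>]
      by (simp add: W_def)
    have le1': "(norm (\<Sum>i = 1..n. (K \<bar>(real i * \<Delta>t - t) / h\<bar> * ((real i * \<Delta>t - t) / h)) *\<^sub>R \<epsilon> i \<omega>))\<^sup>2
        \<le> h / \<Delta>t * W \<omega>" if "t \<in> {0..real n * \<Delta>t}" for t \<omega>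
      using le1[OF that, of \<omega>] mult_left_mono[OF _ Nn, of "W\<^sub>1 \<omega>" "W \<omega>"] W0_nonneg[of \<omega>]
      by (simp add: W_def)
    define c where "c = \<Delta>t / h ^ 3"
    have c: "c \<ge> 0" using dt h0 by (simp add: c_def)
    define g where "g \<omega> = ennreal (P * (\<delta>\<^sup>2 + h\<^sup>2)) + ennreal (P * c) * ennreal (W \<omega>)" for \<omega>
    have g: "ennreal (P * (\<delta>\<^sup>2 + h\<^sup>2 + c * W \<omega>)) = g \<omega>" for \<omega>
      using P c W_nonneg[of \<omega>] unfolding g_def
      by (subst ennreal_mult[symmetric], simp, simp, subst ennreal_plus[symmetric]) (auto simp: algebra_simps)
    have pw: "(SUP x\<in>X. ennreal ((norm (nn_estimator t_NN (real n * \<Delta>t) h (\<theta>\<^sub>0 \<omega>) (\<theta>\<^sub>1 \<omega>) x - f x))\<^sup>2)) \<le> g \<omega>"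
      if \<omega>: "\<omega> \<in> space M" for \<omega>
    proof (rule SUP_least)
      fix x assume "x \<in> X"
      then have x: "x \<in> (\<Union>t\<in>{0..real n * \<Delta>t}. cball (u t) \<delta>)" using X by blast
      have fit': "local_linear_fit K h n \<Delta>t (\<lambda>i. u (real i * \<Delta>t) + \<epsilon> i \<omega>) (\<theta>\<^sub>0 \<omega>) (\<theta>\<^sub>1 \<omega>)"
        using fit[OF \<omega>] by (simp add: observation_def[abs_def])
      have "(norm (nn_estimator t_NN (real n * \<Delta>t) h (\<theta>\<^sub>0 \<omega>) (\<theta>\<^sub>1 \<omega>) x - f x))\<^sup>2
          \<le> 3 * (risk_const L\<^sub>0 L\<^sub>1)\<^sup>2 * (\<delta>\<^sup>2 + h\<^sup>2 + \<Delta>t / h ^ 3 * W \<omega>)"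
        using L0 L1 by (intro nn_estimator_error[OF f u _ _ dt h fit' le0' le1' W_nonneg NN x]) auto
      then show "ennreal ((norm (nn_estimator t_NN (real n * \<Delta>t) h (\<theta>\<^sub>0 \<omega>) (\<theta>\<^sub>1 \<omega>) x - f x))\<^sup>2) \<le> g \<omega>"
        unfolding g[symmetric] P_def c_def by (rule ennreal_leI)
    qed
    have gm[measurable]: "g \<in> borel_measurable M" unfolding g_def by measurable
    \<comment> \<open>\<open>g\<close> is an admissible measurable majorant in the upper integral;
      the supremum itself is never integrated.\<close>
    have "sup_risk M X (\<lambda>\<omega>. nn_estimator t_NN (real n * \<Delta>t) h (\<theta>\<^sub>0 \<omega>) (\<theta>\<^sub>1 \<omega>)) f \<le> (\<integral>\<^sup>+ \<omega>. g \<omega> \<partial>M)"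
      unfolding sup_risk_def outer_expectation_def using pw gm by (intro INF_lower) auto
    also have "\<dots> = ennreal (P * (\<delta>\<^sup>2 + h\<^sup>2)) + ennreal (P * c) * (\<integral>\<^sup>+ \<omega>. ennreal (W \<omega>) \<partial>M)"
      unfolding g_def by (simp add: nn_integral_add nn_integral_cmult emeasure_space_1)
    also have "(\<integral>\<^sup>+ \<omega>. ennreal (W \<omega>) \<partial>M) = (\<integral>\<^sup>+ \<omega>. ennreal (W\<^sub>0 \<omega>) \<partial>M) + (\<integral>\<^sup>+ \<omega>. ennreal (W\<^sub>1 \<omega>) \<partial>M)"
      unfolding W_def using W0_nonneg W1_nonneg by (simp add: nn_integral_add)
    also have "ennreal (P * (\<delta>\<^sup>2 + h\<^sup>2)) + ennreal (P * c) * \<dots>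
        \<le> ennreal (P * (\<delta>\<^sup>2 + h\<^sup>2)) + ennreal (P * c) * (ennreal (A\<^sub>0 * ln (real n)) + ennreal (A\<^sub>1 * ln (real n)))"
      by (intro add_left_mono mult_left_mono add_mono EW0 EW1) auto
    also have "\<dots> = ennreal (P * (\<delta>\<^sup>2 + h\<^sup>2) + P * c * (A\<^sub>0 * ln (real n) + A\<^sub>1 * ln (real n)))"
      using P c A0 A1 n by (simp flip: ennreal_plus ennreal_mult)
    also have "\<dots> \<le> ennreal ((P + 1) * (A\<^sub>0 + A\<^sub>1 + 1) * (\<delta>\<^sup>2 + h\<^sup>2 + \<Delta>t * ln (real n) / h ^ 3))"
    proof (rule ennreal_leI)
      have cl: "0 \<le> c * ln (real n)" using c n by simp
      have "P * (\<delta>\<^sup>2 + h\<^sup>2) + P * c * (A\<^sub>0 * ln (real n) + A\<^sub>1 * ln (real n))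
          = P * (1 * (\<delta>\<^sup>2 + h\<^sup>2) + (A\<^sub>0 + A\<^sub>1) * (c * ln (real n)))" by (simp add: algebra_simps)
      also have "\<dots> \<le> (P + 1) * ((A\<^sub>0 + A\<^sub>1 + 1) * (\<delta>\<^sup>2 + h\<^sup>2) + (A\<^sub>0 + A\<^sub>1 + 1) * (c * ln (real n)))"
      proof -
        have "1 * (\<delta>\<^sup>2 + h\<^sup>2) \<le> (A\<^sub>0 + A\<^sub>1 + 1) * (\<delta>\<^sup>2 + h\<^sup>2)"
          using A0 A1 by (intro mult_right_mono) auto
        moreover have "(A\<^sub>0 + A\<^sub>1) * (c * ln (real n)) \<le> (A\<^sub>0 + A\<^sub>1 + 1) * (c * ln (real n))"
          using cl by (intro mult_right_mono) auto
        moreover have "0 \<le> 1 * (\<delta>\<^sup>2 + h\<^sup>2)" "0 \<le> (A\<^sub>0 + A\<^sub>1) * (c * ln (real n))"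
          using A0 A1 cl by auto
        ultimately show ?thesis using P by - (rule mult_mono, linarith+)
      qed
      also have "\<dots> = (P + 1) * (A\<^sub>0 + A\<^sub>1 + 1) * (\<delta>\<^sup>2 + h\<^sup>2 + \<Delta>t * ln (real n) / h ^ 3)"
      proof -
        have "\<Delta>t * ln (real n) / h ^ 3 = c * ln (real n)" by (simp add: c_def)
        then show ?thesis by (simp only:) (simp add: algebra_simps)
      qed
      finally show "P * (\<delta>\<^sup>2 + h\<^sup>2) + P * c * (A\<^sub>0 * ln (real n) + A\<^sub>1 * ln (real n))
          \<le> (P + 1) * (A\<^sub>0 + A\<^sub>1 + 1) * (\<delta>\<^sup>2 + h\<^sup>2 + \<Delta>t * ln (real n) / h ^ 3)" .
    qed
    finally show "sup_risk M X (\<lambda>\<omega>. nn_estimator t_NN (real n * \<Delta>t) h (\<theta>\<^sub>0 \<omega>) (\<theta>\<^sub>1 \<omega>)) f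
        \<le> ennreal ((P + 1) * (A\<^sub>0 + A\<^sub>1 + 1) * (\<delta>\<^sup>2 + h\<^sup>2 + \<Delta>t * ln (real n) / h ^ 3))" .
  qed
qed

end

section \<open>Asymptotics\<close>

lemma asymp_leI:
  assumes "\<forall>\<^sub>F n in sequentially. a n \<le> ennreal (C * y n)" and "C \<ge> 0" and "\<forall>\<^sub>F n in sequentially. y n \<ge> 0"
  shows "a \<preceq> (\<lambda>n. ennreal (y n))"
proof -
  have "\<forall>\<^sub>F n in sequentially. a n / ennreal (y n) \<le> ennreal C"
    using assms(1,3)
  proof eventually_elim
    case (elim n)
    show ?case
    \<comment> \<open>Here the hypothesis forces a n = 0, and 0 / 0 = 0 in
      \<open>ennreal\<close>.\<close>
    proof (cases "y n = 0")
      case True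
      then show ?thesis using elim by simp
    next
      case False
      then have y: "y n > 0" using elim(2) by linarith
      have "a n / ennreal (y n) \<le> ennreal (C * y n) / ennreal (y n)"
        using elim(1) by (rule divide_right_mono_ennreal)
      also have "\<dots> = ennreal C" using y assms(2) by (simp add: divide_ennreal)
      finally show ?thesis .
    qed
  qed
  then have "limsup (\<lambda>n. a n / ennreal (y n)) \<le> ennreal C" by (rule Limsup_bounded)
  also have "\<dots> < \<infinity>" by simp
  finally show ?thesis by (simp add: asymp_le_def)
qed

text \<open>\<open>C \<ge> 1\<close> is arranged so that powers of C can be enlarged later.\<close>

lemma asymp_leD:
  assumes "(\<lambda>n. ennreal (x n)) \<preceq> (\<lambda>n. ennreal (y n))" and y: "\<forall>\<^sub>F n in sequentially. y n \<ge> 0"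
  obtains C where "C \<ge> 1" "\<forall>\<^sub>F n in sequentially. x n \<le> C * y n"
proof -
  let ?l = "limsup (\<lambda>n. ennreal (x n) / ennreal (y n))"
  have "?l < top" using assms(1) by (simp add: asymp_le_def)
  then obtain r where r: "r \<ge> 0" "?l = ennreal r" by (cases ?l) auto
  have "\<forall>\<^sub>F n in sequentially. ennreal (x n) / ennreal (y n) < ennreal (r + 1)"
    using r by (intro Limsup_lessD) (simp add: ennreal_less_iff)
  with y have "\<forall>\<^sub>F n in sequentially. x n \<le> (r + 1) * y n"
  proof eventually_elim
    case (elim n)
    show ?case
    proof (cases "x n \<le> 0")
      case True
      then show ?thesis using elim(1) r by (intro order_trans[OF True]) auto
    next
      case x: False
      show ?thesis
      \<comment> \<open>A positive numerator over 0 is infinite in \<open>ennreal\<close>, which the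
        finite limsup excludes.\<close>
      proof (cases "y n = 0")
        case True
        then show ?thesis using elim(2) x by simp
      next
        case False
        then have y0: "y n > 0" using elim(1) by linarith
        then have "x n / y n < r + 1"
          using elim(2) x r by (simp add: divide_ennreal ennreal_less_iff del: ennreal_plus)
        then show ?thesis using y0 by (simp add: divide_less_eq)
      qed
    qed
  qed
  then show thesis using r by (intro that[of "r + 1"]) auto
qed

section \<open>Existence and order of the bandwidth\<close>

lemma power5_le_imp_le:
  assumes "x ^ 5 \<le> y ^ 5" and "y \<ge> (0::real)"
  shows "x \<le> y"
  using power_le_imp_le_base[of x 4 y] assms by simp

lemma powr_one_fifth: "x \<ge> 0 \<Longrightarrow> (x powr (1 / 5)) ^ 5 = x" "x \<ge> 0 \<Longrightarrow> (x powr (1 / 5))\<^sup>2 = x powr (2 / 5)"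
  for x :: real
  by (cases "x = 0"; simp add: powr_power)+

text \<open>The bandwidth hypothesis of the theorem is satisfiable. With \<rho> the target order,
  \<rho>^5 = T ln n / n = \<Delta>t ln n. The lower growth condition says ln n / n \<le> const T^4,
  hence \<rho> \<le> const T; the upper one says \<Delta>t^4 \<le> const ln n, hence \<Delta>t \<le>
  const \<rho>. This is where both exponents 1/4 come from.\<close>

lemma optimal_bandwidth_exists:
  fixes \<Delta>t T :: "nat \<Rightarrow> real"
  assumes "C > 0"
    and pos: "\<And>n. n \<ge> 1 \<Longrightarrow> \<Delta>t n > 0" and T: "\<And>n. n \<ge> 1 \<Longrightarrow> T n = real n * \<Delta>t n"
    and lower: "(\<lambda>n. ennreal ((real n / ln (real n)) powr (- (1 / 4)))) \<preceq> (\<lambda>n. ennreal (T n))"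
    and upper: "(\<lambda>n. ennreal (T n)) \<preceq> (\<lambda>n. ennreal (real n * ln (real n) powr (1 / 4)))"
  shows "\<exists>h. optimal_bandwidth (1 / 2) C \<Delta>t T h"
proof -
  define \<rho> where "\<rho> n = (T n * ln (real n) / real n) powr (1 / 5)" for n
  \<comment> \<open>\<rho> clipped to the range from C \<Delta>t to T / 2; by the two comparisons
    clipping costs only constant factors.\<close>
  define h where "h n = max (C * \<Delta>t n) (min (T n / 2) (\<rho> n))" for n
  have \<rho>0: "\<rho> n \<ge> 0" for n by (simp add: \<rho>_def)
  have Tpos: "T n > 0" if "n \<ge> 1" for n using T[OF that] pos[OF that] that by simp
  have Tev: "\<forall>\<^sub>F n in sequentially. T n \<ge> 0"
    using eventually_ge_at_top[of 1] by eventually_elim (use Tpos in \<open>simp add: less_imp_le\<close>)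
  obtain A\<^sub>1 where A1: "A\<^sub>1 \<ge> 1"
    "\<forall>\<^sub>F n in sequentially. (real n / ln (real n)) powr (- (1 / 4)) \<le> A\<^sub>1 * T n"
    by (rule asymp_leD[OF lower Tev])
  obtain A\<^sub>2 where A2: "A\<^sub>2 \<ge> 1"
    "\<forall>\<^sub>F n in sequentially. T n \<le> A\<^sub>2 * (real n * ln (real n) powr (1 / 4))"
    by (rule asymp_leD[OF upper]) simp
  have \<rho>T: "\<forall>\<^sub>F n in sequentially. \<rho> n \<le> A\<^sub>1 * T n"
    using A1(2) eventually_ge_at_top[of 3]
  proof eventually_elim
    case (elim n)
    have l: "ln (real n) \<ge> 1" using elim(2) by (rule one_le_ln)
    have n: "real n > 0" and T0: "T n > 0" using elim(2) Tpos[of n] by auto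
    have "ln (real n) / real n = ((real n / ln (real n)) powr (- (1 / 4))) ^ 4"
    proof -
      have "((real n / ln (real n)) powr (- (1 / 4))) ^ 4 = (real n / ln (real n)) powr (- 1)"
        using l n by (subst powr_power) auto
      also have "\<dots> = 1 / (real n / ln (real n))" using l n by (intro powr_neg_one divide_pos_pos) linarith+
      finally show ?thesis by simp
    qed
    also have "\<dots> \<le> (A\<^sub>1 * T n) ^ 4" using elim(1) T0 by (intro power_mono) auto
    finally have *: "ln (real n) / real n \<le> (A\<^sub>1 * T n) ^ 4" .
    have "\<rho> n ^ 5 = T n * (ln (real n) / real n)"
      using l n T0 by (simp add: \<rho>_def powr_one_fifth)
    also have "\<dots> \<le> (A\<^sub>1 * T n) * (A\<^sub>1 * T n) ^ 4"
      using * l n T0 A1(1) by (intro mult_mono) auto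
    finally have "\<rho> n ^ 5 \<le> (A\<^sub>1 * T n) ^ 5" by (simp add: power_Suc[symmetric] del: power_Suc)
    then show ?case by (rule power5_le_imp_le) (use A1(1) T0 in auto)
  qed
  have dt\<rho>: "\<forall>\<^sub>F n in sequentially. \<Delta>t n \<le> A\<^sub>2 * \<rho> n"
    using A2(2) eventually_ge_at_top[of 3]
  proof eventually_elim
    case (elim n)
    have l: "ln (real n) \<ge> 1" using elim(2) by (rule one_le_ln)
    have n: "real n > 0" and d0: "\<Delta>t n > 0" and Tn: "T n = real n * \<Delta>t n"
      using elim(2) pos[of n] T[of n] by auto
    have "real n * \<Delta>t n \<le> real n * (A\<^sub>2 * ln (real n) powr (1 / 4))"
      using elim(1) by (simp add: Tn mult_ac)
    then have "\<Delta>t n \<le> A\<^sub>2 * ln (real n) powr (1 / 4)" using n by simp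
    then have "\<Delta>t n ^ 4 \<le> (A\<^sub>2 * ln (real n) powr (1 / 4)) ^ 4" using d0 by (intro power_mono) auto
    also have "\<dots> = A\<^sub>2 ^ 4 * ln (real n)" using l by (simp add: power_mult_distrib powr_power)
    finally have "\<Delta>t n * \<Delta>t n ^ 4 \<le> \<Delta>t n * (A\<^sub>2 ^ 4 * ln (real n))" using d0 by (intro mult_left_mono) auto
    then have "\<Delta>t n ^ 5 \<le> A\<^sub>2 ^ 4 * (\<Delta>t n * ln (real n))" by (simp add: eval_nat_numeral mult_ac)
    also have "\<dots> \<le> A\<^sub>2 ^ 5 * (\<Delta>t n * ln (real n))"
      using d0 l A2(1) by (intro mult_right_mono power_increasing) auto
    also have "\<Delta>t n * ln (real n) = \<rho> n ^ 5"
      using d0 l n by (simp add: \<rho>_def powr_one_fifth Tn)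
    finally have "\<Delta>t n ^ 5 \<le> (A\<^sub>2 * \<rho> n) ^ 5" by (simp add: power_mult_distrib)
    then show ?case by (rule power5_le_imp_le) (use A2(1) \<rho>0[of n] in auto)
  qed
  have hpos: "h n > 0" if "n \<ge> 1" for n
    using pos[OF that] \<open>C > 0\<close> by (simp add: h_def less_max_iff_disj)
  have hev: "\<forall>\<^sub>F n in sequentially. h n \<ge> 0"
    using eventually_ge_at_top[of 1] by eventually_elim (use hpos in \<open>simp add: less_imp_le\<close>)
  have "(\<lambda>n. ennreal (h n)) \<preceq> (\<lambda>n. ennreal (\<rho> n))"
  proof (rule asymp_leI)
    show "\<forall>\<^sub>F n in sequentially. ennreal (h n) \<le> ennreal ((C * A\<^sub>2 + 1) * \<rho> n)"
      using dt\<rho>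
    proof eventually_elim
      case (elim n)
      have "C * \<Delta>t n \<le> C * (A\<^sub>2 * \<rho> n)" using elim \<open>C > 0\<close> by (intro mult_left_mono) auto
      moreover have "0 \<le> C * (A\<^sub>2 * \<rho> n)" using \<rho>0 A2 \<open>C > 0\<close> by auto
      ultimately have "h n \<le> (C * A\<^sub>2 + 1) * \<rho> n"
        using \<rho>0[of n] by (auto simp: h_def algebra_simps min_def)
      then show ?case by (rule ennreal_leI)
    qed
  qed (use \<open>C > 0\<close> A2 \<rho>0 in auto)
  moreover have "(\<lambda>n. ennreal (\<rho> n)) \<preceq> (\<lambda>n. ennreal (h n))"
  proof (rule asymp_leI)
    show "\<forall>\<^sub>F n in sequentially. ennreal (\<rho> n) \<le> ennreal (2 * A\<^sub>1 * h n)"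
      using \<rho>T
    proof eventually_elim
      case (elim n)
      have "\<rho> n \<le> 2 * A\<^sub>1 * min (T n / 2) (\<rho> n)"
      proof (cases "T n / 2 \<le> \<rho> n")
        case True
        then show ?thesis using elim by (simp add: min_def)
      next
        case False
        have "1 * \<rho> n \<le> (2 * A\<^sub>1) * \<rho> n" using A1 \<rho>0 by (intro mult_right_mono) auto
        then show ?thesis using False by (simp add: min_def)
      qed
      also have "\<dots> \<le> 2 * A\<^sub>1 * h n"
        using A1 by (intro mult_left_mono) (auto simp: h_def)
      finally show ?case by (rule ennreal_leI)
    qed
  qed (use A1 hev in auto)
  moreover have "\<forall>\<^sub>F n in sequentially. C * \<Delta>t n \<le> h n \<and> h n \<le> 1 / 2 * T n"
    \<comment> \<open>For n \<ge> 2C the clipping range is nonempty, since T = n \<Delta>t.\<close>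
    using eventually_ge_at_top[of "max 1 (nat \<lceil>2 * C\<rceil>)"]
  proof eventually_elim
    case (elim n)
    then have n: "n \<ge> 1" "2 * C \<le> real n" by linarith+
    have "2 * C * \<Delta>t n \<le> real n * \<Delta>t n" using n pos[of n] by (intro mult_right_mono) auto
    then show ?case using T[of n] n by (auto simp: h_def)
  qed
  ultimately show ?thesis
    unfolding optimal_bandwidth_def asymp_eq_def \<rho>_def[symmetric] using hpos by blast
qed

text \<open>The upper comparison of h with \<rho> bounds the bias term h^2, the lower one the noise
  term \<rho>^5 / h^3; both become multiples of \<rho>^2. The quantifier over \<delta> stands
  inside, so the threshold on n does not depend on \<delta>.\<close>

lemma optimal_bandwidth_order:
  assumes h: "optimal_bandwidth c C \<Delta>t T h"
    and pos: "\<And>n. n \<ge> 1 \<Longrightarrow> \<Delta>t n > 0" and T: "\<And>n. n \<ge> 1 \<Longrightarrow> T n = real n * \<Delta>t n"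
  obtains A where "A > 0"
    "\<forall>\<^sub>F n in sequentially. \<forall>\<delta>. \<delta>\<^sup>2 + (h n)\<^sup>2 + \<Delta>t n * ln (real n) / h n ^ 3
      \<le> A * (\<delta>\<^sup>2 + (T n * ln (real n) / real n) powr (2 / 5))"
proof -
  define \<rho> where "\<rho> n = (T n * ln (real n) / real n) powr (1 / 5)" for n
  have \<rho>0: "\<rho> n \<ge> 0" for n by (simp add: \<rho>_def)
  have hpos: "\<And>n. n \<ge> 1 \<Longrightarrow> h n > 0" and h1: "(\<lambda>n. ennreal (h n)) \<preceq> (\<lambda>n. ennreal (\<rho> n))"
    and h2: "(\<lambda>n. ennreal (\<rho> n)) \<preceq> (\<lambda>n. ennreal (h n))"
    using h by (auto simp: optimal_bandwidth_def asymp_eq_def \<rho>_def)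
  have hev: "\<forall>\<^sub>F n in sequentially. h n \<ge> 0"
    using eventually_ge_at_top[of 1] by eventually_elim (use hpos in \<open>simp add: less_imp_le\<close>)
  obtain A\<^sub>1 where A1: "A\<^sub>1 \<ge> 1" "\<forall>\<^sub>F n in sequentially. h n \<le> A\<^sub>1 * \<rho> n"
    by (rule asymp_leD[OF h1]) (simp add: \<rho>0)
  obtain A\<^sub>2 where A2: "A\<^sub>2 \<ge> 1" "\<forall>\<^sub>F n in sequentially. \<rho> n \<le> A\<^sub>2 * h n"
    by (rule asymp_leD[OF h2 hev])
  show thesis
  proof (rule that)
    show "1 + A\<^sub>1\<^sup>2 + A\<^sub>2 ^ 3 > 0" using A1 A2 by (intro add_pos_nonneg) auto
    show "\<forall>\<^sub>F n in sequentially. \<forall>\<delta>. \<delta>\<^sup>2 + (h n)\<^sup>2 + \<Delta>t n * ln (real n) / h n ^ 3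
        \<le> (1 + A\<^sub>1\<^sup>2 + A\<^sub>2 ^ 3) * (\<delta>\<^sup>2 + (T n * ln (real n) / real n) powr (2 / 5))"
      using A1(2) A2(2) eventually_ge_at_top[of 3]
    proof eventually_elim
      case (elim n)
      have h0: "h n > 0" and l: "ln (real n) \<ge> 1" and Tn: "T n = real n * \<Delta>t n" and d0: "\<Delta>t n > 0"
        using elim(3) hpos[of n] one_le_ln[of n] T[of n] pos[of n] by auto
      have x: "T n * ln (real n) / real n = \<Delta>t n * ln (real n)" using elim(3) by (simp add: Tn)
      have \<rho>2: "(T n * ln (real n) / real n) powr (2 / 5) = (\<rho> n)\<^sup>2"
        using d0 l unfolding \<rho>_def x by (simp add: powr_one_fifth)
      have \<rho>5: "\<Delta>t n * ln (real n) = \<rho> n ^ 5"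
        using d0 l unfolding \<rho>_def x by (simp add: powr_one_fifth)
      have "(h n)\<^sup>2 \<le> (A\<^sub>1 * \<rho> n)\<^sup>2" using elim(1) h0 by (intro power_mono) auto
      then have a: "(h n)\<^sup>2 \<le> A\<^sub>1\<^sup>2 * (\<rho> n)\<^sup>2" by (simp add: power_mult_distrib)
      have "\<rho> n ^ 3 \<le> (A\<^sub>2 * h n) ^ 3" using elim(2) h0 \<rho>0 by (intro power_mono) auto
      then have "(\<rho> n)\<^sup>2 * \<rho> n ^ 3 \<le> (\<rho> n)\<^sup>2 * (A\<^sub>2 ^ 3 * h n ^ 3)"
        by (intro mult_left_mono) (auto simp: power_mult_distrib)
      then have "\<rho> n ^ 5 \<le> (A\<^sub>2 ^ 3 * (\<rho> n)\<^sup>2) * h n ^ 3"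
        by (simp add: power_add[symmetric] mult_ac)
      then have b: "\<Delta>t n * ln (real n) / h n ^ 3 \<le> A\<^sub>2 ^ 3 * (\<rho> n)\<^sup>2"
        unfolding \<rho>5 using h0 by (simp add: divide_le_eq)
      show ?case
      proof
        fix \<delta> :: real
        have "0 \<le> (A\<^sub>1\<^sup>2 + A\<^sub>2 ^ 3) * \<delta>\<^sup>2 + (\<rho> n)\<^sup>2" using A2(1) by auto
        then show "\<delta>\<^sup>2 + (h n)\<^sup>2 + \<Delta>t n * ln (real n) / h n ^ 3
          \<le> (1 + A\<^sub>1\<^sup>2 + A\<^sub>2 ^ 3) * (\<delta>\<^sup>2 + (T n * ln (real n) / real n) powr (2 / 5))"
          unfolding \<rho>2 using a b by (simp add: algebra_simps)
      qed
    qed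
  qed
qed

text \<open>By compactness of the time range the distance to the curve is attained, so closed balls
  of radius exactly \<delta> cover the cube.\<close>

lemma cube_subset_tube:
  fixes u :: "real \<Rightarrow> real ^ 'd::finite"
  assumes "continuous_on {0..T} u" and "T \<ge> 0"
    and \<delta>: "\<delta> = (SUP x\<in>{x. \<forall>j. x $ j \<in> {0..1}}. INF t\<in>{0..T}. norm (u t - x))"
  shows "{x. \<forall>j. x $ j \<in> {0..1}} \<subseteq> (\<Union>t\<in>{0..T}. cball (u t) \<delta>)"
proof
  fix x :: "real ^ 'd"
  assume x: "x \<in> {x. \<forall>j. x $ j \<in> {0..1}}"
  have bd: "bdd_below ((\<lambda>t. norm (u t - y)) ` {0..T})" for y
    by (intro bdd_belowI[of _ 0]) auto
  \<comment> \<open>A real-valued \<open>SUP\<close> is an upper bound only for a bounded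
    family.\<close>
  have "bdd_above ((\<lambda>x. INF t\<in>{0..T}. norm (u t - x)) ` {x. \<forall>j. x $ j \<in> {0..1}})"
  proof (rule bdd_aboveI2)
    fix y :: "real ^ 'd" assume y: "y \<in> {x. \<forall>j. x $ j \<in> {0..1}}"
    have "(INF t\<in>{0..T}. norm (u t - y)) \<le> norm (u 0 - y)"
      using \<open>T \<ge> 0\<close> by (intro cINF_lower bd) auto
    also have "\<dots> \<le> norm (u 0) + norm y" by (rule norm_triangle_ineq4)
    also have "norm y \<le> (\<Sum>j\<in>UNIV. \<bar>y $ j\<bar>)" by (rule norm_le_l1_cart)
    also have "\<dots> \<le> (\<Sum>j\<in>(UNIV :: 'd set). 1)" using y by (intro sum_mono) auto
    finally show "(INF t\<in>{0..T}. norm (u t - y)) \<le> norm (u 0) + (\<Sum>j\<in>(UNIV :: 'd set). 1)" by simp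
  qed
  then have le: "(INF t\<in>{0..T}. norm (u t - x)) \<le> \<delta>"
    unfolding \<delta> using x by (intro cSUP_upper)
  have cont: "continuous_on {0..T} (\<lambda>t. norm (u t - x))"
    by (intro continuous_intros assms(1))
  obtain s where s: "s \<in> {0..T}" "\<And>t. t \<in> {0..T} \<Longrightarrow> norm (u s - x) \<le> norm (u t - x)"
    using continuous_attains_inf[OF compact_Icc _ cont] \<open>T \<ge> 0\<close> by auto
  have "norm (u s - x) \<le> (INF t\<in>{0..T}. norm (u t - x))"
    using s(1) by (intro cINF_greatest s(2)) auto
  then show "x \<in> (\<Union>t\<in>{0..T}. cball (u t) \<delta>)"
    using s(1) le by (auto simp: dist_norm intro!: bexI[of _ s])
qed

lemma is_flow_continuous_on:
  assumes "is_flow f x u"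
  shows "continuous_on {0..T} u"
proof -
  have "continuous_on {0..} u"
    unfolding continuous_on_eq_continuous_within
    using assms by (auto simp: is_flow_def intro!: has_vector_derivative_continuous)
  then show ?thesis by (rule continuous_on_subset) auto
qed

text \<open>Both parts are instances of one estimate for sets \<open>X n\<close> inside the tube of
  radius \<open>\<delta> n\<close>. The constants c = 1/2 and C = 6 / (b - a) depend on the kernel
  alone.\<close>

theorem theorem4p4:
  fixes K :: "real \<Rightarrow> real" and L\<^sub>0 L\<^sub>1 \<sigma> :: real
  assumes "CARD('d::finite) \<ge> 2" and "L\<^sub>0 > 0" and "L\<^sub>1 > 0" and "\<sigma> \<ge> 0"
    and "admissible_kernel K"
  shows
    "\<exists>c C. 0 < c \<and> 0 < C \<and>
      (\<forall>\<Delta>t T :: nat \<Rightarrow> real.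
         (\<forall>n\<ge>1. \<Delta>t n > 0 \<and> T n = real n * \<Delta>t n) \<and>
         (\<lambda>n. ennreal ((real n / ln (real n)) powr (- (1 / 4)))) \<preceq> (\<lambda>n. ennreal (T n)) \<and>
         (\<lambda>n. ennreal (T n)) \<preceq> (\<lambda>n. ennreal (real n * ln (real n) powr (1 / 4)))
       \<longrightarrow>
         (\<exists>h. optimal_bandwidth c C \<Delta>t T h) \<and>
         (\<forall>h
            (f :: nat \<Rightarrow> real ^ 'd \<Rightarrow> real ^ 'd)
            (x\<^sub>1 :: nat \<Rightarrow> real ^ 'd)
            (u :: nat \<Rightarrow> real \<Rightarrow> real ^ 'd)
            (M :: nat \<Rightarrow> 'w measure)
            (\<epsilon> :: nat \<Rightarrow> nat \<Rightarrow> 'w \<Rightarrow> real ^ 'd)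
            (\<theta>\<^sub>0 :: nat \<Rightarrow> 'w \<Rightarrow> real \<Rightarrow> real ^ 'd)
            (\<theta>\<^sub>1 :: nat \<Rightarrow> 'w \<Rightarrow> real \<Rightarrow> real ^ 'd)
            (t_NN :: (real \<Rightarrow> real ^ 'd) \<Rightarrow> real \<Rightarrow> real ^ 'd \<Rightarrow> real).
            optimal_bandwidth c C \<Delta>t T h \<and>
            (\<forall>n\<ge>1. snake_model L\<^sub>0 L\<^sub>1 \<sigma> n (f n) (x\<^sub>1 n) (u n) (M n) (\<epsilon> n)) \<and>
            (\<forall>n\<ge>1. \<forall>\<omega> \<in> space (M n).
               local_linear_fit K (h n) n (\<Delta>t n) (observation (\<Delta>t n) (u n) (\<epsilon> n) \<omega>)
                 (\<theta>\<^sub>0 n \<omega>) (\<theta>\<^sub>1 n \<omega>)) \<and>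
            nearest_neighbor_choice t_NN
          \<longrightarrow>
            (\<forall>\<delta> :: nat \<Rightarrow> real. (\<forall>n. \<delta> n \<ge> 0) \<longrightarrow>
               (\<lambda>n. sup_risk (M n) (\<Union>t\<in>{0..T n}. cball (u n t) (\<delta> n))
                      (\<lambda>\<omega>. nn_estimator t_NN (T n) (h n) (\<theta>\<^sub>0 n \<omega>) (\<theta>\<^sub>1 n \<omega>)) (f n))
               \<preceq> (\<lambda>n. ennreal ((\<delta> n)\<^sup>2 + (T n * ln (real n) / real n) powr (2 / 5)))) \<and>
            (\<forall>\<delta> :: nat \<Rightarrow> real.
               (\<forall>n. \<delta> n = (SUP x\<in>{x. \<forall>j. x $ j \<in> {0..1}}. INF t\<in>{0..T n}. norm (u n t - x))) \<longrightarrow>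
               (\<lambda>n. sup_risk (M n) {x. \<forall>j. x $ j \<in> {0..1}}
                      (\<lambda>\<omega>. nn_estimator t_NN (T n) (h n) (\<theta>\<^sub>0 n \<omega>) (\<theta>\<^sub>1 n \<omega>)) (f n))
               \<preceq> (\<lambda>n. ennreal ((\<delta> n)\<^sup>2 + (T n * ln (real n) / real n) powr (2 / 5))))))"
proof -
  obtain B L a b \<kappa> where "kernel_bounds K B L a b \<kappa>"
    using admissible_kernel_bounds[OF \<open>admissible_kernel K\<close>] by metis
  then interpret kernel_bounds K B L a b \<kappa> .
  obtain A where "A > 0" and risk:
    "\<And>n \<Delta>t h f x\<^sub>1 u (M :: 'w measure) (\<epsilon> :: nat \<Rightarrow> 'w \<Rightarrow> real ^ 'd) \<theta>\<^sub>0 \<theta>\<^sub>1 t_NN \<delta> X.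
      n \<ge> 3 \<Longrightarrow> 0 < \<Delta>t \<Longrightarrow> 6 / (b - a) * \<Delta>t \<le> h \<Longrightarrow> h \<le> real n * \<Delta>t / 2 \<Longrightarrow>
      snake_model L\<^sub>0 L\<^sub>1 \<sigma> n f x\<^sub>1 u M \<epsilon> \<Longrightarrow>
      (\<And>\<omega>. \<omega> \<in> space M \<Longrightarrow>
        local_linear_fit K h n \<Delta>t (observation \<Delta>t u \<epsilon> \<omega>) (\<theta>\<^sub>0 \<omega>) (\<theta>\<^sub>1 \<omega>)) \<Longrightarrow>
      nearest_neighbor_choice t_NN \<Longrightarrow>
      X \<subseteq> (\<Union>t\<in>{0..real n * \<Delta>t}. cball (u t) \<delta>) \<Longrightarrow>
      sup_risk M X (\<lambda>\<omega>. nn_estimator t_NN (real n * \<Delta>t) h (\<theta>\<^sub>0 \<omega>) (\<theta>\<^sub>1 \<omega>)) f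
        \<le> ennreal (A * (\<delta>\<^sup>2 + h\<^sup>2 + \<Delta>t * ln (real n) / h ^ 3))"
    using sup_risk_le[OF assms(2-4)] by blast
  have C: "6 / (b - a) > 0" using ab by simp
  show ?thesis
  proof (rule exI[of _ "1 / 2"], rule exI[of _ "6 / (b - a)"], intro conjI allI impI C)
    fix \<Delta>t T :: "nat \<Rightarrow> real"
    assume *: "(\<forall>n\<ge>1. \<Delta>t n > 0 \<and> T n = real n * \<Delta>t n) \<and>
         (\<lambda>n. ennreal ((real n / ln (real n)) powr (- (1 / 4)))) \<preceq> (\<lambda>n. ennreal (T n)) \<and>
         (\<lambda>n. ennreal (T n)) \<preceq> (\<lambda>n. ennreal (real n * ln (real n) powr (1 / 4)))"
    then have pos: "\<And>n. n \<ge> 1 \<Longrightarrow> \<Delta>t n > 0" and T: "\<And>n. n \<ge> 1 \<Longrightarrow> T n = real n * \<Delta>t n" by auto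
    show "\<exists>h. optimal_bandwidth (1 / 2) (6 / (b - a)) \<Delta>t T h"
      using * by (intro optimal_bandwidth_exists C pos T) auto
    fix h and f :: "nat \<Rightarrow> real ^ 'd \<Rightarrow> real ^ 'd" and x\<^sub>1 :: "nat \<Rightarrow> real ^ 'd"
      and u :: "nat \<Rightarrow> real \<Rightarrow> real ^ 'd" and M :: "nat \<Rightarrow> 'w measure"
      and \<epsilon> :: "nat \<Rightarrow> nat \<Rightarrow> 'w \<Rightarrow> real ^ 'd"
      and \<theta>\<^sub>0 \<theta>\<^sub>1 :: "nat \<Rightarrow> 'w \<Rightarrow> real \<Rightarrow> real ^ 'd"
      and t_NN :: "(real \<Rightarrow> real ^ 'd) \<Rightarrow> real \<Rightarrow> real ^ 'd \<Rightarrow> real"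
    assume "optimal_bandwidth (1 / 2) (6 / (b - a)) \<Delta>t T h \<and>
            (\<forall>n\<ge>1. snake_model L\<^sub>0 L\<^sub>1 \<sigma> n (f n) (x\<^sub>1 n) (u n) (M n) (\<epsilon> n)) \<and>
            (\<forall>n\<ge>1. \<forall>\<omega> \<in> space (M n).
               local_linear_fit K (h n) n (\<Delta>t n) (observation (\<Delta>t n) (u n) (\<epsilon> n) \<omega>)
                 (\<theta>\<^sub>0 n \<omega>) (\<theta>\<^sub>1 n \<omega>)) \<and>
            nearest_neighbor_choice t_NN"
    then have h: "optimal_bandwidth (1 / 2) (6 / (b - a)) \<Delta>t T h"
      and model: "\<And>n. n \<ge> 1 \<Longrightarrow> snake_model L\<^sub>0 L\<^sub>1 \<sigma> n (f n) (x\<^sub>1 n) (u n) (M n) (\<epsilon> n)"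
      and fit: "\<And>n \<omega>. n \<ge> 1 \<Longrightarrow> \<omega> \<in> space (M n) \<Longrightarrow>
        local_linear_fit K (h n) n (\<Delta>t n) (observation (\<Delta>t n) (u n) (\<epsilon> n) \<omega>) (\<theta>\<^sub>0 n \<omega>) (\<theta>\<^sub>1 n \<omega>)"
      and NN: "nearest_neighbor_choice t_NN"
      by auto
    obtain A' where "A' > 0" and order:
      "\<forall>\<^sub>F n in sequentially. \<forall>\<delta>. \<delta>\<^sup>2 + (h n)\<^sup>2 + \<Delta>t n * ln (real n) / h n ^ 3
        \<le> A' * (\<delta>\<^sup>2 + (T n * ln (real n) / real n) powr (2 / 5))"
      using optimal_bandwidth_order[OF h pos T] by blast
    have window: "\<forall>\<^sub>F n in sequentially. 6 / (b - a) * \<Delta>t n \<le> h n \<and> h n \<le> 1 / 2 * T n"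
      using h by (simp add: optimal_bandwidth_def)
    \<comment> \<open>The finite-sample bound holds once n \<ge> 3 and the window conditions have
      set in, which is enough for a limsup.\<close>
    have main: "(\<lambda>n. sup_risk (M n) (X n)
          (\<lambda>\<omega>. nn_estimator t_NN (T n) (h n) (\<theta>\<^sub>0 n \<omega>) (\<theta>\<^sub>1 n \<omega>)) (f n))
        \<preceq> (\<lambda>n. ennreal ((\<delta> n)\<^sup>2 + (T n * ln (real n) / real n) powr (2 / 5)))"
      if X: "\<And>n. n \<ge> 1 \<Longrightarrow> X n \<subseteq> (\<Union>t\<in>{0..T n}. cball (u n t) (\<delta> n))" for X \<delta>
    proof (rule asymp_leI)
      show "\<forall>\<^sub>F n in sequentially. sup_risk (M n) (X n)
            (\<lambda>\<omega>. nn_estimator t_NN (T n) (h n) (\<theta>\<^sub>0 n \<omega>) (\<theta>\<^sub>1 n \<omega>)) (f n)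
          \<le> ennreal (A * A' * ((\<delta> n)\<^sup>2 + (T n * ln (real n) / real n) powr (2 / 5)))"
        using order window eventually_ge_at_top[of 3]
      proof eventually_elim
        case (elim n)
        then have n: "n \<ge> 1" by simp
        have "sup_risk (M n) (X n)
            (\<lambda>\<omega>. nn_estimator t_NN (real n * \<Delta>t n) (h n) (\<theta>\<^sub>0 n \<omega>) (\<theta>\<^sub>1 n \<omega>)) (f n)
          \<le> ennreal (A * ((\<delta> n)\<^sup>2 + (h n)\<^sup>2 + \<Delta>t n * ln (real n) / h n ^ 3))"
          using elim X[OF n] T[OF n]
          by (intro risk[OF _ _ _ _ model[OF n] fit[OF n] NN] pos n) auto
        also have "\<dots> \<le> ennreal (A * (A' * ((\<delta> n)\<^sup>2 + (T n * ln (real n) / real n) powr (2 / 5))))"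
          using elim(1) \<open>A > 0\<close> by (intro ennreal_leI mult_left_mono) auto
        finally show ?case using T[OF n] by (simp add: mult.assoc)
      qed
    qed (use \<open>A > 0\<close> \<open>A' > 0\<close> in auto)
    show "(\<lambda>n. sup_risk (M n) (\<Union>t\<in>{0..T n}. cball (u n t) (\<delta> n))
            (\<lambda>\<omega>. nn_estimator t_NN (T n) (h n) (\<theta>\<^sub>0 n \<omega>) (\<theta>\<^sub>1 n \<omega>)) (f n))
        \<preceq> (\<lambda>n. ennreal ((\<delta> n)\<^sup>2 + (T n * ln (real n) / real n) powr (2 / 5)))" for \<delta>
      by (rule main) simp
    show "(\<lambda>n. sup_risk (M n) {x. \<forall>j. x $ j \<in> {0..1}}
            (\<lambda>\<omega>. nn_estimator t_NN (T n) (h n) (\<theta>\<^sub>0 n \<omega>) (\<theta>\<^sub>1 n \<omega>)) (f n))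
        \<preceq> (\<lambda>n. ennreal ((\<delta> n)\<^sup>2 + (T n * ln (real n) / real n) powr (2 / 5)))"
      if "\<forall>n. \<delta> n = (SUP x\<in>{x. \<forall>j. x $ j \<in> {0..1}}. INF t\<in>{0..T n}. norm (u n t - x))" for \<delta>
    proof (rule main)
      fix n :: nat assume n: "n \<ge> 1"
      have "is_flow (f n) (x\<^sub>1 n) (u n)" using model[OF n] by (simp add: snake_model_def)
      moreover have "T n \<ge> 0" using T[OF n] pos[OF n] by simp
      ultimately show "{x. \<forall>j. x $ j \<in> {0..1}} \<subseteq> (\<Union>t\<in>{0..T n}. cball (u n t) (\<delta> n))"
        using that by (intro cube_subset_tube is_flow_continuous_on) auto
    qed
  qed auto
qed

end
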